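(* Let $n\ge 3$ and let $\Omega\subset\mathbb{R}^n$ be a bounded domain with smooth boundary containing the origin. Let $u$ be a solution to $$-\Delta u=0\ \text{ in }\mathbb{R}^n\setminus\overline\Omega,\qquad u=1\ \text{ on }\partial\Omega,\qquad u(x)\to 0\ \text{ as }|x|\to\infty ,$$ satisfying $$|Du|=d\ \text{ on }\{u=c\}\qquad\text{and}\qquad \inf_{\{u=c\}}\frac{H}{n-1}\le\frac{|Du|}{(n-2)\,u}\ \text{ on }\{u=c\},$$ for some $0<c\le 1$ and some $d>0$. Then $\Omega$ is a ball and $u$ is rotationally symmetric.
   Context: $D$ and $\Delta$ are the Euclidean gradient and Laplacian. $\{u=c\}$ denotes $\{x\in\mathbb{R}^n\setminus\Omega: u(x)=c\}$. $H$ is the mean curvature of the hypersurface $\{u=c\}$ with respect to the normal pointing towards the interior of $\{u\le c\}$, that is $\nu=-Du/|Du|$: the sum of the $n-1$ principal curvatures (not their average), with the sign convention that a round sphere with its outward normal has positive mean curvature; $H=D^2u(\nu,\nu)/|Du|$. Rotationally symmetric means depending only on the distance to the center of the ball $\Omega$.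
   Formalization: For c<1 the exterior of the closure of Ω is assumed connected; otherwise a ball with a small hole where u=1 is a counterexample. For c=1, u is assumed C² up to ∂Ω, so that Du and H make sense on {u=1} (automatic by elliptic regularity). *)

theory Defs
  imports "HOL-Analysis.Analysis"
begin

text \<open>All derivatives are Frechet derivatives relative to a set \<open>S\<close>. For interior points of \<open>S\<close> these are
  the ordinary ones. The relevant closed \<open>S\<close> is the complement of a domain with smooth boundary, where
  the relative derivative is unique also at boundary points and is the one-sided derivative up to
  the boundary.\<close>

primrec higher_differentiable_on ::
    "'a::real_normed_vector set \<Rightarrow> ('a \<Rightarrow> 'b::real_normed_vector) \<Rightarrow> nat \<Rightarrow> bool" where
  "higher_differentiable_on S f 0 \<longleftrightarrow> continuous_on S f"
| "higher_differentiable_on S f (Suc k) \<longleftrightarrow>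
     f differentiable_on S \<and>
     (\<forall>v. higher_differentiable_on S (\<lambda>x. frechet_derivative f (at x within S) v) k)"

definition grad_within :: "'a::euclidean_space set \<Rightarrow> ('a \<Rightarrow> real) \<Rightarrow> 'a \<Rightarrow> 'a" where
  "grad_within S u x = (\<Sum>b\<in>Basis. frechet_derivative u (at x within S) b *\<^sub>R b)"

definition hessian :: "('a::euclidean_space \<Rightarrow> real) \<Rightarrow> 'a \<Rightarrow> 'a \<Rightarrow> 'a \<Rightarrow> real" where
  "hessian u x v w = frechet_derivative (\<lambda>y. frechet_derivative u (at y) w) (at x) v"

definition laplacian :: "('a::euclidean_space \<Rightarrow> real) \<Rightarrow> 'a \<Rightarrow> real" where
  "laplacian u x = (\<Sum>b\<in>Basis. hessian u x b b)"

text \<open>Local defining functions: near each boundary point the set is a strict sublevel set of a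
  smooth function without critical points, so the set lies on one side of its boundary.\<close>

definition smooth_boundary :: "'a::euclidean_space set \<Rightarrow> bool" where
  "smooth_boundary \<Omega> \<longleftrightarrow>
     (\<forall>p\<in>frontier \<Omega>. \<exists>U (\<rho>::'a \<Rightarrow> real).
        open U \<and> p \<in> U \<and> (\<forall>k. higher_differentiable_on U \<rho> k) \<and>
        (\<forall>x\<in>U. grad_within U \<rho> x \<noteq> 0) \<and> \<Omega> \<inter> U = {x \<in> U. \<rho> x < 0})"

definition level_set :: "'a::euclidean_space set \<Rightarrow> ('a \<Rightarrow> real) \<Rightarrow> real \<Rightarrow> 'a set" where
  "level_set \<Omega> u c = {x. x \<notin> \<Omega> \<and> u x = c}"

definition unit_normal :: "'a::euclidean_space set \<Rightarrow> ('a \<Rightarrow> real) \<Rightarrow> 'a \<Rightarrow> 'a" where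
  "unit_normal S u x = - (grad_within S u x /\<^sub>R norm (grad_within S u x))"

definition tangential :: "'a::euclidean_space \<Rightarrow> 'a \<Rightarrow> 'a" where
  "tangential \<nu> v = v - (v \<bullet> \<nu>) *\<^sub>R \<nu>"

text \<open>Trace, over the tangent space of the level set of \<open>u\<close> through \<open>x\<close>, of the differential of the unit
  normal field. It is not normalized, and the spheres with outward normal have positive mean
  curvature. The two lemmas at the end identify it with the sum of the principal curvatures and,
  for harmonic \<open>u\<close>, with the quotient of the Hessian in the direction of the normal by the length of
  the gradient.\<close>

definition mean_curvature :: "'a::euclidean_space set \<Rightarrow> ('a \<Rightarrow> real) \<Rightarrow> 'a \<Rightarrow> real" where
  "mean_curvature S u x =
     (\<Sum>b\<in>Basis.
        frechet_derivative (unit_normal S u) (at x within S) (tangential (unit_normal S u x) b)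
          \<bullet> tangential (unit_normal S u x) b)"

lemma mean_curvature_eq_sum_principal_curvatures:
  fixes S :: "'a::euclidean_space set" and u :: "'a \<Rightarrow> real" and x :: 'a
    and E :: "'a set" and \<kappa> :: "'a \<Rightarrow> real"
  defines "\<nu> \<equiv> unit_normal S u x"
  defines "W \<equiv> frechet_derivative (unit_normal S u) (at x within S)"
  assumes diff: "unit_normal S u differentiable (at x within S)"
    and fin: "finite E" and orth: "pairwise orthogonal E" and unit: "\<And>e. e \<in> E \<Longrightarrow> norm e = 1"
    and span: "span E = {v. v \<bullet> \<nu> = 0}" and nu: "norm \<nu> = 1"
    and principal: "\<And>e. e \<in> E \<Longrightarrow> tangential \<nu> (W e) = \<kappa> e *\<^sub>R e"
  shows "mean_curvature S u x = (\<Sum>e\<in>E. \<kappa> e)"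
proof -
  have lin: "linear W"
    unfolding W_def by (rule linear_frechet_derivative[OF diff])
  have inner_E: "e \<bullet> e' = (if e = e' then 1 else 0)" if "e \<in> E" "e' \<in> E" for e e'
    using that orth unit by (auto simp: pairwise_def orthogonal_def norm_eq_1)
  have perp: "e \<bullet> \<nu> = 0" if "e \<in> E" for e
    using span span_base[OF that] by auto
  have tang: "tangential \<nu> v = (\<Sum>e\<in>E. (v \<bullet> e) *\<^sub>R e)" for v
  proof -
    have "\<nu> \<bullet> \<nu> = 1"
      using nu by (simp add: norm_eq_1)
    then have "tangential \<nu> v \<in> span E"
      unfolding span by (simp add: tangential_def inner_diff_left)
    moreover have "(\<Sum>e\<in>E. (v \<bullet> e) *\<^sub>R e) \<in> span E"
      by (intro span_sum span_scale span_base)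
    ultimately have 1: "tangential \<nu> v - (\<Sum>e\<in>E. (v \<bullet> e) *\<^sub>R e) \<in> span E"
      by (rule span_diff)
    have "orthogonal (tangential \<nu> v - (\<Sum>e\<in>E. (v \<bullet> e) *\<^sub>R e)) e" if e: "e \<in> E" for e
    proof -
      have "(\<Sum>e'\<in>E. (v \<bullet> e') *\<^sub>R e') \<bullet> e = (\<Sum>e'\<in>E. if e' = e then v \<bullet> e' else 0)"
        unfolding inner_sum_left by (rule sum.cong) (auto simp: inner_E e)
      then show ?thesis
        using e fin perp[OF e]
        by (simp add: orthogonal_def tangential_def inner_diff_left inner_commute[of \<nu>])
    qed
    with 1 have "orthogonal (tangential \<nu> v - (\<Sum>e\<in>E. (v \<bullet> e) *\<^sub>R e))
        (tangential \<nu> v - (\<Sum>e\<in>E. (v \<bullet> e) *\<^sub>R e))"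
      using orthogonal_to_span by blast
    then show ?thesis
      by (simp add: orthogonal_def)
  qed
  have "mean_curvature S u x = (\<Sum>b\<in>Basis. W (tangential \<nu> b) \<bullet> tangential \<nu> b)"
    by (simp add: mean_curvature_def \<nu>_def W_def)
  also have "\<dots> = (\<Sum>b\<in>Basis. \<Sum>e\<in>E. \<Sum>e'\<in>E. (b \<bullet> e) * (b \<bullet> e') * (W e' \<bullet> e))"
    by (simp add: tang linear_sum[OF lin] linear_cmul[OF lin] inner_sum_left inner_sum_right
        sum_distrib_left mult_ac)
  also have "\<dots> = (\<Sum>e\<in>E. \<Sum>e'\<in>E. (\<Sum>b\<in>Basis. (e \<bullet> b) * (e' \<bullet> b)) * (W e' \<bullet> e))"
    by (subst sum.swap, rule sum.cong[OF refl], subst sum.swap)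
      (simp add: sum_distrib_right inner_commute)
  also have "\<dots> = (\<Sum>e\<in>E. \<Sum>e'\<in>E. if e' = e then W e' \<bullet> e else 0)"
    by (intro sum.cong refl) (auto simp flip: euclidean_inner simp: inner_E)
  also have "\<dots> = (\<Sum>e\<in>E. W e \<bullet> e)"
    using fin by simp
  also have "\<dots> = (\<Sum>e\<in>E. \<kappa> e)"
  proof (rule sum.cong[OF refl])
    fix e assume e: "e \<in> E"
    have "W e \<bullet> e = tangential \<nu> (W e) \<bullet> e"
      using perp[OF e] by (simp add: tangential_def inner_diff_left inner_commute[of \<nu>])
    then show "W e \<bullet> e = \<kappa> e"
      using e by (simp add: principal inner_E)
  qed
  finally show ?thesis .
qed

lemma mean_curvature_eq_hessian:
  fixes u :: "'a::euclidean_space \<Rightarrow> real"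
  assumes S: "open S" "x \<in> S" and C2: "higher_differentiable_on S u 2"
    and nz: "grad_within S u x \<noteq> 0"
  shows "mean_curvature S u x =
    (hessian u x (unit_normal S u x) (unit_normal S u x) - laplacian u x)
      / norm (grad_within S u x)"
proof -
  define g where "g = grad_within S u"
  define \<nu> where "\<nu> = unit_normal S u x"
  have at: "at y within S = at y" if "y \<in> S" for y
    using that S(1) by (rule at_within_open)
  have C1: "u differentiable at y" if "y \<in> S" for y
    using C2 that at[OF that] by (auto simp: numeral_2_eq_2 differentiable_on_def)
  have linu: "linear (frechet_derivative u (at y))" if "y \<in> S" for y
    by (rule linear_frechet_derivative[OF C1[OF that]])
  have d2: "((\<lambda>y. frechet_derivative u (at y) v) has_derivative (\<lambda>w. hessian u x w v)) (at x)" for v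
  proof -
    have "(\<lambda>y. frechet_derivative u (at y within S) v) differentiable (at x within S)"
      using C2 S(2) by (simp add: numeral_2_eq_2 differentiable_on_def)
    then have "(\<lambda>y. frechet_derivative u (at y within S) v) differentiable (at x)"
      by (simp only: at[OF S(2)])
    then have *: "((\<lambda>y. frechet_derivative u (at y within S) v) has_derivative D) (at x)"
      if "D = frechet_derivative (\<lambda>y. frechet_derivative u (at y within S) v) (at x)" for D
      using that by (simp add: frechet_derivative_works)
    have D: "((\<lambda>y. frechet_derivative u (at y) v) has_derivative D) (at x)"
      if "D = frechet_derivative (\<lambda>y. frechet_derivative u (at y within S) v) (at x)" for D
      by (rule has_derivative_transform_within_open[OF *[OF that] S]) (simp add: at)
    from frechet_derivative_at[OF D[OF refl]] D[OF refl] show ?thesis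
      unfolding hessian_def by (metis (full_types) frechet_derivative_at ext)
  qed
  have g_eq: "g y \<bullet> w = frechet_derivative u (at y) w" if "y \<in> S" for y w
  proof -
    have "g y \<bullet> w = (\<Sum>b\<in>Basis. (w \<bullet> b) * frechet_derivative u (at y) b)"
      by (simp add: g_def grad_within_def inner_sum_left at[OF that] inner_commute[of w] mult.commute)
    also have "\<dots> = frechet_derivative u (at y) (\<Sum>b\<in>Basis. (w \<bullet> b) *\<^sub>R b)"
      by (simp add: linear_sum[OF linu[OF that]] linear_cmul[OF linu[OF that]])
    finally show ?thesis
      by (simp add: euclidean_representation)
  qed
  define A where "A = (\<lambda>v. \<Sum>b\<in>Basis. hessian u x v b *\<^sub>R b)"
  have dg: "(g has_derivative A) (at x)"
  proof (rule has_derivative_transform_within_open[OF _ S])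
    show "((\<lambda>y. \<Sum>b\<in>Basis. frechet_derivative u (at y) b *\<^sub>R b) has_derivative A) (at x)"
      unfolding A_def by (intro has_derivative_sum has_derivative_scaleR_left d2)
  qed (simp add: g_def grad_within_def at)
  have A_eq: "A v \<bullet> w = hessian u x v w" for v w
  proof -
    have "((\<lambda>y. g y \<bullet> w) has_derivative (\<lambda>v. A v \<bullet> w)) (at x)"
      by (rule has_derivative_inner_left[OF dg])
    then have "((\<lambda>y. frechet_derivative u (at y) w) has_derivative (\<lambda>v. A v \<bullet> w)) (at x)"
      by (rule has_derivative_transform_within_open[OF _ S]) (simp add: g_eq)
    from has_derivative_unique[OF this d2] show ?thesis
      by metis
  qed
  have linA: "linear A"
    using dg by (rule has_derivative_linear)
  have gx: "g x \<noteq> 0"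
    using nz by (simp add: g_def)
  have nu: "\<nu> = - (g x /\<^sub>R norm (g x))"
    by (simp add: \<nu>_def unit_normal_def g_def)
  have nunu: "\<nu> \<bullet> \<nu> = 1"
    using gx by (simp add: nu dot_square_norm power2_eq_square)
  obtain n' where n': "((\<lambda>y. inverse (norm (g y))) has_derivative n') (at x)"
  proof -
    have "(\<lambda>y. norm (g y)) differentiable (at x)"
      using has_derivative_compose[OF dg has_derivative_norm[OF gx]] by (auto simp: differentiable_def)
    then have "(\<lambda>y. inverse (norm (g y))) differentiable (at x)"
      using gx by (intro differentiable_inverse) auto
    then show ?thesis
      using that by (auto simp: differentiable_def)
  qed
  have dnu: "(unit_normal S u has_derivative
      (\<lambda>v. - (inverse (norm (g x)) *\<^sub>R A v + n' v *\<^sub>R g x))) (at x)"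
    using has_derivative_minus[OF has_derivative_scaleR[OF n' dg]]
    by (simp add: unit_normal_def[abs_def] g_def)
  have W: "frechet_derivative (unit_normal S u) (at x within S) v \<bullet> w = - (A v \<bullet> w) / norm (g x)"
    if "w \<bullet> \<nu> = 0" for v w
  proof -
    have "g x \<bullet> w = 0"
      using that gx by (simp add: nu inner_commute)
    then show ?thesis
      by (simp add: at[OF S(2)] frechet_derivative_at[OF dnu, symmetric] inner_diff_left
        divide_inverse mult.commute)
  qed
  have tang: "tangential \<nu> b \<bullet> \<nu> = 0" for b
    by (simp add: tangential_def inner_diff_left nunu)
  have 1: "(\<Sum>b\<in>Basis. (b \<bullet> \<nu>) * (A \<nu> \<bullet> b)) = A \<nu> \<bullet> \<nu>"
    by (subst (2) euclidean_inner) (simp add: inner_commute mult.commute)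
  have 2: "(\<Sum>b\<in>Basis. (b \<bullet> \<nu>) * (A b \<bullet> \<nu>)) = A \<nu> \<bullet> \<nu>"
  proof -
    have "(\<Sum>b\<in>Basis. (b \<bullet> \<nu>) * (A b \<bullet> \<nu>)) = A (\<Sum>b\<in>Basis. (\<nu> \<bullet> b) *\<^sub>R b) \<bullet> \<nu>"
      by (simp add: linear_sum[OF linA] linear_cmul[OF linA] inner_sum_right inner_commute[of _ \<nu>])
    then show ?thesis
      by (simp add: euclidean_representation)
  qed
  have 3: "(\<Sum>b\<in>Basis. (b \<bullet> \<nu>) * (b \<bullet> \<nu>)) = 1"
    using nunu by (subst (asm) euclidean_inner) (simp add: inner_commute)
  have "mean_curvature S u x =
      (\<Sum>b\<in>Basis. - (A (tangential \<nu> b) \<bullet> tangential \<nu> b) / norm (g x))"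
    unfolding mean_curvature_def \<nu>_def[symmetric] using W[OF tang] by simp
  also have "\<dots> = - (\<Sum>b\<in>Basis. A (tangential \<nu> b) \<bullet> tangential \<nu> b) / norm (g x)"
    by (simp add: sum_negf sum_divide_distrib)
  also have "(\<Sum>b\<in>Basis. A (tangential \<nu> b) \<bullet> tangential \<nu> b) =
      (\<Sum>b\<in>Basis. A b \<bullet> b - (b \<bullet> \<nu>) * (A b \<bullet> \<nu>) - (b \<bullet> \<nu>) * (A \<nu> \<bullet> b)
        + ((b \<bullet> \<nu>) * (b \<bullet> \<nu>)) * (A \<nu> \<bullet> \<nu>))"
    by (simp add: tangential_def linear_diff[OF linA] linear_cmul[OF linA] inner_diff_left
        inner_diff_right algebra_simps)
  also have "\<dots> = (\<Sum>b\<in>Basis. A b \<bullet> b) - A \<nu> \<bullet> \<nu>"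
    by (simp add: sum.distrib sum_subtractf 1 2 3 flip: sum_distrib_right)
  finally show ?thesis
    by (simp add: A_eq laplacian_def g_def \<nu>_def)
qed

end

theory Submission
  imports Defs
begin

text \<open>Write \<open>n\<close> for the dimension and \<open>Q = |Du|\<^sup>2 u powr (- n / (n - 2))\<close>. For \<open>u = \<kappa> |x - p|\<^sup>2\<^sup>-\<^sup>n\<close> the quotient
  \<open>Q / u\<close> is constant. For an arbitrary positive harmonic \<open>u\<close> the function \<open>Q\<close> is subharmonic: its
  Laplacian is \<open>2 u powr (- n / (n - 2))\<close> times the squared distance of the Hessian of \<open>u\<close> from the
  Hessian that such a radial solution with the same value and gradient would have
  (\<open>grad_power_subharmonic\<close>).

  On \<open>{u = c}\<close> the gradient condition makes \<open>Q / u\<close> a constant \<open>P\<close>. Hence \<open>w = Q - P u\<close> is subharmonic in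
  \<open>{u < c}\<close> and vanishes on \<open>{u = c}\<close>. It also has nonpositive upper limit at infinity, because the gradient estimate
  and the comparison with \<open>|x|\<^sup>2\<^sup>-\<^sup>n\<close> give \<open>Q \<le> C u\<close> there (\<open>exterior_potential_bounds\<close>). So \<open>w \<le> 0\<close>.
  The derivative of \<open>w\<close> at \<open>{u = c}\<close>, in the direction of decreasing \<open>u\<close>, is a positive multiple of
  \<open>|Du| / ((n - 2) u) - H / (n - 1)\<close>. At a point of \<open>{u = c}\<close> where \<open>H\<close> is smallest the curvature condition
  makes it nonnegative, and the Hopf lemma then forces \<open>w\<close> to vanish somewhere inside \<open>{u < c}\<close>. By the
  strong maximum principle \<open>w = 0\<close> on a ball. There the Hessian of \<open>u\<close> is the radial one, and integrating
  this identity gives \<open>u = \<kappa> |x - p|\<^sup>2\<^sup>-\<^sup>n\<close> on the ball (\<open>rigidity\<close>). Unique continuation carries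
  the formula to the whole exterior, and the boundary value 1 forces \<open>\<Omega>\<close> to be a ball around \<open>p\<close>
  (\<open>domain_is_ball\<close>).

  The Laplacian of \<open>Q\<close> contains third derivatives, and unique continuation needs real analyticity,
  while \<open>u\<close> is only given to be twice differentiable. Both are obtained from maximum principles without any
  integration: comparison with a quadratic polynomial on a half ball bounds the gradient by the
  supremum; applied to difference quotients, this bound shows that the partial derivatives are harmonic
  again; iterated, it bounds all derivatives well enough for Taylor expansions to converge.\<close>

section \<open>Directional derivatives and harmonic functions\<close>

text \<open>The direction comes first, so that \<open>pd b (pd b u)\<close> and \<open>pd v ^^ k\<close> are iterated derivatives; for basis
  vectors these are the terms of \<open>laplacian\<close>.\<close>

definition pd :: "'a::euclidean_space \<Rightarrow> ('a \<Rightarrow> real) \<Rightarrow> 'a \<Rightarrow> real" where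
  "pd v u x = frechet_derivative u (at x) v"

text \<open>Maximum principles only use the restrictions of a function to lines parallel to the axes, so the
  derivatives are given as data along such lines. The function \<open>Q\<close> can then be treated with
  one-variable calculus.\<close>

definition second_partials ::
    "'a::euclidean_space set \<Rightarrow> ('a \<Rightarrow> real) \<Rightarrow> ('a \<Rightarrow> 'a \<Rightarrow> real) \<Rightarrow> ('a \<Rightarrow> 'a \<Rightarrow> real) \<Rightarrow> bool" where
  "second_partials S w w1 w2 \<longleftrightarrow> (\<forall>x\<in>S. \<forall>b\<in>Basis.
     ((\<lambda>t. w (x + t *\<^sub>R b)) has_real_derivative w1 x b) (at 0) \<and>
     ((\<lambda>t. w1 (x + t *\<^sub>R b) b) has_real_derivative w2 x b) (at 0))"

text \<open>Continuity of the second derivatives is not part of the definition; it follows from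
  \<open>harmonic_on_pd\<close>.\<close>

definition harmonic_on :: "'a::euclidean_space set \<Rightarrow> ('a \<Rightarrow> real) \<Rightarrow> bool" where
  "harmonic_on S u \<longleftrightarrow> open S \<and> (\<forall>x\<in>S. u differentiable (at x) \<and>
     (\<forall>b\<in>Basis. pd b u differentiable (at x)) \<and> (\<Sum>b\<in>Basis. pd b (pd b u) x) = 0)"

lemma has_derivative_along_line:
  fixes f :: "'a::real_normed_vector \<Rightarrow> real"
  assumes "(f has_derivative f') (at (x + s *\<^sub>R v))"
  shows "((\<lambda>t. f (x + t *\<^sub>R v)) has_real_derivative f' v) (at s)"
proof -
  have "((\<lambda>t. x + t *\<^sub>R v) has_derivative (\<lambda>t. t *\<^sub>R v)) (at s)"
    by (auto intro!: derivative_eq_intros)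
  from has_derivative_compose[OF this assms]
  have "((\<lambda>t. f (x + t *\<^sub>R v)) has_derivative (\<lambda>t. f' (t *\<^sub>R v))) (at s)" .
  moreover have "f' (t *\<^sub>R v) = f' v * t" for t
    using has_derivative_linear[OF assms] by (simp add: linear_cmul)
  ultimately show ?thesis
    by (simp add: has_field_derivative_def)
qed

lemma pd_eqI: "(f has_derivative f') (at x) \<Longrightarrow> pd v f x = f' v"
  unfolding pd_def using frechet_derivative_at by metis

lemma has_derivative_pd: "f differentiable (at x) \<Longrightarrow> (f has_derivative (\<lambda>v. pd v f x)) (at x)"
  unfolding pd_def by (simp add: frechet_derivative_works)

lemma pd_sum_Basis:
  assumes "f differentiable (at x)"
  shows "pd v f x = (\<Sum>b\<in>Basis. (v \<bullet> b) * pd b f x)"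
proof -
  have l: "linear (\<lambda>v. pd v f x)"
    using has_derivative_linear[OF has_derivative_pd[OF assms]] .
  have "pd v f x = pd (\<Sum>b\<in>Basis. (v \<bullet> b) *\<^sub>R b) f x"
    by (simp add: euclidean_representation)
  also have "\<dots> = (\<Sum>b\<in>Basis. (v \<bullet> b) * pd b f x)"
    by (subst linear_sum[OF l]) (simp add: linear_cmul[OF l])
  finally show ?thesis .
qed

lemma pd_cong:
  assumes "open S" "x \<in> S" "\<And>y. y \<in> S \<Longrightarrow> f y = g y"
  shows "pd v f x = pd v g x"
proof -
  have "(f has_derivative f') (at x) \<longleftrightarrow> (g has_derivative f') (at x)" for f'
    using assms by (metis has_derivative_transform_within_open)
  then show ?thesis by (simp add: pd_def frechet_derivative_def)
qed

lemma second_partials_harmonic: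
  assumes "harmonic_on S u"
  shows "second_partials S u (\<lambda>x b. pd b u x) (\<lambda>x b. pd b (pd b u) x)"
  unfolding second_partials_def
proof (intro ballI conjI)
  fix x b :: 'a assume x: "x \<in> S" and b: "b \<in> Basis"
  show "((\<lambda>t. u (x + t *\<^sub>R b)) has_real_derivative pd b u x) (at 0)"
    using assms x has_derivative_along_line[of u "\<lambda>v. pd v u x" x 0 b] has_derivative_pd[of u x]
    by (auto simp: harmonic_on_def)
  show "((\<lambda>t. pd b u (x + t *\<^sub>R b)) has_real_derivative pd b (pd b u) x) (at 0)"
    using assms x b has_derivative_along_line[of "pd b u" "\<lambda>v. pd v (pd b u) x" x 0 b] has_derivative_pd[of "pd b u" x]
    by (auto simp: harmonic_on_def)
qed

lemma harmonic_onI: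
  assumes S: "open S"
    and 1: "\<And>x. x \<in> S \<Longrightarrow> (u has_derivative u' x) (at x)"
    and 2: "\<And>x b. x \<in> S \<Longrightarrow> b \<in> Basis \<Longrightarrow> ((\<lambda>y. u' y b) has_derivative u'' b x) (at x)"
    and 3: "\<And>x. x \<in> S \<Longrightarrow> (\<Sum>b\<in>Basis. u'' b x b) = 0"
  shows "harmonic_on S u"
proof -
  have a: "pd b u x = u' x b" if "x \<in> S" for x b
    using pd_eqI[OF 1[OF that]] .
  have b: "(pd b u has_derivative u'' b x) (at x)" if "x \<in> S" "b \<in> Basis" for x b
    using has_derivative_transform_within_open[OF 2[OF that] S that(1)] a by simp
  show ?thesis
    unfolding harmonic_on_def using S 1 b 3 pd_eqI[OF b] by (auto simp: differentiable_def intro!: exI)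
qed

lemma harmonic_onD:
  assumes "harmonic_on S u" "x \<in> S"
  shows "(u has_derivative (\<lambda>v. pd v u x)) (at x)"
    "b \<in> Basis \<Longrightarrow> (pd b u has_derivative (\<lambda>v. pd v (pd b u) x)) (at x)"
    "(\<Sum>b\<in>Basis. pd b (pd b u) x) = 0"
  using assms has_derivative_pd by (auto simp: harmonic_on_def)

lemma harmonic_on_open: "harmonic_on S u \<Longrightarrow> open S"
  by (simp add: harmonic_on_def)

lemma harmonic_on_subset: "harmonic_on S u \<Longrightarrow> open T \<Longrightarrow> T \<subseteq> S \<Longrightarrow> harmonic_on T u"
  by (auto simp: harmonic_on_def)

lemma harmonic_on_continuous: "harmonic_on S u \<Longrightarrow> continuous_on S u"
  by (meson harmonic_on_def continuous_at_imp_continuous_on differentiable_imp_continuous_within)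

lemma harmonic_on_cong:
  assumes "harmonic_on S u" "\<And>x. x \<in> S \<Longrightarrow> v x = u x"
  shows "harmonic_on S v"
proof (rule harmonic_onI[where u' = "\<lambda>x b. pd b u x" and u'' = "\<lambda>b x v. pd v (pd b u) x"])
  fix x assume x: "x \<in> S"
  show "(v has_derivative (\<lambda>b. pd b u x)) (at x)"
    using has_derivative_transform_within_open[OF harmonic_onD(1)[OF assms(1) x] harmonic_on_open[OF assms(1)] x]
      assms(2) by simp
qed (use assms(1) harmonic_onD(2,3) harmonic_on_open in blast)+

lemma harmonic_on_lincomb:
  assumes f: "harmonic_on S f" and g: "harmonic_on S g"
  shows "harmonic_on S (\<lambda>x. \<alpha> * f x + \<beta> * g x)"
proof (rule harmonic_onI[where u' = "\<lambda>x b. \<alpha> * pd b f x + \<beta> * pd b g x" and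
      u'' = "\<lambda>b x v. \<alpha> * pd v (pd b f) x + \<beta> * pd v (pd b g) x"])
  fix x assume x: "x \<in> S"
  show "((\<lambda>x. \<alpha> * f x + \<beta> * g x) has_derivative (\<lambda>b. \<alpha> * pd b f x + \<beta> * pd b g x)) (at x)"
    by (intro has_derivative_add has_derivative_mult_right harmonic_onD(1)[OF _ x] f g)
  show "((\<lambda>x. \<alpha> * pd b f x + \<beta> * pd b g x) has_derivative (\<lambda>v. \<alpha> * pd v (pd b f) x + \<beta> * pd v (pd b g) x)) (at x)"
    if "b \<in> Basis" for b
    by (intro has_derivative_add has_derivative_mult_right harmonic_onD(2)[OF _ x] f g that)
  show "(\<Sum>b\<in>Basis. \<alpha> * pd b (pd b f) x + \<beta> * pd b (pd b g) x) = 0"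
    using harmonic_onD(3)[OF f x] harmonic_onD(3)[OF g x] by (simp add: sum.distrib flip: sum_distrib_left)
qed (use f harmonic_on_open in auto)

lemma harmonic_on_const: "open S \<Longrightarrow> harmonic_on S (\<lambda>x. c)"
  by (rule harmonic_onI[where u' = "\<lambda>_ _. 0" and u'' = "\<lambda>_ _ _. 0"]) auto

lemma harmonic_on_sum:
  assumes "open S" "\<And>i. i \<in> I \<Longrightarrow> harmonic_on S (f i)"
  shows "harmonic_on S (\<lambda>x. \<Sum>i\<in>I. a i * f i x)"
  using assms(2)
proof (induction I rule: infinite_finite_induct)
  case (insert i I)
  then show ?case
    using harmonic_on_lincomb[of S "f i" "\<lambda>x. \<Sum>i\<in>I. a i * f i x" "a i" 1] by simp
qed (use assms(1) harmonic_on_const in auto)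

text \<open>The two uses are translations and the reflection in a coordinate hyperplane. Each basis vector goes to
  itself or its negative, and the signs cancel in the pure second derivatives.\<close>

lemma harmonic_on_affine:
  assumes u: "harmonic_on S u" and L: "bounded_linear L"
    and sgn: "\<And>b. b \<in> Basis \<Longrightarrow> L b = \<sigma> b *\<^sub>R b \<and> \<sigma> b * \<sigma> b = 1"
  shows "harmonic_on ((\<lambda>x. L x + a) -` S) (\<lambda>x. u (L x + a))"
proof (rule harmonic_onI[where u' = "\<lambda>x b. pd (L b) u (L x + a)" and
      u'' = "\<lambda>b x v. \<sigma> b * pd (L v) (pd b u) (L x + a)"])
  have dL: "((\<lambda>x. L x + a) has_derivative L) (at x)" for x
    using L by (auto intro!: derivative_eq_intros bounded_linear_imp_has_derivative)
  show "open ((\<lambda>x. L x + a) -` S)"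
    using harmonic_on_open[OF u] linear_continuous_on[OF L]
    by (intro open_vimage continuous_on_add continuous_on_const) auto
  fix x assume x: "x \<in> (\<lambda>x. L x + a) -` S"
  then have y: "L x + a \<in> S" by simp
  show "((\<lambda>x. u (L x + a)) has_derivative (\<lambda>b. pd (L b) u (L x + a))) (at x)"
    using has_derivative_compose[OF dL harmonic_onD(1)[OF u y]] .
  have scl: "pd (s *\<^sub>R v) f z = s * pd v f z" if "f differentiable (at z)" for s v f z
    using linear_cmul[OF has_derivative_linear[OF has_derivative_pd[OF that]]] by simp
  show "((\<lambda>x. pd (L b) u (L x + a)) has_derivative (\<lambda>v. \<sigma> b * pd (L v) (pd b u) (L x + a))) (at x)"
    if b: "b \<in> Basis" for b
  proof (rule has_derivative_transform_within_open[OF _ \<open>open ((\<lambda>x. L x + a) -` S)\<close> x])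
    show "((\<lambda>x. \<sigma> b * pd b u (L x + a)) has_derivative (\<lambda>v. \<sigma> b * pd (L v) (pd b u) (L x + a))) (at x)"
      by (intro has_derivative_mult_right has_derivative_compose[OF dL harmonic_onD(2)[OF u y b]])
    show "\<sigma> b * pd b u (L z + a) = pd (L b) u (L z + a)" if "z \<in> (\<lambda>x. L x + a) -` S" for z
      using that sgn[OF b] u by (auto simp: harmonic_on_def scl)
  qed
  have "(\<Sum>b\<in>Basis. \<sigma> b * pd (L b) (pd b u) (L x + a)) = (\<Sum>b\<in>Basis. pd b (pd b u) (L x + a))"
  proof (rule sum.cong[OF refl])
    fix b :: 'a assume b: "b \<in> Basis"
    have "pd b u differentiable (at (L x + a))" using u y b by (simp add: harmonic_on_def)
    then show "\<sigma> b * pd (L b) (pd b u) (L x + a) = pd b (pd b u) (L x + a)"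
      using sgn[OF b] by (simp add: scl flip: mult.assoc)
  qed
  then show "(\<Sum>b\<in>Basis. \<sigma> b * pd (L b) (pd b u) (L x + a)) = 0"
    using harmonic_onD(3)[OF u y] by simp
qed

lemma harmonic_on_translate:
  assumes "harmonic_on S u"
  shows "harmonic_on ((\<lambda>x. x + a) -` S) (\<lambda>x. u (x + a))"
  using harmonic_on_affine[OF assms bounded_linear_ident, of "\<lambda>_. 1" a] by simp

lemma second_partials_lincomb:
  assumes f: "second_partials S f f1 f2" and g: "second_partials S g g1 g2"
  shows "second_partials S (\<lambda>x. f x + a * g x) (\<lambda>x b. f1 x b + a * g1 x b) (\<lambda>x b. f2 x b + a * g2 x b)"
  using assms unfolding second_partials_def
  by (auto intro!: derivative_eq_intros)

lemma second_partials_cong: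
  assumes S: "open S" and f: "second_partials S f f1 f2" and eq: "\<And>x. x \<in> S \<Longrightarrow> h x = f x"
  shows "second_partials S h f1 f2"
  unfolding second_partials_def
proof (intro ballI conjI)
  fix x b :: 'a assume x: "x \<in> S" and b: "b \<in> Basis"
  show "((\<lambda>t. f1 (x + t *\<^sub>R b) b) has_real_derivative f2 x b) (at 0)"
    using f x b by (simp add: second_partials_def)
  have "((\<lambda>t. x + t *\<^sub>R b) \<longlongrightarrow> x + 0 *\<^sub>R b) (nhds 0)" by (intro tendsto_intros filterlim_ident)
  then have "\<forall>\<^sub>F t in nhds 0. x + t *\<^sub>R b \<in> S" using S x by (auto dest: topological_tendstoD)
  then have "\<forall>\<^sub>F t in nhds 0. h (x + t *\<^sub>R b) = f (x + t *\<^sub>R b)" by (rule eventually_mono) (rule eq)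
  from DERIV_cong_ev[OF refl this refl] show "((\<lambda>t. h (x + t *\<^sub>R b)) has_real_derivative f1 x b) (at 0)"
    using f x b by (simp add: second_partials_def)
qed

lemma second_partials_norm_power2:
  "second_partials S (\<lambda>x. x \<bullet> x) (\<lambda>x b. 2 * (x \<bullet> b)) (\<lambda>x b. 2)"
  unfolding second_partials_def
  by (auto intro!: derivative_eq_intros simp: inner_add_left inner_add_right inner_Basis inner_commute)

section \<open>Maximum principles\<close>

lemma second_derivative_test:
  fixes f :: "real \<Rightarrow> real"
  assumes d: "d > 0" and f: "\<And>t. \<bar>t\<bar> < d \<Longrightarrow> (f has_real_derivative f' t) (at t)"
    and f': "(f' has_real_derivative D) (at 0)" and max: "\<And>t. \<bar>t\<bar> < d \<Longrightarrow> f t \<le> f 0"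
  shows "D \<le> 0"
proof (rule ccontr)
  assume "\<not> D \<le> 0"
  then have "D > 0" by simp
  have 0: "f' 0 = 0"
    using DERIV_local_max[OF f[of 0] d] d max by simp
  obtain e where e: "e > 0" "\<And>h. 0 < h \<Longrightarrow> h < e \<Longrightarrow> f' 0 < f' (0 + h)"
    using DERIV_pos_inc_right[OF f' \<open>D > 0\<close>] by blast
  define h where "h = min d e / 2"
  have h: "0 < h" "h < d" "h < e" using d e by (auto simp: h_def min_def)
  obtain z where z: "0 < z" "z < h" "f h - f 0 = (h - 0) * f' z"
    using MVT2[of 0 h f f'] h f by (auto simp: abs_if)
  have "f' z > 0" using e(2)[of z] z h 0 by simp
  with z h have "f h > f 0" by (metis diff_gt_0_iff_gt diff_zero mult_pos_pos)
  then show False using max[of h] h by simp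
qed

text \<open>Adding a small multiple of \<open>|y|\<^sup>2\<close> makes the Laplacian strictly positive, which is impossible at an
  interior maximum by the second derivative test.\<close>

lemma weak_max_bounded:
  fixes w :: "'a::euclidean_space \<Rightarrow> real"
  assumes W: "open W" "bounded W" and cont: "continuous_on (closure W) w"
    and sp: "second_partials W w w1 w2" and sub: "\<And>x. x \<in> W \<Longrightarrow> (\<Sum>b\<in>Basis. w2 x b) \<ge> 0"
    and bd: "\<And>x. x \<in> frontier W \<Longrightarrow> w x \<le> m" and x: "x \<in> W"
  shows "w x \<le> m"
proof (rule ccontr)
  assume "\<not> w x \<le> m"
  then have gt: "w x > m" by simp
  obtain R where R: "R > 0" "\<And>y. y \<in> closure W \<Longrightarrow> norm y \<le> R"
    using bounded_closure[OF W(2)] bounded_pos by metis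
  \<comment> \<open>On the closure of \<open>W\<close> the perturbation is at most half of the gap \<open>w x - m\<close>.\<close>
  define e where "e = (w x - m) / (2 * R^2)"
  have e: "e > 0" using gt R(1) by (simp add: e_def)
  define f where "f = (\<lambda>y. w y + e * (y \<bullet> y))"
  have cf: "continuous_on (closure W) f"
    unfolding f_def by (intro continuous_intros cont)
  have comp: "compact (closure W)" using W(2) by simp
  obtain y where y: "y \<in> closure W" "\<And>z. z \<in> closure W \<Longrightarrow> f z \<le> f y"
    using continuous_attains_sup[OF comp _ cf] x closure_subset by blast
  show False
  proof (cases "y \<in> W")
    case False
    then have "y \<in> frontier W" using y(1) W(1) by (simp add: frontier_def interior_open)
    then have "f y \<le> m + e * R^2"
      using bd[of y] R(2)[OF y(1)] e by (auto simp: f_def dot_square_norm intro!: add_mono power_mono mult_left_mono)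
    also have "\<dots> < w x" using gt R(1) by (simp add: e_def field_simps)
    also have "\<dots> \<le> f x" using e by (simp add: f_def)
    finally show False using y(2)[of x] x closure_subset by force
  next
    case True
    obtain d where d: "d > 0" "ball y d \<subseteq> W" using W(1) True openE by blast
    have spf: "second_partials W f (\<lambda>x b. w1 x b + e * (2 * (x \<bullet> b))) (\<lambda>x b. w2 x b + e * 2)"
      unfolding f_def by (rule second_partials_lincomb[OF sp second_partials_norm_power2])
    have "w2 y b + e * 2 \<le> 0" if b: "b \<in> Basis" for b
    proof (rule second_derivative_test[OF d(1)])
      fix t :: real assume t: "\<bar>t\<bar> < d"
      then have in_W: "y + t *\<^sub>R b \<in> W" using d(2) b by (auto simp: dist_norm)
      show "f (y + t *\<^sub>R b) \<le> f (y + 0 *\<^sub>R b)" using y(2) in_W closure_subset by auto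
      have "((\<lambda>s. f ((y + t *\<^sub>R b) + s *\<^sub>R b)) has_real_derivative w1 (y + t *\<^sub>R b) b + e * (2 * ((y + t *\<^sub>R b) \<bullet> b))) (at 0)"
        using spf in_W b unfolding second_partials_def by blast
      then have "((\<lambda>s. f (y + (s + t) *\<^sub>R b)) has_real_derivative w1 (y + t *\<^sub>R b) b + e * (2 * ((y + t *\<^sub>R b) \<bullet> b))) (at 0)"
        by (simp add: algebra_simps)
      then show "((\<lambda>s. f (y + s *\<^sub>R b)) has_real_derivative w1 (y + t *\<^sub>R b) b + e * (2 * ((y + t *\<^sub>R b) \<bullet> b))) (at t)"
        using DERIV_shift[of "\<lambda>s. f (y + s *\<^sub>R b)" _ 0 t] by simp
    next
      show "((\<lambda>t. w1 (y + t *\<^sub>R b) b + e * (2 * ((y + t *\<^sub>R b) \<bullet> b))) has_real_derivative w2 y b + e * 2) (at 0)"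
        using spf True b unfolding second_partials_def by blast
    qed
    then have "(\<Sum>b\<in>Basis. w2 y b + e * 2) \<le> 0" by (intro sum_nonpos) auto
    moreover have "real DIM('a) * (e * 2) > 0" using e by simp
    ultimately show False using sub[OF True] by (simp only: sum.distrib sum_constant)
  qed
qed

text \<open>Cutting \<open>W\<close> with a large ball reduces this to the bounded case with bound \<open>e\<close>.\<close>

lemma weak_max_unbounded:
  fixes w :: "'a::euclidean_space \<Rightarrow> real"
  assumes W: "open W" and cont: "continuous_on (closure W) w"
    and sp: "second_partials W w w1 w2" and sub: "\<And>x. x \<in> W \<Longrightarrow> (\<Sum>b\<in>Basis. w2 x b) \<ge> 0"
    and bd: "\<And>x. x \<in> frontier W \<Longrightarrow> w x \<le> 0"
    and inf: "\<And>e. e > 0 \<Longrightarrow> \<exists>R. \<forall>x\<in>closure W. norm x \<ge> R \<longrightarrow> w x \<le> e"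
    and x: "x \<in> W"
  shows "w x \<le> 0"
proof (rule field_le_epsilon)
  fix e :: real assume e: "e > 0"
  obtain R where R: "\<And>x. x \<in> closure W \<Longrightarrow> norm x \<ge> R \<Longrightarrow> w x \<le> e" using inf[OF e] by blast
  define V where "V = W \<inter> ball 0 (max R (norm x + 1))"
  have V: "open V" "bounded V" "x \<in> V" "V \<subseteq> W" using W x by (auto simp: V_def bounded_Int)
  have cl: "closure V \<subseteq> closure W" using V by (simp add: closure_mono)
  have "w x \<le> e"
  proof (rule weak_max_bounded[OF V(1,2) continuous_on_subset[OF cont cl], of w1 w2])
    show "second_partials V w w1 w2" using sp V(4) by (auto simp: second_partials_def)
    show "(\<Sum>b\<in>Basis. w2 x b) \<ge> 0" if "x \<in> V" for x using that sub V(4) by blast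
    show "w y \<le> e" if "y \<in> frontier V" for y
    proof (cases "y \<in> frontier W")
      case True then show ?thesis using bd e by force
    next
      case False
      have yc: "y \<in> closure W" "y \<notin> V" using that cl V(1) by (auto simp: frontier_def interior_open)
      then have "y \<in> W" using False W by (simp add: frontier_def interior_open)
      then have "norm y \<ge> R" using yc(2) by (auto simp: V_def)
      then show ?thesis using R yc by blast
    qed
  qed (use V in auto)
  then show "w x \<le> 0 + e" by simp
qed

section \<open>Gradient estimate\<close>

text \<open>The odd part \<open>(u y - u (L y + a)) / 2\<close> of \<open>u\<close> with respect to the hyperplane through \<open>x\<close> orthogonal to \<open>b\<close>
  vanishes on that hyperplane and has the same derivative in direction \<open>b\<close> at \<open>x\<close>. On the half ball it
  is dominated by a harmonic quadratic polynomial that also vanishes at \<open>x\<close>, so the slopes at \<open>x\<close> compare.\<close>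

lemma gradient_estimate:
  fixes u :: "'a::euclidean_space \<Rightarrow> real"
  assumes u: "harmonic_on S u" and sub: "cball x \<delta> \<subseteq> S" and \<delta>: "\<delta> > 0"
    and M: "\<And>y. y \<in> cball x \<delta> \<Longrightarrow> \<bar>u y\<bar> \<le> M" and b: "b \<in> Basis"
  shows "\<bar>pd b u x\<bar> \<le> real DIM('a) * M / \<delta>"
proof -
  have xS: "x \<in> S" using sub \<delta> by (meson centre_in_cball less_imp_le subsetD)
  have key: "pd b u x \<le> real DIM('a) * M / \<delta>"
    if u: "harmonic_on S u" and M: "\<And>y. y \<in> cball x \<delta> \<Longrightarrow> \<bar>u y\<bar> \<le> M" for u
  proof -
    define n where "n = real DIM('a)"
    define L where "L = (\<lambda>y::'a. y - (2 * (y \<bullet> b)) *\<^sub>R b)"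
    define a where "a = (2 * (x \<bullet> b)) *\<^sub>R b"
    have M0: "M \<ge> 0" using M[of x] \<delta> by force
    have bL: "bounded_linear L"
      unfolding L_def by (intro bounded_linear_intros)
    have bb: "b \<bullet> b = 1" using b by simp
    have La: "L y + a - x = L (y - x)" for y by (simp add: L_def a_def algebra_simps inner_diff_left)
    have nL: "norm (L y) = norm y" for y
      unfolding norm_eq_sqrt_inner L_def using bb by (simp add: algebra_simps inner_commute)
    have Lb: "L b = - b" using bb by (simp add: L_def scaleR_2)
    define S' where "S' = (\<lambda>y. L y + a) -` S \<inter> S"
    have hR: "harmonic_on ((\<lambda>y. L y + a) -` S) (\<lambda>y. u (L y + a))"
    proof (rule harmonic_on_affine[OF u bL, where \<sigma> = "\<lambda>c. if c = b then -1 else 1"])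
      fix c :: 'a assume "c \<in> Basis"
      then show "L c = (if c = b then - 1 else 1) *\<^sub>R c \<and> (if c = b then - 1 else 1) * (if c = b then - 1 else 1) = (1::real)"
        using b Lb by (auto simp: L_def inner_not_same_Basis)
    qed
    have oS': "open S'" unfolding S'_def using harmonic_on_open[OF hR] harmonic_on_open[OF u] by auto
    define \<phi> where "\<phi> = (\<lambda>y. (1/2) * u y + (-1/2) * u (L y + a))"
    have h\<phi>: "harmonic_on S' \<phi>"
      unfolding \<phi>_def
      by (intro harmonic_on_lincomb harmonic_on_subset[OF u oS'] harmonic_on_subset[OF hR oS']) (auto simp: S'_def)
    have cb: "cball x \<delta> \<subseteq> S'"
    proof
      fix y assume y: "y \<in> cball x \<delta>"
      then have "L y + a \<in> cball x \<delta>"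
        by (simp add: dist_norm norm_minus_commute[of x] La nL)
      then show "y \<in> S'" using y sub by (auto simp: S'_def)
    qed
    \<comment> \<open>With \<open>s = (y - x) \<bullet> b\<close> the barrier is \<open>M / \<delta>\<^sup>2\<close> times \<open>|y - x|\<^sup>2 + n \<delta> s - n s\<^sup>2\<close>. The Laplacians \<open>2 n\<close> and
      \<open>- 2 n\<close> of the quadratic terms cancel, and \<open>n s (\<delta> - s) \<ge> 0\<close> on the half ball.\<close>
    define \<psi> where "\<psi> = (\<lambda>y::'a. (y - x) \<bullet> (y - x) + n * \<delta> * ((y - x) \<bullet> b) - n * ((y - x) \<bullet> b)\<^sup>2)"
    define \<psi>1 where "\<psi>1 = (\<lambda>y c::'a. 2 * ((y - x) \<bullet> c) + n * \<delta> * (c \<bullet> b) - n * (2 * ((y - x) \<bullet> b) * (c \<bullet> b)))"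
    define \<psi>2 where "\<psi>2 = (\<lambda>(y::'a) c::'a. 2 - n * (2 * (c \<bullet> b) * (c \<bullet> b)))"
    have sp\<psi>: "second_partials S' \<psi> \<psi>1 \<psi>2"
      unfolding second_partials_def \<psi>_def \<psi>1_def \<psi>2_def
      by (auto intro!: derivative_eq_intros simp: inner_add_left inner_diff_left inner_add_right inner_diff_right
          inner_commute algebra_simps)
    define w where "w = (\<lambda>y. \<phi> y + (- M / \<delta>\<^sup>2) * \<psi> y)"
    define W where "W = ball x \<delta> \<inter> {y. (y - x) \<bullet> b > 0}"
    have oW: "open W"
      unfolding W_def by (intro open_Int open_ball open_Collect_less continuous_intros)
    have bW: "bounded W" by (simp add: W_def bounded_Int)
    have clW: "closure W \<subseteq> cball x \<delta> \<inter> {y. (y - x) \<bullet> b \<ge> 0}"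
      by (rule closure_minimal) (auto simp: W_def intro!: closed_Int closed_cball closed_Collect_le continuous_intros)
    note sp = second_partials_lincomb[OF second_partials_harmonic[OF h\<phi>] sp\<psi>, of "- M / \<delta>\<^sup>2"]
    have WS': "W \<subseteq> S'" using cb by (auto simp: W_def)
    have w_le: "w y \<le> 0" if yW: "y \<in> W" for y
    proof (rule weak_max_bounded[OF oW bW _ _ _ _ yW])
      have c1: "continuous_on S' \<phi>"
        by (rule harmonic_on_continuous[OF h\<phi>])
      have "continuous_on S' w"
        unfolding w_def \<psi>_def by (intro continuous_intros c1)
      then show "continuous_on (closure W) w"
        using continuous_on_subset clW cb by blast
      show "second_partials W w (\<lambda>y c. pd c \<phi> y + - M / \<delta>\<^sup>2 * \<psi>1 y c)
         (\<lambda>y c. pd c (pd c \<phi>) y + - M / \<delta>\<^sup>2 * \<psi>2 y c)"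
        using sp WS' unfolding w_def second_partials_def by blast
      have "(\<Sum>c\<in>Basis. \<psi>2 z c) = 0" for z
      proof -
        have "(\<Sum>c\<in>Basis. (c \<bullet> b) * (c \<bullet> b)) = 1"
          using bb by (subst (asm) euclidean_inner) (simp add: inner_commute)
        then have "(\<Sum>c\<in>Basis. n * (2 * (c \<bullet> b) * (c \<bullet> b))) = n * 2"
          by (simp add: mult.assoc flip: sum_distrib_left)
        then show ?thesis
          unfolding \<psi>2_def sum_subtractf by (simp add: n_def)
      qed
      moreover have "(\<Sum>c\<in>Basis. pd c (pd c \<phi>) z) = 0" if "z \<in> W" for z
        using harmonic_onD(3)[OF h\<phi>] that WS' by blast
      ultimately show "0 \<le> (\<Sum>c\<in>Basis. pd c (pd c \<phi>) z + - M / \<delta>\<^sup>2 * \<psi>2 z c)"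
        if "z \<in> W" for z
        using that by (simp only: sum.distrib flip: sum_distrib_left)
    next
      fix z assume z: "z \<in> frontier W"
      then have zc: "z \<in> cball x \<delta>" "(z - x) \<bullet> b \<ge> 0" "z \<notin> W"
        using clW oW by (auto simp: frontier_def interior_open)
      define s where "s = (z - x) \<bullet> b"
      have s\<delta>: "s \<le> \<delta>" "s \<ge> 0"
        using Basis_le_norm[OF b, of "z - x"] zc unfolding s_def by (auto simp: dist_norm norm_minus_commute)
      have Lz: "L z + a \<in> cball x \<delta>"
        using zc by (simp add: dist_norm norm_minus_commute[of x] La nL)
      show "w z \<le> 0"
      proof (cases "s = 0")
        case True
        then have "L z + a = z" using La[of z] by (simp add: L_def s_def)
        moreover have "\<psi> z \<ge> 0" using True by (simp add: \<psi>_def s_def)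
        ultimately show ?thesis using M0 by (simp add: w_def \<phi>_def)
      next
        case False
        then have "z \<notin> ball x \<delta>" using zc s\<delta> by (auto simp: W_def s_def)
        then have nz: "(z - x) \<bullet> (z - x) = \<delta>\<^sup>2"
          using zc by (simp add: dot_square_norm dist_norm norm_minus_commute)
        have "s * s \<le> s * \<delta>" using s\<delta> by (intro mult_left_mono) auto
        then have "n * (s * s) \<le> n * (s * \<delta>)" by (rule mult_left_mono) (simp add: n_def)
        then have "\<psi> z \<ge> \<delta>\<^sup>2"
          unfolding \<psi>_def nz s_def[symmetric] by (simp add: power2_eq_square mult_ac)
        then have "(M / \<delta>\<^sup>2) * \<psi> z \<ge> (M / \<delta>\<^sup>2) * \<delta>\<^sup>2" using M0 by (intro mult_left_mono) auto
        then have "(M / \<delta>\<^sup>2) * \<psi> z \<ge> M" using \<delta> by simp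
        moreover have "1/2 * u z + -1/2 * u (L z + a) \<le> M" using M[OF zc(1)] M[OF Lz] by (auto simp: abs_le_iff)
        ultimately show ?thesis by (simp add: w_def \<phi>_def)
      qed
    qed
    \<comment> \<open>The comparison along the normal ray from \<open>x\<close>; equality holds at \<open>t = 0\<close>, so the derivative there is
      nonpositive.\<close>
    define g where "g = (\<lambda>t. (1/2) * u (x + t *\<^sub>R b) - (1/2) * u (x - t *\<^sub>R b) - (M / \<delta>\<^sup>2) * (t\<^sup>2 + n * \<delta> * t - n * t\<^sup>2))"
    have du: "(u has_derivative (\<lambda>v. pd v u x)) (at x)" using harmonic_onD(1)[OF u xS] .
    have d1: "((\<lambda>t. u (x + t *\<^sub>R b)) has_real_derivative pd b u x) (at 0)"
      using has_derivative_along_line[of u _ x 0 b] du by simp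
    have "pd (- b) u x = - pd b u x" using linear_neg[OF has_derivative_linear[OF du]] .
    then have d2: "((\<lambda>t. u (x - t *\<^sub>R b)) has_real_derivative - pd b u x) (at 0)"
      using has_derivative_along_line[of u "\<lambda>v. pd v u x" x 0 "- b"] du by simp
    have dg: "(g has_real_derivative (pd b u x - (M / \<delta>\<^sup>2) * (n * \<delta>))) (at 0)"
      unfolding g_def by (rule derivative_eq_intros d1 d2 refl | simp)+
    have g_le: "g t \<le> 0" if "0 < t" "t < \<delta>" for t
    proof -
      have "x + t *\<^sub>R b \<in> W" using that b by (simp add: W_def dist_norm bb)
      from w_le[OF this] have "w (x + t *\<^sub>R b) \<le> 0" .
      moreover have "L (x + t *\<^sub>R b) + a = x - t *\<^sub>R b"
      proof -
        have "L (x + t *\<^sub>R b) + a = x + t *\<^sub>R b - (2 * t) *\<^sub>R b"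
          using bb by (simp add: L_def a_def inner_add_left distrib_left scaleR_add_left)
        also have "(2 * t) *\<^sub>R b = t *\<^sub>R b + t *\<^sub>R b" by (simp only: mult_2 scaleR_add_left)
        finally show ?thesis by simp
      qed
      ultimately show ?thesis by (simp add: w_def \<phi>_def g_def \<psi>_def bb power2_eq_square)
    qed
    have "pd b u x - (M / \<delta>\<^sup>2) * (n * \<delta>) \<le> 0"
    proof (rule ccontr)
      assume "\<not> ?thesis"
      then obtain d where "d > 0" "\<forall>h>0. h < d \<longrightarrow> g 0 < g (0 + h)"
        using DERIV_pos_inc_right[OF dg] by auto
      then have "g 0 < g (min d \<delta> / 2)" using \<delta> by (auto simp: min_def)
      moreover have "g (min d \<delta> / 2) \<le> 0" using \<open>d > 0\<close> \<delta> by (intro g_le) (auto simp: min_def)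
      moreover have "g 0 = 0" by (simp add: g_def)
      ultimately show False by simp
    qed
    then show ?thesis using \<delta> by (simp add: n_def power2_eq_square mult.commute)
  qed
  have "pd b u x \<le> real DIM('a) * M / \<delta>" by (rule key[OF u M])
  moreover have "- pd b u x \<le> real DIM('a) * M / \<delta>"
  proof -
    have h: "harmonic_on S (\<lambda>y. (-1) * u y + 0 * u y)" by (rule harmonic_on_lincomb[OF u u])
    have "pd b (\<lambda>y. (-1) * u y + 0 * u y) x = - pd b u x"
    proof -
      have "(u has_derivative (\<lambda>v. pd v u x)) (at x)" using harmonic_onD(1)[OF u xS] .
      then have "((\<lambda>y. (-1) * u y + 0 * u y) has_derivative (\<lambda>v. - pd v u x)) (at x)"
        by (auto intro!: derivative_eq_intros)
      then show ?thesis by (rule pd_eqI)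
    qed
    then show ?thesis using key[OF h] M by simp
  qed
  ultimately show ?thesis by linarith
qed

section \<open>Interior regularity\<close>

lemma pd_lincomb:
  assumes "f differentiable (at x)" "g differentiable (at x)"
  shows "pd b (\<lambda>y. \<alpha> * f y + \<beta> * g y) x = \<alpha> * pd b f x + \<beta> * pd b g x"
  by (rule pd_eqI, intro has_derivative_add has_derivative_mult_right has_derivative_pd assms)

text \<open>A derivative of \<open>u\<close> is not yet known to be harmonic, so the gradient estimate cannot simply be applied
  twice. It is applied to the difference quotients of \<open>u\<close> instead, which are harmonic and are bounded by
  the estimate for \<open>u\<close> itself.\<close>

lemma second_derivative_estimate:
  fixes u :: "'a::euclidean_space \<Rightarrow> real"
  assumes u: "harmonic_on S u" and sub: "cball x (2 * \<delta>) \<subseteq> S" and \<delta>: "\<delta> > 0"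
    and M: "\<And>y. y \<in> cball x (2 * \<delta>) \<Longrightarrow> \<bar>u y\<bar> \<le> M" and a: "a \<in> Basis" and b: "b \<in> Basis"
  shows "\<bar>pd b (pd a u) x\<bar> \<le> (real DIM('a) / \<delta>)\<^sup>2 * M"
proof -
  define n where "n = real DIM('a)"
  have M0: "M \<ge> 0" using M[of x] \<delta> by force
  have xS: "x \<in> S" using sub \<delta> by auto
  have diff: "u differentiable (at y)" if "y \<in> S" for y using u that by (simp add: harmonic_on_def)
  have est: "\<bar>(pd a u (x + t *\<^sub>R b) - pd a u x) / t\<bar> \<le> n * (n * M / (\<delta> - t)) / \<delta>" if t: "0 < t" "t < \<delta>" for t
  proof -
    define q where "q = (\<lambda>y. (1 / t) * u (y + t *\<^sub>R b) + (- 1 / t) * u y)"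
    define S' where "S' = (\<lambda>y. y + t *\<^sub>R b) -` S \<inter> S"
    have h1: "harmonic_on ((\<lambda>y. y + t *\<^sub>R b) -` S) (\<lambda>y. u (y + t *\<^sub>R b))"
      by (rule harmonic_on_translate[OF u])
    have oS': "open S'" using harmonic_on_open[OF h1] harmonic_on_open[OF u] by (auto simp: S'_def)
    have hq: "harmonic_on S' q"
      unfolding q_def
      by (intro harmonic_on_lincomb harmonic_on_subset[OF h1 oS'] harmonic_on_subset[OF u oS']) (auto simp: S'_def)
    have nb: "norm (t *\<^sub>R b) = t" using t b by simp
    have inc: "y + s *\<^sub>R b \<in> cball x (\<delta> + t)" if "y \<in> cball x \<delta>" "0 \<le> s" "s \<le> t" for y s
    proof -
      have "dist x (y + s *\<^sub>R b) \<le> dist x y + norm (s *\<^sub>R b)"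
        using dist_triangle[of x "y + s *\<^sub>R b" y] by (simp add: dist_norm)
      then show ?thesis using that b by simp
    qed
    have big: "cball x (\<delta> + t) \<subseteq> S" using sub t by auto
    have c: "cball x \<delta> \<subseteq> S'"
    proof
      fix y assume "y \<in> cball x \<delta>"
      then show "y \<in> S'"
        using subsetD[OF big inc[of y t]] subsetD[OF big inc[of y 0]] t by (simp add: S'_def)
    qed
    have qb: "\<bar>q y\<bar> \<le> n * M / (\<delta> - t)" if y: "y \<in> cball x \<delta>" for y
    proof -
      have "\<exists>z. 0 < z \<and> z < t \<and> u (y + t *\<^sub>R b) - u (y + 0 *\<^sub>R b) = (t - 0) * pd b u (y + z *\<^sub>R b)"
        using inc[OF y] big t(1)
        by (intro MVT2 has_derivative_along_line[OF harmonic_onD(1)[OF u]]) auto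
      then obtain z where z: "0 < z" "z < t" "u (y + t *\<^sub>R b) - u y = t * pd b u (y + z *\<^sub>R b)" by auto
      have yz: "y + z *\<^sub>R b \<in> cball x (\<delta> + t)" using inc[OF y] z by auto
      have sb: "cball (y + z *\<^sub>R b) (\<delta> - t) \<subseteq> cball x (2 * \<delta>)"
        using yz by (simp add: cball_subset_cball_iff dist_commute)
      have "\<bar>pd b u (y + z *\<^sub>R b)\<bar> \<le> n * M / (\<delta> - t)"
        unfolding n_def by (rule gradient_estimate[OF u _ _ _ b]) (use sb sub M t in auto)
      moreover have "q y = pd b u (y + z *\<^sub>R b)"
        using z(3) t by (simp add: q_def field_simps)
      ultimately show ?thesis by simp
    qed
    have "\<bar>pd a q x\<bar> \<le> n * (n * M / (\<delta> - t)) / \<delta>"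
      unfolding n_def by (rule gradient_estimate[OF hq c \<delta> _ a]) (use qb in \<open>auto simp: n_def\<close>)
    moreover have "pd a q x = (pd a u (x + t *\<^sub>R b) - pd a u x) / t"
    proof -
      have "x \<in> S'" using c \<delta> by (meson centre_in_cball less_imp_le subsetD)
      then have xt: "x + t *\<^sub>R b \<in> S" by (simp add: S'_def)
      have "((\<lambda>y. u (y + t *\<^sub>R b)) has_derivative (\<lambda>v. pd v u (x + t *\<^sub>R b))) (at x)"
        by (rule has_derivative_compose[where f = "\<lambda>y. y + t *\<^sub>R b" and f' = "\<lambda>v. v" and g = u, OF _ harmonic_onD(1)[OF u xt]])
          (auto intro!: derivative_eq_intros)
      then have "(q has_derivative (\<lambda>v. (1 / t) * pd v u (x + t *\<^sub>R b) + (- 1 / t) * pd v u x)) (at x)"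
        unfolding q_def by (intro has_derivative_add has_derivative_mult_right harmonic_onD(1)[OF u xS])
      from pd_eqI[OF this] show ?thesis using t by (simp add: field_simps)
    qed
    ultimately show ?thesis by simp
  qed
  have "((\<lambda>t. pd a u (x + t *\<^sub>R b)) has_real_derivative pd b (pd a u) x) (at 0)"
    using has_derivative_along_line[of "pd a u" _ x 0 b] harmonic_onD(2)[OF u xS a] by simp
  then have "((\<lambda>t. (pd a u (x + t *\<^sub>R b) - pd a u x) / t) \<longlongrightarrow> pd b (pd a u) x) (at 0)"
    unfolding DERIV_def by simp
  then have l1: "((\<lambda>t. \<bar>(pd a u (x + t *\<^sub>R b) - pd a u x) / t\<bar>) \<longlongrightarrow> \<bar>pd b (pd a u) x\<bar>) (at_right 0)"
    by (intro tendsto_rabs) (rule filterlim_mono[OF _ order_refl at_le], auto)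
  have l2: "((\<lambda>t. n * (n * M / (\<delta> - t)) / \<delta>) \<longlongrightarrow> n * (n * M / (\<delta> - 0)) / \<delta>) (at_right 0)"
    using \<delta> by (intro tendsto_intros) auto
  have "\<bar>pd b (pd a u) x\<bar> \<le> n * (n * M / (\<delta> - 0)) / \<delta>"
  proof (rule tendsto_le[OF _ l2 l1])
    show "\<forall>\<^sub>F t in at_right 0. \<bar>(pd a u (x + t *\<^sub>R b) - pd a u x) / t\<bar> \<le> n * (n * M / (\<delta> - t)) / \<delta>"
      unfolding eventually_at_right_field using est \<delta> by blast
  qed simp
  then show ?thesis by (simp add: n_def power2_eq_square)
qed

text \<open>The theorem on term-by-term differentiation of a sequence, in terms of partial derivatives.\<close>

lemma pd_sequence:
  fixes f :: "nat \<Rightarrow> 'a::euclidean_space \<Rightarrow> real"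
  assumes T: "open T" "convex T" and diff: "\<And>k x. x \<in> T \<Longrightarrow> f k differentiable (at x)"
    and C: "\<And>b. b \<in> Basis \<Longrightarrow> uniformly_Cauchy_on T (\<lambda>k. pd b (f k))"
    and lim: "\<And>x. x \<in> T \<Longrightarrow> (\<lambda>k. f k x) \<longlonglongrightarrow> F x" and x: "x \<in> T"
  shows "F differentiable (at x)" "b \<in> Basis \<Longrightarrow> (\<lambda>k. pd b (f k) x) \<longlonglongrightarrow> pd b F x"
proof -
  have "\<forall>b\<in>Basis. \<exists>g. uniform_limit T (\<lambda>k. pd b (f k)) g sequentially"
    using Cauchy_uniformly_convergent[OF C] by (auto simp: uniformly_convergent_on_def)
  then obtain g where g: "\<And>b. b \<in> Basis \<Longrightarrow> uniform_limit T (\<lambda>k. pd b (f k)) (g b) sequentially"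
    by metis
  define g' where "g' = (\<lambda>x h. \<Sum>b\<in>Basis. (h \<bullet> b) * g b x)"
  have "\<exists>G. \<forall>x\<in>T. (\<lambda>k. f k x) \<longlonglongrightarrow> G x \<and> (G has_derivative g' x) (at x within T)"
  proof (rule has_derivative_sequence[where f = f and f' = "\<lambda>k x v. pd v (f k) x" and ?x0.0 = x and l = "F x" and g' = g'])
    show "convex T" "x \<in> T" "(\<lambda>k. f k x) \<longlonglongrightarrow> F x" using T(2) x lim[OF x] by auto
    show "(f k has_derivative (\<lambda>v. pd v (f k) x)) (at x within T)" if "x \<in> T" for k x
      using has_derivative_pd[OF diff[OF that]] by (rule has_derivative_at_withinI)
    fix e :: real assume e: "e > 0"
    define n where "n = real DIM('a)"
    have n: "n > 0" by (simp add: n_def)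
    have "\<forall>\<^sub>F k in sequentially. \<forall>b\<in>Basis. \<forall>x\<in>T. dist (pd b (f k) x) (g b x) < e / n"
      using g e n by (intro eventually_ball_finite) (auto simp: uniform_limit_iff)
    then show "\<forall>\<^sub>F k in sequentially. \<forall>x\<in>T. \<forall>h. norm (pd h (f k) x - g' x h) \<le> e * norm h"
    proof (rule eventually_mono, intro ballI allI)
      fix k x and h :: 'a assume k: "\<forall>b\<in>Basis. \<forall>x\<in>T. dist (pd b (f k) x) (g b x) < e / n" and x: "x \<in> T"
      have "pd h (f k) x - g' x h = (\<Sum>b\<in>Basis. (h \<bullet> b) * (pd b (f k) x - g b x))"
        by (subst pd_sum_Basis[OF diff[OF x]]) (simp add: g'_def algebra_simps sum_subtractf)
      also have "norm \<dots> \<le> (\<Sum>b\<in>(Basis::'a set). norm h * (e / n))"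
      proof (rule sum_norm_le)
        fix b :: 'a assume b: "b \<in> Basis"
        have "\<bar>h \<bullet> b\<bar> * \<bar>pd b (f k) x - g b x\<bar> \<le> norm h * (e / n)"
          using k x b Basis_le_norm[OF b, of h] by (intro mult_mono) (auto simp: dist_real_def less_imp_le)
        then show "norm ((h \<bullet> b) * (pd b (f k) x - g b x)) \<le> norm h * (e / n)"
          by (simp add: abs_mult)
      qed
      also have "\<dots> = e * norm h" using n by (simp add: n_def)
      finally show "norm (pd h (f k) x - g' x h) \<le> e * norm h" .
    qed
  qed
  then obtain G where G: "\<And>x. x \<in> T \<Longrightarrow> (\<lambda>k. f k x) \<longlonglongrightarrow> G x" "\<And>x. x \<in> T \<Longrightarrow> (G has_derivative g' x) (at x within T)"
    by blast
  have GF: "G y = F y" if "y \<in> T" for y using LIMSEQ_unique[OF G(1)[OF that] lim[OF that]] .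
  have "(G has_derivative g' x) (at x)" using G(2)[OF x] unfolding at_within_open[OF x T(1)] .
  then have dF: "(F has_derivative g' x) (at x)"
    by (rule has_derivative_transform_within_open[OF _ T(1) x GF])
  then show "F differentiable (at x)" by (auto simp: differentiable_def)
  assume b: "b \<in> Basis"
  have "pd b F x = (\<Sum>c\<in>Basis. (b \<bullet> c) * g c x)" using pd_eqI[OF dF] by (simp add: g'_def)
  also have "\<dots> = (\<Sum>c\<in>Basis. if c = b then g c x else 0)"
    using b by (intro sum.cong) (auto simp: inner_Basis)
  also have "\<dots> = g b x" using b by simp
  finally show "(\<lambda>k. pd b (f k) x) \<longlonglongrightarrow> pd b F x"
    using tendsto_uniform_limitI[OF g[OF b] x] by simp
qed

lemma harmonic_on_local:
  assumes "open S" "\<And>x. x \<in> S \<Longrightarrow> \<exists>T. x \<in> T \<and> harmonic_on T u"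
  shows "harmonic_on S u"
  using assms by (fastforce simp: harmonic_on_def)

text \<open>The difference quotients in direction \<open>e\<close> converge to \<open>pd e u\<close> locally uniformly. They are harmonic, so
  the estimates for first and second derivatives make their derivatives up to order two uniformly
  Cauchy. Hence the limit has two derivatives, and its Laplacian is the limit of zeros.\<close>

lemma harmonic_on_pd_Basis:
  fixes u :: "'a::euclidean_space \<Rightarrow> real"
  assumes u: "harmonic_on S u" and e: "e \<in> Basis"
  shows "harmonic_on S (pd e u)"
proof (rule harmonic_on_local[OF harmonic_on_open[OF u]])
  fix x0 assume x0: "x0 \<in> S"
  obtain R where R: "R > 0" "cball x0 R \<subseteq> S"
    using harmonic_on_open[OF u] x0 open_contains_cball by blast
  define r where "r = R / 4"
  have r: "r > 0" "cball x0 (4 * r) \<subseteq> S" using R by (auto simp: r_def)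
  define n where "n = real DIM('a)"
  define T where "T = ball x0 r"
  have T: "open T" "convex T" "x0 \<in> T" using r by (auto simp: T_def)
  define h where "h = (\<lambda>k. r / real (Suc k))"
  have h: "h k > 0" "h k \<le> r" for k using r by (auto simp: h_def field_simps)
  have hlim: "h \<longlonglongrightarrow> 0" unfolding h_def by (rule LIMSEQ_Suc[OF lim_const_over_n])
  define F where "F = (\<lambda>k y. (1 / h k) * u (y + h k *\<^sub>R e) + (- 1 / h k) * u y)"
  define S' where "S' = (\<lambda>k. (\<lambda>y. y + h k *\<^sub>R e) -` S \<inter> S)"
  have hF: "harmonic_on (S' k) (F k)" for k
  proof -
    have h1: "harmonic_on ((\<lambda>y. y + h k *\<^sub>R e) -` S) (\<lambda>y. u (y + h k *\<^sub>R e))"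
      by (rule harmonic_on_translate[OF u])
    have oS': "open (S' k)" using harmonic_on_open[OF h1] harmonic_on_open[OF u] by (auto simp: S'_def)
    show ?thesis unfolding F_def
      by (intro harmonic_on_lincomb harmonic_on_subset[OF h1 oS'] harmonic_on_subset[OF u oS']) (auto simp: S'_def)
  qed
  have inc: "y + s *\<^sub>R e \<in> cball x0 (4 * r)" if "y \<in> cball x0 (3 * r)" "0 \<le> s" "s \<le> r" for y s
  proof -
    have "dist x0 (y + s *\<^sub>R e) \<le> dist x0 y + norm (s *\<^sub>R e)"
      using dist_triangle[of x0 "y + s *\<^sub>R e" y] by (simp add: dist_norm)
    then show ?thesis using that e by simp
  qed
  have S'3: "cball x0 (3 * r) \<subseteq> S' k" for k
  proof
    fix y assume "y \<in> cball x0 (3 * r)"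
    then show "y \<in> S' k"
      using subsetD[OF r(2) inc[of y "h k"]] subsetD[OF r(2) inc[of y 0]] h[of k] r(1) by (simp add: S'_def less_imp_le)
  qed
  have unif: "\<exists>N. \<forall>k\<ge>N. \<forall>y\<in>cball x0 (3 * r). \<bar>F k y - pd e u y\<bar> \<le> \<epsilon>" if \<epsilon>: "\<epsilon> > 0" for \<epsilon>
  proof -
    have "continuous_on (cball x0 (4 * r)) (pd e u)"
      using u e r(2) by (intro continuous_at_imp_continuous_on ballI differentiable_imp_continuous_within)
        (auto simp: harmonic_on_def)
    then have "uniformly_continuous_on (cball x0 (4 * r)) (pd e u)"
      by (rule compact_uniformly_continuous) simp
    then obtain d where d: "d > 0" "\<And>y z. y \<in> cball x0 (4 * r) \<Longrightarrow> z \<in> cball x0 (4 * r) \<Longrightarrow> dist z y < d \<Longrightarrow> dist (pd e u z) (pd e u y) < \<epsilon>"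
      using \<epsilon> unfolding uniformly_continuous_on_def by metis
    obtain N where N: "\<And>k. k \<ge> N \<Longrightarrow> h k < d"
      using order_tendstoD(2)[OF hlim d(1)] by (auto simp: eventually_sequentially)
    have "\<bar>F k y - pd e u y\<bar> \<le> \<epsilon>" if k: "k \<ge> N" and y: "y \<in> cball x0 (3 * r)" for k y
    proof -
      have "\<exists>z. 0 < z \<and> z < h k \<and> u (y + h k *\<^sub>R e) - u (y + 0 *\<^sub>R e) = (h k - 0) * pd e u (y + z *\<^sub>R e)"
        using inc[OF y] h[of k] r(2)
        by (intro MVT2 has_derivative_along_line[OF harmonic_onD(1)[OF u]]) auto
      then obtain z where z: "0 < z" "z < h k" "u (y + h k *\<^sub>R e) - u y = h k * pd e u (y + z *\<^sub>R e)" by auto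
      have "F k y = pd e u (y + z *\<^sub>R e)" using z(3) h(1)[of k] by (simp add: F_def field_simps)
      moreover have "dist (pd e u (y + z *\<^sub>R e)) (pd e u y) < \<epsilon>"
        using N[OF k] z h[of k] inc[OF y, of z] inc[OF y, of 0] r(1) e by (intro d(2)) (auto simp: dist_norm)
      ultimately show ?thesis by (simp add: dist_real_def)
    qed
    then show ?thesis by blast
  qed
  have diffF: "F k differentiable (at x)" "b \<in> Basis \<Longrightarrow> pd b (F k) differentiable (at x)" if "x \<in> cball x0 (3 * r)" for k x b
    using hF[of k] S'3[of k] that by (auto simp: harmonic_on_def)
  have T3: "T \<subseteq> cball x0 (3 * r)" using r by (auto simp: T_def)
  have T2: "cball x (2 * r) \<subseteq> cball x0 (3 * r)" if "x \<in> T" for x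
    using that by (auto simp: T_def cball_subset_cball_iff dist_commute)
  have T1: "cball x r \<subseteq> cball x0 (3 * r)" if "x \<in> T" for x
    using that r(1) by (simp add: T_def cball_subset_cball_iff dist_commute)
  \<comment> \<open>Applied to the difference of two quotients, whose supremum tends to 0, the estimates bound the
    difference of their derivatives.\<close>
  have both: "\<exists>N. \<forall>k\<ge>N. \<forall>l\<ge>N. \<forall>x\<in>T. \<forall>a\<in>Basis. \<forall>b\<in>Basis. \<bar>pd a (F k) x - pd a (F l) x\<bar> < \<epsilon> \<and>
     \<bar>pd b (pd a (F k)) x - pd b (pd a (F l)) x\<bar> < \<epsilon>" if \<epsilon>: "\<epsilon> > 0" for \<epsilon>
  proof -
    define m where "m = n * 2 / r + (n / r)\<^sup>2 * 2 + 1"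
    have n: "n > 0" by (simp add: n_def)
    have m: "m > 0" using r n unfolding m_def by (intro add_nonneg_pos add_nonneg_nonneg) auto
    define \<eta> where "\<eta> = \<epsilon> / m"
    have \<eta>: "\<eta> > 0" using \<epsilon> m by (simp add: \<eta>_def)
    have small: "n * (2 * \<eta>) / r < \<epsilon>" "(n / r)\<^sup>2 * (2 * \<eta>) < \<epsilon>"
    proof -
      have "n * 2 / r < m" "(n / r)\<^sup>2 * 2 < m" using r n by (auto simp: m_def add_nonneg_pos add_pos_nonneg)
      from this[THEN mult_strict_right_mono, OF \<eta>] show "n * (2 * \<eta>) / r < \<epsilon>" "(n / r)\<^sup>2 * (2 * \<eta>) < \<epsilon>"
        using m by (simp_all add: \<eta>_def mult_ac)
    qed
    obtain N where N: "\<And>k y. k \<ge> N \<Longrightarrow> y \<in> cball x0 (3 * r) \<Longrightarrow> \<bar>F k y - pd e u y\<bar> \<le> \<eta>" using unif[OF \<eta>] by blast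
    have "\<bar>pd a (F k) x - pd a (F l) x\<bar> < \<epsilon> \<and> \<bar>pd b (pd a (F k)) x - pd b (pd a (F l)) x\<bar> < \<epsilon>"
      if kl: "k \<ge> N" "l \<ge> N" and x: "x \<in> T" and a: "a \<in> Basis" and b: "b \<in> Basis" for k l x a b
    proof -
      define D where "D = (\<lambda>y. 1 * F k y + (-1) * F l y)"
      have oI: "open (S' k \<inter> S' l)" using harmonic_on_open[OF hF] by auto
      have hD: "harmonic_on (S' k \<inter> S' l) D"
        unfolding D_def by (intro harmonic_on_lincomb harmonic_on_subset[OF hF oI]) auto
      have c3: "cball x0 (3 * r) \<subseteq> S' k \<inter> S' l" using S'3 by auto
      have bd: "\<bar>D y\<bar> \<le> 2 * \<eta>" if "y \<in> cball x0 (3 * r)" for y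
        using N[OF kl(1) that] N[OF kl(2) that] unfolding D_def by linarith
      have e1: "\<bar>pd a D x\<bar> \<le> n * (2 * \<eta>) / r"
        unfolding n_def
        by (rule gradient_estimate[OF hD _ r(1) _ a]) (use c3 bd T1[OF x] in blast)+
      have e2: "\<bar>pd b (pd a D) x\<bar> \<le> (n / r)\<^sup>2 * (2 * \<eta>)"
        unfolding n_def
        by (rule second_derivative_estimate[OF hD _ r(1) _ a b]) (use c3 bd T2[OF x] in blast)+
      have p1: "pd a D y = 1 * pd a (F k) y + (-1) * pd a (F l) y" if "y \<in> T" for y
        unfolding D_def using that T3 by (intro pd_lincomb diffF) auto
      have "pd b (pd a D) x = pd b (\<lambda>y. 1 * pd a (F k) y + (-1) * pd a (F l) y) x"
        by (rule pd_cong[OF T(1) x p1])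
      also have "\<dots> = 1 * pd b (pd a (F k)) x + (-1) * pd b (pd a (F l)) x"
        using x T3 a by (intro pd_lincomb diffF) auto
      finally show ?thesis using e1 e2 p1[OF x] small by simp
    qed
    then show ?thesis by blast
  qed
  have C1: "uniformly_Cauchy_on T (\<lambda>k. pd b (F k))" if "b \<in> Basis" for b
    unfolding uniformly_Cauchy_on_def dist_real_def using both that by meson
  have C2: "uniformly_Cauchy_on T (\<lambda>k. pd b (pd a (F k)))" if "a \<in> Basis" "b \<in> Basis" for a b
    unfolding uniformly_Cauchy_on_def dist_real_def using both that by meson
  have lim0: "(\<lambda>k. F k x) \<longlonglongrightarrow> pd e u x" if "x \<in> T" for x
    unfolding LIMSEQ_def dist_real_def
  proof (intro allI impI)
    fix \<epsilon> :: real assume "\<epsilon> > 0"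
    then show "\<exists>N. \<forall>k\<ge>N. \<bar>F k x - pd e u x\<bar> < \<epsilon>"
      using unif[of "\<epsilon> / 2"] T3 that by fastforce
  qed
  have seq1: "pd e u differentiable (at x)" "b \<in> Basis \<Longrightarrow> (\<lambda>k. pd b (F k) x) \<longlonglongrightarrow> pd b (pd e u) x"
    if x: "x \<in> T" for b x
    using pd_sequence[OF T(1,2) diffF(1)[OF subsetD[OF T3]] C1 lim0 x] by auto
  have seq2: "pd a (pd e u) differentiable (at x)"
      "b \<in> Basis \<Longrightarrow> (\<lambda>k. pd b (pd a (F k)) x) \<longlonglongrightarrow> pd b (pd a (pd e u)) x"
    if a: "a \<in> Basis" and x: "x \<in> T" for a b x
    using pd_sequence[OF T(1,2) diffF(2)[OF subsetD[OF T3] a] C2[OF a] seq1(2)[OF _ a] x] by auto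
  have "(\<Sum>b\<in>Basis. pd b (pd b (pd e u)) x) = 0" if x: "x \<in> T" for x
  proof -
    have "(\<lambda>k. \<Sum>b\<in>Basis. pd b (pd b (F k)) x) \<longlonglongrightarrow> (\<Sum>b\<in>Basis. pd b (pd b (pd e u)) x)"
      by (intro tendsto_sum seq2(2) x)
    moreover have "(\<Sum>b\<in>Basis. pd b (pd b (F k)) x) = 0" for k
      using harmonic_onD(3)[OF hF] S'3 T3 x by blast
    ultimately show ?thesis by (simp add: LIMSEQ_const_iff)
  qed
  then have "harmonic_on T (pd e u)"
    unfolding harmonic_on_def using T(1) seq1(1) seq2(1) by blast
  then show "\<exists>T. x0 \<in> T \<and> harmonic_on T (pd e u)" using T(3) by blast
qed

lemma harmonic_on_pd:
  assumes u: "harmonic_on S u"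
  shows "harmonic_on S (pd v u)"
proof (rule harmonic_on_cong)
  show "harmonic_on S (\<lambda>x. \<Sum>b\<in>Basis. (v \<bullet> b) * pd b u x)"
    by (rule harmonic_on_sum[OF harmonic_on_open[OF u] harmonic_on_pd_Basis[OF u]])
  show "pd v u x = (\<Sum>b\<in>Basis. (v \<bullet> b) * pd b u x)" if "x \<in> S" for x
    using u that by (intro pd_sum_Basis) (auto simp: harmonic_on_def)
qed

section \<open>Unique continuation\<close>

lemma harmonic_on_iterated_pd: "harmonic_on S u \<Longrightarrow> harmonic_on S ((pd v ^^ k) u)"
  by (induction k) (auto intro: harmonic_on_pd)

lemma directional_derivative_estimate:
  fixes u :: "'a::euclidean_space \<Rightarrow> real"
  assumes u: "harmonic_on S u" and sub: "cball x \<delta> \<subseteq> S" and \<delta>: "\<delta> > 0"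
    and M: "\<And>y. y \<in> cball x \<delta> \<Longrightarrow> \<bar>u y\<bar> \<le> M"
  shows "\<bar>pd v u x\<bar> \<le> (real DIM('a))\<^sup>2 * norm v / \<delta> * M"
proof -
  have "x \<in> S" using sub \<delta> by auto
  then have "pd v u x = (\<Sum>b\<in>Basis. (v \<bullet> b) * pd b u x)"
    using u by (intro pd_sum_Basis) (auto simp: harmonic_on_def)
  also have "norm \<dots> \<le> (\<Sum>b\<in>(Basis::'a set). norm v * (real DIM('a) * M / \<delta>))"
  proof (rule sum_norm_le)
    fix b :: 'a assume b: "b \<in> Basis"
    have "\<bar>v \<bullet> b\<bar> * \<bar>pd b u x\<bar> \<le> norm v * (real DIM('a) * M / \<delta>)"
      using Basis_le_norm[OF b, of v] gradient_estimate[OF u sub \<delta> M b] by (intro mult_mono) auto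
    then show "norm ((v \<bullet> b) * pd b u x) \<le> norm v * (real DIM('a) * M / \<delta>)" by (simp add: abs_mult)
  qed
  also have "\<dots> = (real DIM('a))\<^sup>2 * norm v / \<delta> * M" by (simp add: power2_eq_square)
  finally show ?thesis by simp
qed

text \<open>Each of the \<open>k\<close> differentiations uses up a part \<open>\<rho> / k\<close> of the radius; this splitting gives the growth
  \<open>k ^ k\<close>, comparable to \<open>fact k\<close>, that analyticity requires.\<close>

lemma iterated_derivative_estimate:
  fixes u :: "'a::euclidean_space \<Rightarrow> real"
  assumes u: "harmonic_on S u" and sub: "cball x \<rho> \<subseteq> S" and \<rho>: "\<rho> > 0"
    and M: "\<And>y. y \<in> cball x \<rho> \<Longrightarrow> \<bar>u y\<bar> \<le> M"
  shows "\<bar>(pd v ^^ k) u x\<bar> \<le> ((real DIM('a))\<^sup>2 * norm v * real k / \<rho>) ^ k * M"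
proof (cases "k = 0")
  case True then show ?thesis using M[of x] \<rho> by simp
next
  case False
  define \<sigma> where "\<sigma> = \<rho> / real k"
  have \<sigma>: "\<sigma> > 0" "real k * \<sigma> = \<rho>" using False \<rho> by (auto simp: \<sigma>_def)
  have "\<bar>(pd v ^^ j) u y\<bar> \<le> ((real DIM('a))\<^sup>2 * norm v / \<sigma>) ^ j * M"
    if "j \<le> k" "y \<in> cball x (\<rho> - real j * \<sigma>)" for j y
    using that
  proof (induction j arbitrary: y)
    case 0 then show ?case using M by simp
  next
    case (Suc j)
    have c: "cball y \<sigma> \<subseteq> cball x (\<rho> - real j * \<sigma>)"
      using Suc.prems(2) by (simp add: cball_subset_cball_iff dist_commute algebra_simps)
    have "real j * \<sigma> \<ge> 0" using \<sigma>(1) by simp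
    then have c': "cball x (\<rho> - real j * \<sigma>) \<subseteq> S" using sub by auto
    have "\<bar>pd v ((pd v ^^ j) u) y\<bar> \<le> (real DIM('a))\<^sup>2 * norm v / \<sigma> * (((real DIM('a))\<^sup>2 * norm v / \<sigma>) ^ j * M)"
      using Suc.IH Suc.prems c c' \<sigma>(1)
      by (intro directional_derivative_estimate[OF harmonic_on_iterated_pd[OF u]]) auto
    then show ?case by simp
  qed
  from this[of k x] show ?thesis using \<sigma> False by (simp add: \<sigma>_def)
qed

lemma power_self_le_exp: "real k ^ k \<le> exp 1 ^ k * fact k"
proof -
  have "real k ^ k / fact k \<le> exp (real k)"
  proof -
    have s: "(\<lambda>j. real k ^ j / fact j) sums exp (real k)"
      using exp_converges[of "real k"] by (simp add: field_simps)
    have "(\<Sum>j\<in>{k}. real k ^ j / fact j) \<le> (\<Sum>j. real k ^ j / fact j)"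
      by (rule sum_le_suminf) (use s sums_summable in auto)
    then show ?thesis using sums_unique[OF s] by simp
  qed
  moreover have "exp (real k) = exp 1 ^ k" using exp_of_nat_mult[of k "1::real"] by simp
  ultimately show ?thesis by (simp add: pos_divide_le_eq)
qed

text \<open>All Taylor coefficients at \<open>z\<close> along the segment to \<open>x\<close> vanish, so \<open>u x\<close> equals the remainder of every
  order. The radius in terms of \<open>\<rho>\<close> is uniform, so zeros propagate to points of the closure.\<close>

lemma harmonic_zero_spreads:
  fixes u :: "'a::euclidean_space \<Rightarrow> real"
  assumes u: "harmonic_on S u" and sub: "cball z \<rho> \<subseteq> S" and \<rho>: "\<rho> > 0"
    and N: "open N" "z \<in> N" "\<And>y. y \<in> N \<Longrightarrow> u y = 0"
    and x: "dist z x \<le> \<rho> / (12 * (real DIM('a))\<^sup>2)"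
  shows "u x = 0"
proof -
  define K where "K = (real DIM('a))\<^sup>2"
  have K: "K \<ge> 1" using DIM_positive[where 'a='a] unfolding K_def by (intro one_le_power) linarith
  define v where "v = x - z"
  have nv: "norm v \<le> \<rho> / (12 * K)" using x by (simp add: v_def K_def dist_norm norm_minus_commute)
  have "\<rho> / (12 * K) \<le> \<rho> / 2" using \<rho> K by (intro divide_left_mono) auto
  then have nv2: "norm v \<le> \<rho> / 2" using nv by linarith
  have zero: "(pd v ^^ k) u y = 0" if "y \<in> N" for k y
    using that
  proof (induction k arbitrary: y)
    case (Suc k)
    have "pd v ((pd v ^^ k) u) y = pd v (\<lambda>_. 0) y" using Suc by (intro pd_cong[OF N(1)]) auto
    also have "\<dots> = 0" by (simp add: pd_def)
    finally show ?case by simp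
  qed (use N in simp)
  have "compact (cball z \<rho>)" by simp
  moreover have "continuous_on (cball z \<rho>) u" using harmonic_on_continuous[OF u] sub continuous_on_subset by blast
  ultimately have "bounded (u ` cball z \<rho>)" using compact_continuous_image compact_imp_bounded by blast
  then obtain M where "\<forall>t\<in>u ` cball z \<rho>. norm t \<le> M" unfolding bounded_iff by blast
  then have M: "\<bar>u y\<bar> \<le> M" if "y \<in> cball z \<rho>" for y using that by auto
  have M0: "M \<ge> 0" using M[of z] \<rho> by force
  have seg: "z + t *\<^sub>R v \<in> cball z (\<rho> / 2)" if "0 \<le> t" "t \<le> 1" for t
  proof -
    have "t * norm v \<le> 1 * norm v" using that by (intro mult_right_mono) auto
    then show ?thesis using that nv2 by (simp add: dist_norm)
  qed
  have bound: "\<bar>u x\<bar> \<le> (1 / 2) ^ k * M" for k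
  proof -
    have "\<exists>t. 0 < t \<and> t \<le> 1 \<and> u (z + 1 *\<^sub>R v) = (\<Sum>m<k. (pd v ^^ m) u (z + 0 *\<^sub>R v) / fact m * 1 ^ m) + (pd v ^^ k) u (z + t *\<^sub>R v) / fact k * 1 ^ k"
    proof (rule Maclaurin2[where diff = "\<lambda>m t. (pd v ^^ m) u (z + t *\<^sub>R v)" and f = "\<lambda>t. u (z + t *\<^sub>R v)" and h = 1 and n = k])
      show "\<forall>m t. m < k \<and> 0 \<le> t \<and> t \<le> 1 \<longrightarrow>
        ((\<lambda>t. (pd v ^^ m) u (z + t *\<^sub>R v)) has_real_derivative (pd v ^^ Suc m) u (z + t *\<^sub>R v)) (at t)"
      proof (intro allI impI)
        fix m t assume t: "m < k \<and> 0 \<le> t \<and> t \<le> (1::real)"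
        then have "z + t *\<^sub>R v \<in> S" using seg[of t] sub \<rho> by auto
        then show "((\<lambda>t. (pd v ^^ m) u (z + t *\<^sub>R v)) has_real_derivative (pd v ^^ Suc m) u (z + t *\<^sub>R v)) (at t)"
          using has_derivative_along_line[OF harmonic_onD(1)[OF harmonic_on_iterated_pd[OF u]]] by simp
      qed
    qed auto
    then obtain t where t: "0 < t" "t \<le> 1" and
      ux: "u (z + 1 *\<^sub>R v) = (\<Sum>m<k. (pd v ^^ m) u (z + 0 *\<^sub>R v) / fact m * 1 ^ m) + (pd v ^^ k) u (z + t *\<^sub>R v) / fact k * 1 ^ k"
      by blast
    have "u x = (pd v ^^ k) u (z + t *\<^sub>R v) / fact k"
      using ux zero[OF N(2)] by (simp add: v_def)
    note t = t this
    have c: "cball (z + t *\<^sub>R v) (\<rho> / 2) \<subseteq> cball z \<rho>"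
      using seg[of t] t by (simp add: cball_subset_cball_iff dist_commute)
    \<comment> \<open>The constant 12 in the hypothesis on \<open>x\<close> is chosen for this: on balls of radius \<open>\<rho> / 2\<close> the factor per
      order is \<open>2 K |v| / \<rho> \<le> 1 / 6\<close>, and with \<open>k ^ k \<le> 3 ^ k * fact k\<close> the remainder is at most \<open>M / 2 ^ k\<close>.\<close>
    have "\<bar>(pd v ^^ k) u (z + t *\<^sub>R v)\<bar> \<le> (K * norm v * real k / (\<rho> / 2)) ^ k * M"
      unfolding K_def by (rule iterated_derivative_estimate[OF u]) (use c sub \<rho> M in auto)
    also have "K * norm v * real k / (\<rho> / 2) = (2 * K * norm v / \<rho>) * real k" by simp
    also have "((2 * K * norm v / \<rho>) * real k) ^ k * M = (2 * K * norm v / \<rho>) ^ k * real k ^ k * M"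
      by (simp only: power_mult_distrib)
    also have "\<dots> \<le> (1 / 6) ^ k * (exp 1 ^ k * fact k) * M"
    proof (intro mult_right_mono mult_mono power_mono power_self_le_exp)
      have "2 * K * norm v \<le> 2 * K * (\<rho> / (12 * K))" using nv K by (intro mult_left_mono) auto
      then show "2 * K * norm v / \<rho> \<le> 1 / 6" using \<rho> K by (simp add: field_simps)
    qed (use \<rho> K M0 in auto)
    also have "\<dots> \<le> (1 / 6) ^ k * (3 ^ k * fact k) * M"
      using exp_le M0 by (intro mult_right_mono mult_left_mono power_mono) auto
    also have "\<dots> = ((1 / 6) * 3) ^ k * fact k * M" by (simp only: power_mult_distrib mult.assoc)
    also have "\<dots> = ((1 / 2) ^ k * M) * fact k" by simp
    finally have "\<bar>(pd v ^^ k) u (z + t *\<^sub>R v)\<bar> / fact k \<le> (1 / 2) ^ k * M" by (subst pos_divide_le_eq) auto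
    then show ?thesis using t(3) by (simp only: abs_divide abs_of_pos fact_gt_zero)
  qed
  have "(\<lambda>k. (1 / 2) ^ k * M) \<longlonglongrightarrow> 0 * M" by (intro tendsto_intros LIMSEQ_power_zero) auto
  then have "\<bar>u x\<bar> \<le> 0" using bound by (intro LIMSEQ_le_const[of _ 0]) auto
  then show ?thesis by simp
qed

text \<open>The interior of the zero set is open, and closed relative to \<open>S\<close> since zeros spread over balls whose
  radius depends only on the distance to the complement of \<open>S\<close>.\<close>

theorem harmonic_unique_continuation:
  fixes u :: "'a::euclidean_space \<Rightarrow> real"
  assumes u: "harmonic_on S u" and S: "connected S" and V: "open V" "V \<noteq> {}" "V \<subseteq> S"
    and zero: "\<And>y. y \<in> V \<Longrightarrow> u y = 0" and x: "x \<in> S"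
  shows "u x = 0"
proof -
  define Z where "Z = interior {x \<in> S. u x = 0}"
  have Z: "open Z" "Z \<subseteq> {x \<in> S. u x = 0}" by (auto simp: Z_def interior_subset)
  have VZ: "V \<subseteq> Z" unfolding Z_def using V zero by (intro interior_maximal) auto
  define K where "K = (real DIM('a))\<^sup>2"
  have K: "K \<ge> 1" using DIM_positive[where 'a='a] unfolding K_def by (intro one_le_power) linarith
  have "Z = S \<inter> closure Z"
  proof (intro equalityI subsetI)
    fix y assume "y \<in> S \<inter> closure Z"
    then have y: "y \<in> S" "y \<in> closure Z" by auto
    obtain R where R: "R > 0" "cball y R \<subseteq> S" using harmonic_on_open[OF u] y open_contains_cball by blast
    define \<rho> where "\<rho> = R / 2"
    have \<rho>: "\<rho> > 0" using R by (simp add: \<rho>_def)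
    define \<eta> where "\<eta> = \<rho> / (12 * K)"
    have \<eta>: "\<eta> > 0" "\<eta> \<le> \<rho>" 
  proof -
      show "\<eta> > 0" using \<rho> K by (simp add: \<eta>_def)
      have "\<rho> / (12 * K) \<le> \<rho> / 1" using \<rho> K by (intro divide_left_mono) auto
      then show "\<eta> \<le> \<rho>" by (simp add: \<eta>_def)
    qed
    obtain z where z: "z \<in> Z" "dist z y < \<eta>" using y(2) \<eta>(1) closure_approachable by blast
    have c: "cball z \<rho> \<subseteq> S"
    proof
      fix q assume "q \<in> cball z \<rho>"
      then have "dist y q \<le> R" using z(2) \<eta>(2) dist_triangle2[of y q z] dist_commute[of z y] dist_commute[of z q] by (simp add: \<rho>_def)
      then show "q \<in> S" using R by auto
    qed
    have "ball z \<eta> \<subseteq> {x \<in> S. u x = 0}"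
    proof
      fix q assume q: "q \<in> ball z \<eta>"
      then have "u q = 0"
        using harmonic_zero_spreads[OF u c \<rho> Z(1) z(1), of q] Z(2) by (auto simp: \<eta>_def K_def)
      then show "q \<in> {x \<in> S. u x = 0}" using q c \<eta> by auto
    qed
    then have "ball z \<eta> \<subseteq> Z" unfolding Z_def by (intro interior_maximal) auto
    then show "y \<in> Z" using z(2) by auto
  qed (use Z closure_subset in auto)
  then have "closedin (top_of_set S) Z" unfolding closedin_closed using closed_closure by blast
  moreover have "openin (top_of_set S) Z" by (rule open_subset) (use Z in auto)
  ultimately have "Z = S" using S V VZ unfolding connected_clopen by blast
  then show ?thesis using x Z by auto
qed

section \<open>The fundamental solution\<close>

text \<open>This is \<open>|x - z|\<close> to the power \<open>2 - n\<close>, written with the smooth function \<open>|x - z|\<^sup>2\<close>; the value at \<open>z\<close>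
  itself is the default 0 of \<open>powr\<close>.\<close>

definition fundamental_solution :: "'a::euclidean_space \<Rightarrow> 'a \<Rightarrow> real" where
  "fundamental_solution z x = ((x - z) \<bullet> (x - z)) powr (1 - real DIM('a) / 2)"

lemma has_derivative_powr_const:
  fixes f :: "'a::real_normed_vector \<Rightarrow> real"
  assumes "(f has_derivative f') (at x within S)" "f x > 0"
  shows "((\<lambda>x. f x powr r) has_derivative (\<lambda>v. f' v * (r * f x powr (r - 1)))) (at x within S)"
  by (rule DERIV_compose_FDERIV[OF has_real_derivative_powr[OF assms(2)] assms(1)])

lemma harmonic_on_fundamental_solution:
  fixes z :: "'a::euclidean_space"
  shows "harmonic_on (- {z}) (fundamental_solution z)"
proof -
  define n where "n = real DIM('a)"
  define a where "a = 1 - n / 2"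
  define s where "s = (\<lambda>x::'a. (x - z) \<bullet> (x - z))"
  have ds: "(s has_derivative (\<lambda>v. 2 * ((x - z) \<bullet> v))) (at x)" for x
    unfolding s_def by (auto intro!: derivative_eq_intros simp: inner_commute)
  have sp: "s x > 0" if "x \<in> - {z}" for x using that by (simp add: s_def)
  define h where "h b x v = 2 * ((x - z) \<bullet> b) * (a * (2 * ((x - z) \<bullet> v) * ((a - 1) * s x powr (a - 1 - 1)))) +
    2 * (v \<bullet> b) * (a * s x powr (a - 1))" for b x v
  show ?thesis
  proof (rule harmonic_onI[where u' = "\<lambda>x b. 2 * ((x - z) \<bullet> b) * (a * s x powr (a - 1))" and
      u'' = h])
    show "open (- {z})" by auto
    fix x assume x: "x \<in> - {z}"
    show "(fundamental_solution z has_derivative (\<lambda>b. 2 * ((x - z) \<bullet> b) * (a * s x powr (a - 1)))) (at x)"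
      using has_derivative_powr_const[OF ds sp[OF x], of a]
      by (simp add: fundamental_solution_def[abs_def] s_def a_def n_def)
    show "((\<lambda>y. 2 * ((y - z) \<bullet> b) * (a * s y powr (a - 1))) has_derivative h b x) (at x)" for b
      unfolding h_def
      by (rule derivative_eq_intros has_derivative_powr_const[OF ds sp[OF x]] refl | simp)+
    have q: "(\<Sum>b\<in>Basis. ((x - z) \<bullet> b) * ((x - z) \<bullet> b)) = s x"
      unfolding s_def by (rule euclidean_inner[symmetric])
    have p: "s x powr (a - 1 - 1) * s x = s x powr (a - 1)"
      using sp[OF x] powr_add[of "s x" "a - 1 - 1" 1] by simp
    have "(\<Sum>b\<in>Basis. h b x b) = (\<Sum>b\<in>Basis. (4 * a * (a - 1) * s x powr (a - 1 - 1)) * (((x - z) \<bullet> b) * ((x - z) \<bullet> b)) + 2 * a * s x powr (a - 1))"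
      by (intro sum.cong) (auto simp: h_def algebra_simps)
    also have "\<dots> = 4 * a * (a - 1) * (s x powr (a - 1 - 1) * s x) + n * (2 * a * s x powr (a - 1))"
      by (simp only: sum.distrib q sum_constant flip: sum_distrib_left) (simp add: n_def)
    also have "\<dots> = 0" unfolding p by (simp add: a_def algebra_simps)
    finally show "(\<Sum>b\<in>Basis. h b x b) = 0" .
  qed
qed

lemma fundamental_solution_pos: "x \<noteq> z \<Longrightarrow> fundamental_solution z x > 0"
  by (simp add: fundamental_solution_def)

section \<open>Hopf lemma and strong maximum principle\<close>

text \<open>The barrier is a small multiple of the fundamental solution with pole \<open>z\<close>, shifted to vanish on the
  sphere through \<open>y\<close>. In the annulus between the radii \<open>r / 2\<close> and \<open>r\<close> the sum of \<open>w\<close> and the barrier is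
  nonpositive, and the barrier grows at least linearly on the way from \<open>y\<close> to the centre. The bound on a ray
  replaces the usual statement on the normal derivative, which need not exist for \<open>w\<close>.\<close>

lemma hopf_lemma:
  fixes w :: "'a::euclidean_space \<Rightarrow> real"
  assumes dim: "DIM('a) \<ge> 3" and r: "r > 0" and cont: "continuous_on (cball z r) w"
    and sp: "second_partials (ball z r) w w1 w2"
    and sub: "\<And>x. x \<in> ball z r \<Longrightarrow> (\<Sum>b\<in>Basis. w2 x b) \<ge> 0"
    and le: "\<And>x. x \<in> cball z r \<Longrightarrow> w x \<le> 0"
    and neg: "\<And>x. x \<in> cball z (r / 2) \<Longrightarrow> w x < 0" and y: "dist z y = r"
  shows "\<exists>\<epsilon>>0. \<forall>t. 0 < t \<and> t < 1 / 2 \<longrightarrow> w (y + t *\<^sub>R (z - y)) \<le> - \<epsilon> * t"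
proof -
  define a where "a = 1 - real DIM('a) / 2"
  have a: "a \<le> - 1 / 2" using dim by (simp add: a_def)
  let ?\<Gamma> = "fundamental_solution z"
  have \<Gamma>: "?\<Gamma> x = (dist z x)\<^sup>2 powr a" for x
    by (simp add: fundamental_solution_def a_def dist_norm norm_minus_commute flip: dot_square_norm)
  have "compact (cball z (r / 2))" by simp
  moreover have "continuous_on (cball z (r / 2)) w" by (rule continuous_on_subset[OF cont]) (use r in auto)
  ultimately obtain x0 where x0: "x0 \<in> cball z (r / 2)" "\<And>x. x \<in> cball z (r / 2) \<Longrightarrow> w x \<le> w x0"
    using continuous_attains_sup[of "cball z (r / 2)" w] r by (auto simp: cball_eq_empty)
  define m where "m = - w x0"
  have m: "m > 0" using neg[OF x0(1)] by (simp add: m_def)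
  define \<Gamma>r where "\<Gamma>r = (r\<^sup>2) powr a"
  define H where "H = ((r / 2)\<^sup>2) powr a - \<Gamma>r"
  have H: "H > 0"
  proof -
    have "(r / 2)\<^sup>2 < r\<^sup>2" using r by (intro power_strict_mono) auto
    then have "(r\<^sup>2) powr a < ((r / 2)\<^sup>2) powr a" using a r by (intro powr_less_mono2_neg) auto
    then show ?thesis by (simp add: H_def \<Gamma>r_def)
  qed
  define e where "e = m / H"
  have e: "e > 0" using m H by (simp add: e_def)
  define W where "W = ball z r \<inter> - cball z (r / 2)"
  have W: "open W" "bounded W" by (auto simp: W_def bounded_Int)
  have clW: "closure W \<subseteq> cball z r \<inter> - ball z (r / 2)"
    by (rule closure_minimal) (auto simp: W_def)
  have hh: "harmonic_on (- {z}) (\<lambda>x. 1 * ?\<Gamma> x + (- \<Gamma>r) * 1)"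
    by (intro harmonic_on_lincomb harmonic_on_fundamental_solution harmonic_on_const) auto
  define h where "h = (\<lambda>x. 1 * ?\<Gamma> x + (- \<Gamma>r) * 1)"
  have Wz: "W \<subseteq> - {z}" "W \<subseteq> ball z r" using r by (auto simp: W_def)
  have le0: "w x + e * h x \<le> 0" if x: "x \<in> W" for x
  proof (rule weak_max_bounded[OF W _ _ _ _ x])
    have "continuous_on (closure W) h"
      by (rule continuous_on_subset[OF harmonic_on_continuous[OF hh[folded h_def]]]) (use clW r in auto)
    then show "continuous_on (closure W) (\<lambda>x. w x + e * h x)"
      using continuous_on_subset[OF cont] clW by (intro continuous_intros) blast+
    have "second_partials W w w1 w2" using sp Wz by (auto simp: second_partials_def)
    moreover have "second_partials W h (\<lambda>x b. pd b h x) (\<lambda>x b. pd b (pd b h) x)"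
      by (rule second_partials_harmonic[OF harmonic_on_subset[OF hh[folded h_def] W(1) Wz(1)]])
    ultimately show "second_partials W (\<lambda>x. w x + e * h x) (\<lambda>x b. w1 x b + e * pd b h x) (\<lambda>x b. w2 x b + e * pd b (pd b h) x)"
      by (rule second_partials_lincomb)
    show "0 \<le> (\<Sum>b\<in>Basis. w2 x b + e * pd b (pd b h) x)" if "x \<in> W" for x
    proof -
      have "(\<Sum>b\<in>Basis. pd b (pd b h) x) = 0" using harmonic_onD(3)[OF hh[folded h_def]] that Wz by blast
      then show ?thesis using sub[of x] that Wz by (auto simp: sum.distrib simp flip: sum_distrib_left)
    qed
    fix x assume "x \<in> frontier W"
    then have x: "x \<in> cball z r" "x \<notin> ball z (r / 2)" "x \<notin> W" using clW W(1) by (auto simp: frontier_def interior_open)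
    show "w x + e * h x \<le> 0"
    proof (cases "x \<in> cball z (r / 2)")
      case True
      then have d: "dist z x = r / 2" using x(2) by auto
      have "h x = H" unfolding h_def H_def \<Gamma> d by simp
      moreover have "w x \<le> - m" using x0(2)[OF True] by (simp add: m_def)
      ultimately show ?thesis using H by (simp add: e_def)
    next
      case False
      then have "dist z x = r" using x by (auto simp: W_def)
      then have "h x = 0" by (simp add: h_def \<Gamma>r_def \<Gamma>)
      then show ?thesis using le[OF x(1)] by simp
    qed
  qed
  have "w (y + t *\<^sub>R (z - y)) \<le> - (e * \<Gamma>r) * t" if t: "0 < t" "t < 1 / 2" for t
  proof -
    let ?x = "y + t *\<^sub>R (z - y)"
    have "z - ?x = (1 - t) *\<^sub>R (z - y)" by (simp add: algebra_simps)
    then have d: "dist z ?x = (1 - t) * r" using y t by (simp add: dist_norm)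
    have "(1 - t) * r < 1 * r" "1 / 2 * r < (1 - t) * r" using t r by (intro mult_strict_right_mono, auto)+
    then have "?x \<in> W" using d t by (simp add: W_def)
    from le0[OF this] have "w ?x \<le> - (e * h ?x)" by simp
    moreover have "h ?x \<ge> \<Gamma>r * t"
    proof -
      have "1 + t \<le> 1 / (1 - t)" using t by (simp add: field_simps)
      also have "\<dots> = ((1 - t)\<^sup>2) powr (- 1 / 2)"
      proof -
        have "((1 - t)\<^sup>2) powr (- (1 / 2)) = inverse (((1 - t)\<^sup>2) powr (1 / 2))" by (rule powr_minus)
        also have "((1 - t)\<^sup>2) powr (1 / 2) = 1 - t" using t by (subst powr_half_sqrt) auto
        finally show ?thesis by (simp add: inverse_eq_divide)
      qed
      also have "\<dots> \<le> ((1 - t)\<^sup>2) powr a" using t a by (intro powr_mono') (auto simp: power_le_one)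
      finally have "\<Gamma>r * (1 + t) \<le> \<Gamma>r * ((1 - t)\<^sup>2) powr a" by (intro mult_left_mono) (auto simp: \<Gamma>r_def)
      also have "\<dots> = ?\<Gamma> ?x" unfolding \<Gamma> d using r t by (simp add: \<Gamma>r_def power_mult_distrib powr_mult mult.commute)
      finally show ?thesis by (simp add: h_def algebra_simps)
    qed
    then have "e * h ?x \<ge> e * (\<Gamma>r * t)" using e by (intro mult_left_mono) auto
    ultimately show ?thesis by (simp add: mult.assoc)
  qed
  moreover have "e * \<Gamma>r > 0" using e r by (simp add: \<Gamma>r_def)
  ultimately show ?thesis by blast
qed

text \<open>If \<open>w a < 0\<close>, the largest ball around \<open>a\<close> on which \<open>w < 0\<close> touches the zero set at an interior point of
  \<open>G\<close>. There \<open>w\<close> has a maximum, hence derivative zero, which contradicts the Hopf lemma.\<close>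

lemma strong_maximum_principle:
  fixes w :: "'a::euclidean_space \<Rightarrow> real"
  assumes dim: "DIM('a) \<ge> 3" and G: "open G" and diff: "\<And>x. x \<in> G \<Longrightarrow> w differentiable (at x)"
    and sp: "second_partials G w w1 w2" and sub: "\<And>x. x \<in> G \<Longrightarrow> (\<Sum>b\<in>Basis. w2 x b) \<ge> 0"
    and le: "\<And>x. x \<in> G \<Longrightarrow> w x \<le> 0" and q: "w q = 0" and \<delta>: "\<delta> > 0" "cball q (2 * \<delta>) \<subseteq> G"
    and a: "a \<in> ball q \<delta>"
  shows "w a = 0"
proof (rule ccontr)
  assume na: "w a \<noteq> 0"
  have cont: "continuous_on G w"
    using diff differentiable_imp_continuous_within continuous_at_imp_continuous_on by blast
  define Z where "Z = {x \<in> cball q (2 * \<delta>). w x = 0}"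
  have "closed Z"
    unfolding Z_def by (intro continuous_closed_preimage_constant continuous_on_subset[OF cont \<delta>(2)]) auto
  moreover have qZ: "q \<in> Z" using q \<delta> by (simp add: Z_def)
  ultimately obtain p where p: "p \<in> Z" "\<And>y. y \<in> Z \<Longrightarrow> dist a p \<le> dist a y"
    using distance_attains_inf[of Z a] by blast
  define s where "s = dist a p"
  have s: "s < \<delta>" using p(2)[OF qZ] a by (simp add: s_def dist_commute)
  have pG: "p \<in> G" "w p = 0" using p(1) \<delta>(2) by (auto simp: Z_def)
  have s0: "s > 0" using na pG by (auto simp: s_def)
  have big: "cball a s \<subseteq> cball q (2 * \<delta>)" using s a by (simp add: cball_subset_cball_iff dist_commute)
  then have aG: "cball a s \<subseteq> G" using \<delta>(2) by blast
  have bG: "ball a s \<subseteq> G" using aG by auto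
  have neg: "w x < 0" if "x \<in> ball a s" for x
  proof -
    have "x \<notin> Z" using p(2)[of x] that by (auto simp: s_def)
    then show ?thesis using that big le[of x] bG by (force simp: Z_def)
  qed
  have "\<exists>\<epsilon>>0. \<forall>t. 0 < t \<and> t < 1 / 2 \<longrightarrow> w (p + t *\<^sub>R (a - p)) \<le> - \<epsilon> * t"
  proof (rule hopf_lemma[OF dim s0 continuous_on_subset[OF cont aG]])
    show "second_partials (ball a s) w w1 w2" using sp bG by (auto simp: second_partials_def)
    show "\<And>x. x \<in> ball a s \<Longrightarrow> 0 \<le> sum (w2 x) Basis" using sub bG by auto
    show "\<And>x. x \<in> cball a s \<Longrightarrow> w x \<le> 0" using le aG by auto
    show "\<And>x. x \<in> cball a (s / 2) \<Longrightarrow> w x < 0" using neg s0 by auto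
    show "dist a p = s" by (simp add: s_def)
  qed
  then obtain e where e: "e > 0" "\<And>t. 0 < t \<Longrightarrow> t < 1 / 2 \<Longrightarrow> w (p + t *\<^sub>R (a - p)) \<le> - e * t" by blast
  define f where "f = (\<lambda>t. w (p + t *\<^sub>R (a - p)))"
  have df: "(f has_real_derivative pd (a - p) w p) (at 0)"
    unfolding f_def using has_derivative_along_line[of w _ p 0 "a - p"] has_derivative_pd[OF diff[OF pG(1)]] by simp
  obtain d where d: "d > 0" "ball p d \<subseteq> G" using G pG openE by blast
  have nap: "norm (a - p) > 0" using s0 by (simp add: s_def dist_norm)
  have "pd (a - p) w p = 0"
  proof (rule DERIV_local_max[OF df])
    show "d / norm (a - p) > 0" using d nap by simp
    show "\<forall>t. \<bar>0 - t\<bar> < d / norm (a - p) \<longrightarrow> f t \<le> f 0"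
    proof (intro allI impI)
      fix t assume "\<bar>0 - t\<bar> < d / norm (a - p)"
      then have "\<bar>t\<bar> * norm (a - p) < d" using nap by (simp add: pos_less_divide_eq)
      then have "p + t *\<^sub>R (a - p) \<in> ball p d" by (simp add: dist_norm)
      then have "p + t *\<^sub>R (a - p) \<in> G" using d(2) by blast
      then show "f t \<le> f 0" using le pG(2) by (simp add: f_def)
    qed
  qed
  then have dg: "((\<lambda>t. f t + e * t) has_real_derivative e) (at 0)"
    using df by (auto intro!: derivative_eq_intros)
  obtain d' where d': "d' > 0" "\<And>t. 0 < t \<Longrightarrow> t < d' \<Longrightarrow> f 0 + e * 0 < f (0 + t) + e * (0 + t)"
    using DERIV_pos_inc_right[OF dg e(1)] by blast
  define t where "t = min d' (1 / 2) / 2"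
  have t: "0 < t" "t < d'" "t < 1 / 2" using d'(1) by (auto simp: t_def min_def)
  show False using d'(2)[OF t(1,2)] e(2)[OF t(1,3)] pG(2) by (simp add: f_def)
qed

section \<open>The P-function\<close>

text \<open>This is \<open>|Du|\<^sup>2 u powr (- n / (n - 2))\<close>. The quotient by \<open>u\<close> is the usual P-function of exterior problems, which
  satisfies an equation with a drift term; after multiplication with \<open>u\<close> the drift disappears and
  plain subharmonicity remains.\<close>

definition grad_power :: "('a::euclidean_space \<Rightarrow> real) \<Rightarrow> 'a \<Rightarrow> real" where
  "grad_power u x = (\<Sum>e\<in>Basis. (pd e u x)\<^sup>2) * u x powr (- (real DIM('a) / (real DIM('a) - 2)))"

text \<open>The Hessian at \<open>x\<close> of the function \<open>\<kappa> |x - p|\<^sup>2\<^sup>-\<^sup>n\<close> whose value and gradient at \<open>x\<close> are those of \<open>u\<close>, if the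
  gradient is not zero.\<close>

definition model_hessian :: "('a::euclidean_space \<Rightarrow> real) \<Rightarrow> 'a \<Rightarrow> 'a \<Rightarrow> 'a \<Rightarrow> real" where
  "model_hessian u x e b =
     (real DIM('a) * pd e u x * pd b u x - (if e = b then \<Sum>c\<in>Basis. (pd c u x)\<^sup>2 else 0)) / ((real DIM('a) - 2) * u x)"

text \<open>The Laplacian of \<open>N u powr (- g)\<close> with \<open>N = |Du|\<^sup>2\<close> and \<open>g = n / (n - 2)\<close> is a combination of \<open>|D\<^sup>2u|\<^sup>2\<close>, of
  \<open>X = D\<^sup>2u(Du, Du)\<close> and of \<open>N\<^sup>2\<close>, because \<open>u\<close> and its derivatives are harmonic. For this exponent it is a
  perfect square: the cross term with the model Hessian is \<open>2 g X / u\<close>, since \<open>D\<^sup>2u\<close> is trace free, and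
  the squared norm of the model Hessian is \<open>g (g + 1) N\<^sup>2 / (2 u\<^sup>2)\<close>.\<close>

lemma grad_power_subharmonic:
  fixes u :: "'a::euclidean_space \<Rightarrow> real"
  assumes dim: "DIM('a) \<ge> 3" and u: "harmonic_on G u" and pos: "\<And>x. x \<in> G \<Longrightarrow> u x > 0"
  obtains Q1 Q2 where "second_partials G (grad_power u) Q1 Q2"
    "\<And>x. x \<in> G \<Longrightarrow> (\<Sum>b\<in>Basis. Q2 x b) =
        2 * u x powr (- (real DIM('a) / (real DIM('a) - 2))) * (\<Sum>b\<in>Basis. \<Sum>e\<in>Basis. (pd b (pd e u) x - model_hessian u x e b)\<^sup>2)"
proof -
  define n where "n = real DIM('a)"
  have n: "n \<ge> 3" using dim by (simp add: n_def)
  define g where "g = n / (n - 2)"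
  define N where "N = (\<lambda>x. \<Sum>e\<in>Basis. (pd e u x)\<^sup>2)"
  define Nb where "Nb = (\<lambda>x b. \<Sum>e\<in>Basis. pd e u x * pd b (pd e u) x)"
  define Nbb where "Nbb = (\<lambda>x b. \<Sum>e\<in>Basis. (pd b (pd e u) x)\<^sup>2 + pd e u x * pd b (pd b (pd e u)) x)"
  define Q1 where "Q1 = (\<lambda>x b. 2 * Nb x b * u x powr (- g) - g * N x * (u x powr (- g - 1) * pd b u x))"
  define Q2 where "Q2 = (\<lambda>x b. 2 * Nbb x b * u x powr (- g) - 4 * g * Nb x b * pd b u x * u x powr (- g - 1)
      + g * (g + 1) * N x * (pd b u x)\<^sup>2 * u x powr (- g - 2) - g * N x * pd b (pd b u) x * u x powr (- g - 1))"
  have Qeq: "grad_power u = (\<lambda>x. N x * u x powr (- g))"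
    by (simp add: grad_power_def[abs_def] N_def g_def n_def)
  have sp: "second_partials G (grad_power u) Q1 Q2"
    unfolding second_partials_def
  proof (intro ballI)
    fix x b :: 'a assume x: "x \<in> G" and b: "b \<in> Basis"
    have du: "((\<lambda>t. u (x + t *\<^sub>R b)) has_real_derivative pd b u x) (at 0)"
      using second_partials_harmonic[OF u] x b by (simp add: second_partials_def)
    have dub: "((\<lambda>t. pd b u (x + t *\<^sub>R b)) has_real_derivative pd b (pd b u) x) (at 0)"
      using second_partials_harmonic[OF u] x b by (simp add: second_partials_def)
    have due: "((\<lambda>t. pd e u (x + t *\<^sub>R b)) has_real_derivative pd b (pd e u) x) (at 0)" for e
      using second_partials_harmonic[OF harmonic_on_pd[OF u]] x b by (simp add: second_partials_def)
    have duee: "((\<lambda>t. pd b (pd e u) (x + t *\<^sub>R b)) has_real_derivative pd b (pd b (pd e u)) x) (at 0)" for e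
      using second_partials_harmonic[OF harmonic_on_pd[OF u]] x b by (simp add: second_partials_def)
    have u0: "u (x + 0 *\<^sub>R b) > 0" using pos[OF x] by simp
    have dpow: "((\<lambda>t. u (x + t *\<^sub>R b) powr r) has_real_derivative r * u x powr (r - 1) * pd b u x) (at 0)" for r
      using DERIV_fun_powr[OF du u0, of r] by simp
    have dN: "((\<lambda>t. N (x + t *\<^sub>R b)) has_real_derivative 2 * Nb x b) (at 0)"
      unfolding N_def Nb_def by (auto intro!: derivative_eq_intros due sum.cong simp: sum_distrib_left)
    have dNb: "((\<lambda>t. Nb (x + t *\<^sub>R b) b) has_real_derivative Nbb x b) (at 0)"
      unfolding Nb_def Nbb_def by (auto intro!: derivative_eq_intros due duee sum.cong simp: power2_eq_square)
    have 1: "((\<lambda>t. grad_power u (x + t *\<^sub>R b)) has_real_derivative Q1 x b) (at 0)"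
      unfolding Qeq Q1_def by (rule derivative_eq_intros dN dpow refl | simp)+
    have 2: "((\<lambda>t. Q1 (x + t *\<^sub>R b) b) has_real_derivative Q2 x b) (at 0)"
      unfolding Q1_def
      by (rule derivative_eq_intros dN dNb dub dpow refl | simp add: Q2_def power2_eq_square algebra_simps)+
    show "((\<lambda>t. grad_power u (x + t *\<^sub>R b)) has_real_derivative Q1 x b) (at 0) \<and>
          ((\<lambda>t. Q1 (x + t *\<^sub>R b) b) has_real_derivative Q2 x b) (at 0)" using 1 2 by blast
  qed
  let ?B = "Basis::'a set"
  have lap: "(\<Sum>b\<in>Basis. Q2 x b) =
        2 * u x powr (- g) * (\<Sum>b\<in>Basis. \<Sum>e\<in>Basis. (pd b (pd e u) x - model_hessian u x e b)\<^sup>2)" if x: "x \<in> G" for x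
  proof -
    define v where "v = u x"
    have v: "v > 0" using pos[OF x] by (simp add: v_def)
    define p where "p = (\<lambda>e. pd e u x)"
    define h where "h = (\<lambda>e b. pd b (pd e u) x)"
    define NN where "NN = (\<Sum>e\<in>?B. (p e)\<^sup>2)"
    define HH where "HH = (\<Sum>b\<in>?B. \<Sum>e\<in>?B. (h e b)\<^sup>2)"
    define X where "X = (\<Sum>b\<in>?B. \<Sum>e\<in>?B. p e * h e b * p b)"
    have tr: "(\<Sum>b\<in>Basis. h b b) = 0" using harmonic_onD(3)[OF u x] by (simp add: h_def)
    have tr3: "(\<Sum>b\<in>Basis. Nbb x b) = HH"
    proof -
      have "(\<Sum>b\<in>Basis. Nbb x b) = HH + (\<Sum>e\<in>Basis. p e * (\<Sum>b\<in>Basis. pd b (pd b (pd e u)) x))"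
        unfolding Nbb_def HH_def h_def p_def sum.distrib sum_distrib_left by (subst (4) sum.swap) simp
      also have "(\<Sum>e\<in>Basis. p e * (\<Sum>b\<in>Basis. pd b (pd b (pd e u)) x)) = 0"
        using harmonic_onD(3)[OF harmonic_on_pd[OF u] x] by simp
      finally show ?thesis by simp
    qed
    have "(\<Sum>b\<in>Basis. Q2 x b) = 2 * v powr (- g) * (\<Sum>b\<in>Basis. Nbb x b) - 4 * g * v powr (- g - 1) * (\<Sum>b\<in>Basis. Nb x b * p b)
       + g * (g + 1) * NN * v powr (- g - 2) * (\<Sum>b\<in>?B. (p b)\<^sup>2) - g * NN * v powr (- g - 1) * (\<Sum>b\<in>?B. h b b)"
      unfolding Q2_def sum_distrib_left
      by (simp add: sum.distrib sum_subtractf v_def p_def h_def NN_def N_def mult_ac)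
    also have "(\<Sum>b\<in>Basis. Nb x b * p b) = X"
      by (simp add: Nb_def X_def p_def h_def sum_distrib_right)
    also have "2 * v powr (- g) * (\<Sum>b\<in>Basis. Nbb x b) - 4 * g * v powr (- g - 1) * X
       + g * (g + 1) * NN * v powr (- g - 2) * (\<Sum>b\<in>?B. (p b)\<^sup>2) - g * NN * v powr (- g - 1) * (\<Sum>b\<in>?B. h b b)
      = v powr (- g) * (2 * HH - 4 * g * X / v + g * (g + 1) * NN\<^sup>2 / v\<^sup>2)"
      unfolding tr tr3 NN_def[symmetric] using v
      by (simp add: powr_diff algebra_simps power2_eq_square powr_numeral add_divide_distrib)
    also have "2 * HH - 4 * g * X / v + g * (g + 1) * NN\<^sup>2 / v\<^sup>2 =
       2 * (\<Sum>b\<in>Basis. \<Sum>e\<in>Basis. (h e b - model_hessian u x e b)\<^sup>2)"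
    proof -
      define k where "k = 1 / ((n - 2) * v)"
      have mh: "model_hessian u x e b = k * (n * p e * p b - (if e = b then NN else 0))" for e b
        by (simp add: model_hessian_def k_def n_def p_def NN_def v_def)
      have sq: "(h e b - model_hessian u x e b)\<^sup>2 = (h e b)\<^sup>2 - 2 * k * n * (p e * h e b * p b)
          + (if e = b then 2 * k * NN * h b b else 0)
          + k\<^sup>2 * n\<^sup>2 * ((p e)\<^sup>2 * (p b)\<^sup>2) + (if e = b then k\<^sup>2 * (NN\<^sup>2 - 2 * n * NN * (p b)\<^sup>2) else 0)" for e b
        unfolding mh by (auto simp: power2_eq_square algebra_simps)
      have "(\<Sum>b\<in>Basis. \<Sum>e\<in>Basis. (h e b - model_hessian u x e b)\<^sup>2) =
         HH - 2 * k * n * X + 2 * k * NN * (\<Sum>b\<in>?B. h b b)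
         + k\<^sup>2 * n\<^sup>2 * (\<Sum>b\<in>?B. \<Sum>e\<in>?B. (p e)\<^sup>2 * (p b)\<^sup>2)
         + k\<^sup>2 * (n * NN\<^sup>2 - 2 * n * NN * NN)"
      proof -
        have d1: "(\<Sum>b\<in>?B. \<Sum>e\<in>?B. if e = b then 2 * k * NN * h b b else 0) = 2 * k * NN * (\<Sum>b\<in>?B. h b b)"
          by (simp add: sum_distrib_left)
        have d2: "(\<Sum>b\<in>?B. \<Sum>e\<in>?B. if e = b then k\<^sup>2 * (NN\<^sup>2 - 2 * n * NN * (p b)\<^sup>2) else 0)
           = k\<^sup>2 * (n * NN\<^sup>2 - 2 * n * NN * NN)"
        proof -
          have "(\<Sum>b\<in>?B. \<Sum>e\<in>?B. if e = b then k\<^sup>2 * (NN\<^sup>2 - 2 * n * NN * (p b)\<^sup>2) else 0)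
            = (\<Sum>b\<in>?B. k\<^sup>2 * (NN\<^sup>2 - 2 * n * NN * (p b)\<^sup>2))" by simp
          also have "\<dots> = k\<^sup>2 * (n * NN\<^sup>2 - 2 * n * NN * (\<Sum>b\<in>?B. (p b)\<^sup>2))"
            by (simp only: sum_subtractf sum_constant n_def flip: sum_distrib_left)
          finally show ?thesis by (simp only: NN_def)
        qed
        show ?thesis
          unfolding sq sum.distrib sum_subtractf d1 d2 HH_def X_def by (simp only: sum_distrib_left)
      qed
      also have "(\<Sum>b\<in>?B. \<Sum>e\<in>?B. (p e)\<^sup>2 * (p b)\<^sup>2) = NN\<^sup>2"
        by (simp add: NN_def power2_eq_square sum_product mult_ac)
      also have "HH - 2 * k * n * X + 2 * k * NN * (\<Sum>b\<in>?B. h b b) + k\<^sup>2 * n\<^sup>2 * NN\<^sup>2 + k\<^sup>2 * (n * NN\<^sup>2 - 2 * n * NN * NN)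
         = HH - 2 * g * X / v + n * (n - 1) / ((n - 2)\<^sup>2 * v\<^sup>2) * NN\<^sup>2"
      proof -
        have "k\<^sup>2 * n\<^sup>2 * NN\<^sup>2 + k\<^sup>2 * (n * NN\<^sup>2 - 2 * n * NN * NN) = n * (n - 1) * k\<^sup>2 * NN\<^sup>2"
          by (simp add: power2_eq_square algebra_simps)
        moreover have "k\<^sup>2 = 1 / ((n - 2)\<^sup>2 * v\<^sup>2)" by (simp add: k_def power_divide power_mult_distrib)
        moreover have "2 * k * n * X = 2 * g * X / v" by (simp add: k_def g_def)
        ultimately show ?thesis unfolding tr by simp
      qed
      finally have eq: "(\<Sum>b\<in>Basis. \<Sum>e\<in>Basis. (h e b - model_hessian u x e b)\<^sup>2) = HH - 2 * g * X / v + n * (n - 1) / ((n - 2)\<^sup>2 * v\<^sup>2) * NN\<^sup>2" .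
      have "g + 1 = 2 * (n - 1) / (n - 2)" using n by (simp add: g_def field_simps)
      then have "g * (g + 1) = 2 * (n * (n - 1)) / (n - 2)\<^sup>2" by (simp add: g_def power2_eq_square)
      then have "g * (g + 1) * NN\<^sup>2 / v\<^sup>2 = 2 * (n * (n - 1) / ((n - 2)\<^sup>2 * v\<^sup>2) * NN\<^sup>2)" by simp
      then show ?thesis unfolding eq by simp
    qed
    finally show ?thesis by (simp add: v_def h_def mult_ac)
  qed
  show ?thesis by (rule that[OF sp]) (use lap in \<open>simp add: g_def n_def\<close>)
qed

lemma grad_power_differentiable:
  assumes u: "harmonic_on G u" and x: "x \<in> G" "u x > 0"
  shows "grad_power u differentiable (at x)"
proof -
  have "(\<lambda>x. (\<Sum>e\<in>Basis. (pd e u x)\<^sup>2)) differentiable (at x)"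
    using harmonic_on_pd[OF u] x(1) by (intro differentiable_sum ballI differentiable_power) (auto simp: harmonic_on_def)
  moreover have "(\<lambda>x. u x powr r) differentiable (at x)" for r
    using has_derivative_powr_const[OF harmonic_onD(1)[OF u x(1)] x(2)] by (auto simp: differentiable_def)
  ultimately show ?thesis unfolding grad_power_def[abs_def] by (rule differentiable_mult)
qed

text \<open>Both \<open>Q\<close> and \<open>u\<close> being known on an open set, the Laplacian of \<open>Q\<close> vanishes there and the Hessian of \<open>u\<close> is the
  model one. This says that the field \<open>u powr (- g) Du + k x\<close> with \<open>k = P / (n - 2)\<close> has derivative zero,
  hence equals a constant \<open>k p\<close>. Taking norms in \<open>u powr (- g) Du = - k (x - p)\<close> and using \<open>Q = P u\<close>
  determines \<open>u\<close>.\<close>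

lemma rigidity:
  fixes u :: "'a::euclidean_space \<Rightarrow> real"
  assumes dim: "DIM('a) \<ge> 3" and V: "open V" "connected V" "V \<noteq> {}" and u: "harmonic_on V u"
    and pos: "\<And>x. x \<in> V \<Longrightarrow> u x > 0" and P: "P > 0" and eq: "\<And>x. x \<in> V \<Longrightarrow> grad_power u x = P * u x"
  shows "\<exists>p \<kappa>. \<kappa> > 0 \<and> (\<forall>x\<in>V. x \<noteq> p \<and> u x = \<kappa> * fundamental_solution p x)"
proof -
  define n where "n = real DIM('a)"
  have n: "n \<ge> 3" using dim by (simp add: n_def)
  define g where "g = n / (n - 2)"
  obtain Q1 Q2 where sp: "second_partials V (grad_power u) Q1 Q2" and
    lap: "\<And>x. x \<in> V \<Longrightarrow> (\<Sum>b\<in>Basis. Q2 x b) =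
        2 * u x powr (- g) * (\<Sum>b\<in>Basis. \<Sum>e\<in>Basis. (pd b (pd e u) x - model_hessian u x e b)\<^sup>2)"
    using grad_power_subharmonic[OF dim u pos] unfolding g_def n_def by blast
  have near: "\<forall>\<^sub>F t in nhds 0. x + t *\<^sub>R b \<in> V" if "x \<in> V" for x b
  proof -
    have "((\<lambda>t. x + t *\<^sub>R b) \<longlongrightarrow> x + 0 *\<^sub>R b) (nhds 0)" by (intro tendsto_intros filterlim_ident)
    then show ?thesis using V(1) that by (auto dest: topological_tendstoD)
  qed
  have Q1: "Q1 x b = P * pd b u x" if x: "x \<in> V" and b: "b \<in> Basis" for x b
  proof (rule DERIV_unique)
    show "((\<lambda>t. grad_power u (x + t *\<^sub>R b)) has_real_derivative Q1 x b) (at 0)"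
      using sp x b by (auto simp: second_partials_def)
    have "((\<lambda>t. P * u (x + t *\<^sub>R b)) has_real_derivative P * pd b u x) (at 0)"
      using second_partials_harmonic[OF u] x b by (auto simp: second_partials_def intro!: derivative_eq_intros)
    then show "((\<lambda>t. grad_power u (x + t *\<^sub>R b)) has_real_derivative P * pd b u x) (at 0)"
      using near[OF x, of b] eq by (subst DERIV_cong_ev[OF refl _ refl]) (auto elim!: eventually_mono)
  qed
  have Q2: "Q2 x b = P * pd b (pd b u) x" if x: "x \<in> V" and b: "b \<in> Basis" for x b
  proof (rule DERIV_unique)
    show "((\<lambda>t. Q1 (x + t *\<^sub>R b) b) has_real_derivative Q2 x b) (at 0)"
      using sp x b by (auto simp: second_partials_def)
    have "((\<lambda>t. P * pd b u (x + t *\<^sub>R b)) has_real_derivative P * pd b (pd b u) x) (at 0)"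
      using second_partials_harmonic[OF u] x b by (auto simp: second_partials_def intro!: derivative_eq_intros)
    then show "((\<lambda>t. Q1 (x + t *\<^sub>R b) b) has_real_derivative P * pd b (pd b u) x) (at 0)"
      using near[OF x, of b] Q1 b by (subst DERIV_cong_ev[OF refl _ refl]) (auto elim!: eventually_mono)
  qed
  have hess: "pd b (pd e u) x = model_hessian u x e b" if x: "x \<in> V" and b: "b \<in> Basis" and e: "e \<in> Basis" for x b e
  proof -
    have "(\<Sum>b\<in>Basis. Q2 x b) = P * (\<Sum>b\<in>Basis. pd b (pd b u) x)" using Q2[OF x] by (simp add: sum_distrib_left)
    also have "\<dots> = 0" using harmonic_onD(3)[OF u x] by simp
    finally have "(\<Sum>b\<in>Basis. \<Sum>e\<in>Basis. (pd b (pd e u) x - model_hessian u x e b)\<^sup>2) = 0"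
      using lap[OF x] pos[OF x] by auto
    then show ?thesis using b e by (auto simp: sum_nonneg_eq_0_iff sum_nonneg)
  qed
  define k where "k = P / (n - 2)"
  have k: "k > 0" using P n by (simp add: k_def)
  define f where "f = (\<lambda>e x. u x powr (- g) * pd e u x + k * (x \<bullet> e))"
  have df: "(f e has_derivative (\<lambda>_. 0)) (at x)" if x: "x \<in> V" and e: "e \<in> Basis" for x e
  proof -
    define D where "D = (\<lambda>v. u x powr (- g) * pd v (pd e u) x + (pd v u x * ((- g) * u x powr (- g - 1))) * pd e u x + k * (v \<bullet> e))"
    have D: "(f e has_derivative D) (at x)"
      unfolding f_def D_def
      by (intro has_derivative_add has_derivative_mult has_derivative_powr_const has_derivative_mult_right
          harmonic_onD(1)[OF u x] harmonic_onD(2)[OF u x e] pos[OF x] has_derivative_inner_left has_derivative_ident)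
    have lin: "linear D" using has_derivative_linear[OF D] .
    have Db: "D b = 0" if b: "b \<in> Basis" for b
    proof -
      define v where "v = u x"
      have v: "v > 0" using pos[OF x] by (simp add: v_def)
      define N where "N = (\<Sum>c\<in>Basis. (pd c u x)\<^sup>2)"
      have NP: "N * v powr (- g) = P * v" using eq[OF x] by (simp add: grad_power_def N_def v_def g_def n_def)
      have pw: "v powr (- g - 1) = v powr (- g) / v" using v by (simp add: powr_diff)
      have "pd b (pd e u) x = (n * pd e u x * pd b u x - (if e = b then N else 0)) / ((n - 2) * v)"
        using hess[OF x b e] by (simp add: model_hessian_def n_def N_def v_def)
      then have "D b = v powr (- g) * ((n * pd e u x * pd b u x - (if e = b then N else 0)) / ((n - 2) * v))
         - pd b u x * (g * (v powr (- g) / v)) * pd e u x + k * (if e = b then 1 else 0)"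
        using b e unfolding D_def v_def[symmetric] pw by (simp add: inner_Basis)
      also have "\<dots> = - (if e = b then N * v powr (- g) else 0) / ((n - 2) * v) + k * (if e = b then 1 else 0)"
        by (cases "e = b") (simp_all add: g_def diff_divide_distrib right_diff_distrib mult_ac)
      also have "\<dots> = 0" unfolding NP using n v by (simp add: k_def)
      finally show ?thesis .
    qed
    have "D v = 0" for v
    proof -
      have "D v = D (\<Sum>b\<in>Basis. (v \<bullet> b) *\<^sub>R b)" by (simp add: euclidean_representation)
      also have "\<dots> = 0" using Db by (subst linear_sum[OF lin]) (simp add: linear_cmul[OF lin])
      finally show ?thesis .
    qed
    then have "D = (\<lambda>_. 0)" by (rule ext)
    then show ?thesis using D by simp
  qed
  obtain x0 where x0: "x0 \<in> V" using V(3) by blast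
  define p where "p = (\<Sum>e\<in>Basis. (f e x0 / k) *\<^sub>R e)"
  have pe: "p \<bullet> e = f e x0 / k" if "e \<in> Basis" for e using that by (simp add: p_def)
  have grad: "u x powr (- g) * pd e u x = - k * ((x - p) \<bullet> e)" if x: "x \<in> V" and e: "e \<in> Basis" for x e
  proof -
    have "f e x = f e x0" by (rule has_derivative_zero_unique_connected[OF V(1,2) df[OF _ e] x x0])
    then show ?thesis using pe[OF e] k by (simp add: f_def inner_diff_left field_simps)
  qed
  define \<kappa> where "\<kappa> = k / (n - 2)"
  have \<kappa>: "\<kappa> > 0" using k n by (simp add: \<kappa>_def)
  have main: "x \<noteq> p \<and> u x = \<kappa> powr (1 - n / 2) * fundamental_solution p x" if x: "x \<in> V" for x
  proof -
    define v where "v = u x"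
    have v: "v > 0" using pos[OF x] by (simp add: v_def)
    define N where "N = (\<Sum>c\<in>Basis. (pd c u x)\<^sup>2)"
    have NP: "N * v powr (- g) = P * v" using eq[OF x] by (simp add: grad_power_def N_def v_def g_def n_def)
    have "(v powr (- g))\<^sup>2 * N = (\<Sum>e\<in>Basis. (v powr (- g) * pd e u x)\<^sup>2)"
      by (simp add: N_def sum_distrib_left power_mult_distrib)
    also have "\<dots> = (\<Sum>e\<in>Basis. k\<^sup>2 * (((x - p) \<bullet> e) * ((x - p) \<bullet> e)))"
      by (intro sum.cong refl) (simp add: v_def grad[OF x] power2_eq_square)
    also have "\<dots> = k\<^sup>2 * ((x - p) \<bullet> (x - p))" by (simp add: euclidean_inner[of "x - p" "x - p"] sum_distrib_left)
    finally have "v powr (- g) * (N * v powr (- g)) = k\<^sup>2 * ((x - p) \<bullet> (x - p))" by (simp add: power2_eq_square mult_ac)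
    then have "P * (v powr (- g) * v) = k\<^sup>2 * ((x - p) \<bullet> (x - p))" unfolding NP by (simp add: mult_ac)
    moreover have "v powr (- g) * v = v powr (1 - g)" using v by (simp add: powr_diff powr_minus field_simps)
    moreover have "P = k * (n - 2)" using n by (simp add: k_def)
    ultimately have "k * (n - 2) * v powr (1 - g) = k * k * ((x - p) \<bullet> (x - p))" by (simp add: power2_eq_square)
    then have "k * ((n - 2) * v powr (1 - g)) = k * (k * ((x - p) \<bullet> (x - p)))" by (simp only: mult.assoc)
    then have "(n - 2) * v powr (1 - g) = k * ((x - p) \<bullet> (x - p))" using k by (metis mult_cancel_left less_irrefl)
    moreover have "n - 2 \<noteq> 0" using n by simp
    ultimately have e1: "v powr (1 - g) = \<kappa> * ((x - p) \<bullet> (x - p))"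
      unfolding \<kappa>_def by (metis nonzero_mult_div_cancel_left times_divide_eq_left)
    have "v powr (1 - g) > 0" using v by simp
    then have xp: "x \<noteq> p" using e1 by auto
    have ex: "(1 - g) * (1 - n / 2) = 1" using n by (simp add: g_def field_simps)
    have "v = (v powr (1 - g)) powr (1 - n / 2)" using v by (simp add: powr_powr ex)
    also have "\<dots> = \<kappa> powr (1 - n / 2) * fundamental_solution p x"
      unfolding e1 using \<kappa> by (simp add: powr_mult fundamental_solution_def n_def)
    finally show ?thesis using xp by (simp add: v_def)
  qed
  show ?thesis using main \<kappa> by (intro exI[of _ p] exI[of _ "\<kappa> powr (1 - n / 2)"]) simp
qed

section \<open>Derivatives relative to a set with an interior ball\<close>

lemma higher_differentiable_on_2D:
  assumes "higher_differentiable_on S u 2" "x \<in> S"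
  shows "u differentiable (at x within S)"
    "(\<lambda>y. frechet_derivative u (at y within S) v) differentiable (at x within S)"
  using assms by (auto simp: numeral_2_eq_2 differentiable_on_def)

lemma continuous_on_second_derivative:
  assumes "higher_differentiable_on S u 2"
  shows "continuous_on S (\<lambda>x. frechet_derivative (\<lambda>y. frechet_derivative u (at y within S) v) (at x within S) w)"
  using assms by (simp add: numeral_2_eq_2)

lemma harmonic_onI_laplacian:
  assumes S: "open S" and C2: "higher_differentiable_on S u 2" and lap: "\<And>x. x \<in> S \<Longrightarrow> laplacian u x = 0"
  shows "harmonic_on S u"
proof -
  have at: "at x within S = at x" if "x \<in> S" for x using that S by (rule at_within_open)
  have "pd b u differentiable (at x)" if x: "x \<in> S" for x b
  proof -
    have "(\<lambda>y. frechet_derivative u (at y within S) b) differentiable (at x)"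
      using higher_differentiable_on_2D(2)[OF C2 x] at[OF x] by simp
    then obtain D where "((\<lambda>y. frechet_derivative u (at y within S) b) has_derivative D) (at x)"
      by (auto simp: differentiable_def)
    then have "(pd b u has_derivative D) (at x)"
      by (rule has_derivative_transform_within_open[OF _ S x]) (simp add: pd_def at)
    then show ?thesis by (auto simp: differentiable_def)
  qed
  moreover have "u differentiable (at x)" if "x \<in> S" for x
    using higher_differentiable_on_2D(1)[OF C2 that] at[OF that] by simp
  moreover have "(\<Sum>b\<in>Basis. pd b (pd b u) x) = 0" if "x \<in> S" for x
    using lap[OF that] by (simp add: laplacian_def hessian_def pd_def[abs_def])
  ultimately show ?thesis using S by (simp add: harmonic_on_def)
qed

lemma has_derivative_grad_within:
  assumes "u differentiable (at x within S)"
  shows "(u has_derivative (\<lambda>v. grad_within S u x \<bullet> v)) (at x within S)"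
proof -
  let ?D = "frechet_derivative u (at x within S)"
  have D: "(u has_derivative ?D) (at x within S)" using assms by (simp add: frechet_derivative_works)
  have lin: "linear ?D" by (rule has_derivative_linear[OF D])
  have "?D v = grad_within S u x \<bullet> v" for v
  proof -
    have "?D v = ?D (\<Sum>b\<in>Basis. (v \<bullet> b) *\<^sub>R b)" by (simp add: euclidean_representation)
    also have "\<dots> = (\<Sum>b\<in>Basis. (v \<bullet> b) * ?D b)" by (subst linear_sum[OF lin]) (simp add: linear_cmul[OF lin])
    finally show ?thesis by (simp add: grad_within_def inner_sum_left inner_sum_right inner_commute[of _ v] mult.commute)
  qed
  then have "?D = (\<lambda>v. grad_within S u x \<bullet> v)" by (rule ext)
  then show ?thesis using D by simp
qed

text \<open>The Hessian as the linear map \<open>v \<mapsto> D\<^sup>2u(v, -)\<close>, expressed by vectors.\<close>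

definition hess_within :: "'a::euclidean_space set \<Rightarrow> ('a \<Rightarrow> real) \<Rightarrow> 'a \<Rightarrow> 'a \<Rightarrow> 'a" where
  "hess_within S u x v = (\<Sum>b\<in>Basis. frechet_derivative (\<lambda>y. frechet_derivative u (at y within S) b) (at x within S) v *\<^sub>R b)"

lemma grad_within_has_derivative:
  assumes "\<And>b. b \<in> Basis \<Longrightarrow> (\<lambda>y. frechet_derivative u (at y within S) b) differentiable (at x within S)"
  shows "(grad_within S u has_derivative hess_within S u x) (at x within S)"
  unfolding grad_within_def[abs_def] hess_within_def
  using assms by (intro has_derivative_sum has_derivative_scaleR_left) (simp add: frechet_derivative_works)

lemma has_derivative_along_ray:
  fixes f :: "'a::real_normed_vector \<Rightarrow> 'b::real_normed_vector"
  assumes f: "(f has_derivative f') (at x within S)" and ray: "\<And>t. t \<in> {0..\<epsilon>} \<Longrightarrow> x + t *\<^sub>R v \<in> S"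
  shows "((\<lambda>t. f (x + t *\<^sub>R v)) has_vector_derivative f' v) (at 0 within {0..\<epsilon>})"
proof -
  have l: "((\<lambda>t. x + t *\<^sub>R v) has_derivative (\<lambda>t. t *\<^sub>R v)) (at 0 within {0..\<epsilon>})"
    by (auto intro!: derivative_eq_intros)
  have "(f has_derivative f') (at (x + 0 *\<^sub>R v) within (\<lambda>t. x + t *\<^sub>R v) ` {0..\<epsilon>})"
    using f ray by (auto intro: has_derivative_subset)
  from has_derivative_in_compose[OF l this]
  have "((\<lambda>t. f (x + t *\<^sub>R v)) has_derivative (\<lambda>t. f' (t *\<^sub>R v))) (at 0 within {0..\<epsilon>})" .
  moreover have "f' (t *\<^sub>R v) = t *\<^sub>R f' v" for t
    using has_derivative_linear[OF f] by (simp add: linear_cmul)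
  ultimately show ?thesis by (simp add: has_vector_derivative_def)
qed

lemma ray_in_ball:
  fixes x z :: "'a::real_inner"
  assumes r: "r > 0" and x: "dist z x = r" and v: "(z - x) \<bullet> v > 0"
  shows "\<exists>\<epsilon>>0. \<forall>t. 0 < t \<and> t \<le> \<epsilon> \<longrightarrow> x + t *\<^sub>R v \<in> ball z r"
proof -
  have v0: "v \<noteq> 0" using v by auto
  define \<epsilon> where "\<epsilon> = ((z - x) \<bullet> v) / (v \<bullet> v)"
  have \<epsilon>: "\<epsilon> > 0" using v v0 by (simp add: \<epsilon>_def)
  have "x + t *\<^sub>R v \<in> ball z r" if t: "0 < t" "t \<le> \<epsilon>" for t
  proof -
    have "t * (v \<bullet> v) \<le> (z - x) \<bullet> v" using t v0 by (simp add: \<epsilon>_def pos_le_divide_eq)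
    then have "t * (v \<bullet> v) < 2 * ((z - x) \<bullet> v)" using v by linarith
    then have "t * (t * (v \<bullet> v)) < t * (2 * ((z - x) \<bullet> v))" using t by (intro mult_strict_left_mono) auto
    moreover have "(dist z (x + t *\<^sub>R v))\<^sup>2 = (z - x) \<bullet> (z - x) - t * (2 * ((z - x) \<bullet> v)) + t * (t * (v \<bullet> v))"
      unfolding dist_norm power2_norm_eq_inner by (simp add: algebra_simps inner_commute)
    moreover have "(z - x) \<bullet> (z - x) = r\<^sup>2" using x by (simp add: dist_norm dot_square_norm)
    ultimately have "(dist z (x + t *\<^sub>R v))\<^sup>2 < r\<^sup>2" by linarith
    then show ?thesis using r by (simp add: power2_less_imp_less)
  qed
  then show ?thesis using \<epsilon> by blast
qed

text \<open>The derivatives in the directions that point into the ball are determined by one-sided limits. These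
  directions form an open half space, and every vector is a difference of two of them.\<close>

lemma has_derivative_within_unique:
  fixes f :: "'a::euclidean_space \<Rightarrow> 'b::real_normed_vector"
  assumes r: "r > 0" and ball: "ball z r \<subseteq> S" "dist z x = r" "x \<in> S"
    and f: "(f has_derivative f1) (at x within S)" "(f has_derivative f2) (at x within S)"
  shows "f1 = f2"
proof
  have half: "f1 v = f2 v" if v: "(z - x) \<bullet> v > 0" for v
  proof -
    obtain \<epsilon> where \<epsilon>: "\<epsilon> > 0" "\<And>t. 0 < t \<Longrightarrow> t \<le> \<epsilon> \<Longrightarrow> x + t *\<^sub>R v \<in> ball z r"
      using ray_in_ball[OF r ball(2) v] by blast
    have ray: "x + t *\<^sub>R v \<in> S" if "t \<in> {0..\<epsilon>}" for t
      using \<epsilon>(2)[of t] that ball by (cases "t = 0") auto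
    show ?thesis
      by (rule vector_derivative_unique_within[OF _ has_derivative_along_ray[OF f(1) ray] has_derivative_along_ray[OF f(2) ray]])
        (use \<epsilon>(1) in \<open>auto simp: at_within_Icc_at_right\<close>)
  qed
  fix v
  let ?m = "z - x"
  have m: "?m \<bullet> ?m > 0" using r ball(2) by auto
  define s where "s = \<bar>?m \<bullet> v\<bar> / (?m \<bullet> ?m) + 1"
  have s: "s > 0" by (simp add: s_def add_nonneg_pos)
  have "s * (?m \<bullet> ?m) = \<bar>?m \<bullet> v\<bar> + ?m \<bullet> ?m" using m by (simp add: s_def distrib_right)
  then have "?m \<bullet> (v + s *\<^sub>R ?m) > 0" unfolding inner_add_right inner_scaleR_right using m by linarith
  then have "f1 (v + s *\<^sub>R ?m) = f2 (v + s *\<^sub>R ?m)" by (rule half)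
  moreover have "f1 (s *\<^sub>R ?m) = f2 (s *\<^sub>R ?m)" using m s by (intro half) simp
  ultimately show "f1 v = f2 v"
    using linear_add[OF has_derivative_linear[OF f(1)]] linear_add[OF has_derivative_linear[OF f(2)]] by simp
qed

text \<open>At boundary points derivatives are relative to \<open>S\<close>, so the differential of the normal field has to be
  assumed unique. Its component along the gradient, which comes from differentiating the norm, drops
  out against tangential vectors; what is left is the trace of \<open>A\<close> over the tangent space.\<close>

lemma mean_curvature_eq_hess_within:
  fixes u :: "'a::euclidean_space \<Rightarrow> real"
  assumes uniq: "\<And>f1 f2. (unit_normal S u has_derivative f1) (at x within S) \<Longrightarrow>
       (unit_normal S u has_derivative f2) (at x within S) \<Longrightarrow> f1 = f2"
    and dg: "(grad_within S u has_derivative A) (at x within S)" and nz: "grad_within S u x \<noteq> 0"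
  shows "mean_curvature S u x =
    (A (unit_normal S u x) \<bullet> unit_normal S u x - (\<Sum>b\<in>Basis. A b \<bullet> b)) / norm (grad_within S u x)"
proof -
  define g where "g = grad_within S u"
  define \<nu> where "\<nu> = unit_normal S u x"
  have linA: "linear A" using dg by (rule has_derivative_linear)
  have gx: "g x \<noteq> 0" using nz by (simp add: g_def)
  have nu: "\<nu> = - (g x /\<^sub>R norm (g x))" by (simp add: \<nu>_def unit_normal_def g_def)
  have nunu: "\<nu> \<bullet> \<nu> = 1" using gx by (simp add: nu dot_square_norm power2_eq_square)
  obtain n' where n': "((\<lambda>y. inverse (norm (g y))) has_derivative n') (at x within S)"
  proof -
    have "(\<lambda>y. norm (g y)) differentiable (at x within S)"
      using has_derivative_compose[OF dg[folded g_def] has_derivative_norm[OF gx]] by (auto simp: differentiable_def)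
    then have "(\<lambda>y. inverse (norm (g y))) differentiable (at x within S)"
      using gx by (intro differentiable_inverse) auto
    then show ?thesis using that by (auto simp: differentiable_def)
  qed
  have dnu: "(unit_normal S u has_derivative (\<lambda>v. - (inverse (norm (g x)) *\<^sub>R A v + n' v *\<^sub>R g x))) (at x within S)"
    using has_derivative_minus[OF has_derivative_scaleR[OF n' dg[folded g_def]]]
    by (simp add: unit_normal_def[abs_def] g_def)
  have fd: "frechet_derivative (unit_normal S u) (at x within S) = (\<lambda>v. - (inverse (norm (g x)) *\<^sub>R A v + n' v *\<^sub>R g x))"
    by (rule uniq[OF _ dnu]) (use dnu in \<open>auto simp: differentiable_def simp flip: frechet_derivative_works\<close>)
  have W: "frechet_derivative (unit_normal S u) (at x within S) v \<bullet> w = - (A v \<bullet> w) / norm (g x)"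
    if "w \<bullet> \<nu> = 0" for v w
  proof -
    have "g x \<bullet> w = 0" using that gx by (simp add: nu inner_commute)
    then show ?thesis by (simp add: fd inner_diff_left divide_inverse mult.commute)
  qed
  have tang: "tangential \<nu> b \<bullet> \<nu> = 0" for b by (simp add: tangential_def inner_diff_left nunu)
  have 1: "(\<Sum>b\<in>Basis. (b \<bullet> \<nu>) * (A \<nu> \<bullet> b)) = A \<nu> \<bullet> \<nu>"
    by (subst (2) euclidean_inner) (simp add: inner_commute mult.commute)
  have 2: "(\<Sum>b\<in>Basis. (b \<bullet> \<nu>) * (A b \<bullet> \<nu>)) = A \<nu> \<bullet> \<nu>"
  proof -
    have "(\<Sum>b\<in>Basis. (b \<bullet> \<nu>) * (A b \<bullet> \<nu>)) = A (\<Sum>b\<in>Basis. (\<nu> \<bullet> b) *\<^sub>R b) \<bullet> \<nu>"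
      by (simp add: linear_sum[OF linA] linear_cmul[OF linA] inner_sum_right inner_commute[of _ \<nu>])
    then show ?thesis by (simp add: euclidean_representation)
  qed
  have 3: "(\<Sum>b\<in>Basis. (b \<bullet> \<nu>) * (b \<bullet> \<nu>)) = 1"
    using nunu by (subst (asm) euclidean_inner) (simp add: inner_commute)
  have "mean_curvature S u x = (\<Sum>b\<in>Basis. - (A (tangential \<nu> b) \<bullet> tangential \<nu> b) / norm (g x))"
    unfolding mean_curvature_def \<nu>_def[symmetric] using W[OF tang] by simp
  also have "\<dots> = - (\<Sum>b\<in>Basis. A (tangential \<nu> b) \<bullet> tangential \<nu> b) / norm (g x)"
    by (simp add: sum_negf sum_divide_distrib)
  also have "(\<Sum>b\<in>Basis. A (tangential \<nu> b) \<bullet> tangential \<nu> b) =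
      (\<Sum>b\<in>Basis. A b \<bullet> b - (b \<bullet> \<nu>) * (A b \<bullet> \<nu>) - (b \<bullet> \<nu>) * (A \<nu> \<bullet> b)
        + ((b \<bullet> \<nu>) * (b \<bullet> \<nu>)) * (A \<nu> \<bullet> \<nu>))"
    by (simp add: tangential_def linear_diff[OF linA] linear_cmul[OF linA] inner_diff_left
        inner_diff_right algebra_simps)
  also have "\<dots> = (\<Sum>b\<in>Basis. A b \<bullet> b) - A \<nu> \<bullet> \<nu>"
    by (simp add: sum.distrib sum_subtractf 1 2 3 flip: sum_distrib_right)
  finally show ?thesis by (simp add: g_def \<nu>_def)
qed

section \<open>Interior balls\<close>

text \<open>To first order \<open>\<rho> x\<close> is \<open>|g y| (m \<bullet> h)\<close> with \<open>h = x - y\<close> and the unit vector \<open>m\<close> in direction \<open>g y\<close>, and on the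
  ball with centre \<open>y + r m\<close> one has \<open>|h|\<^sup>2 \<le> 2 r (m \<bullet> h)\<close>. So for small \<open>r\<close> the linear term dominates the
  quadratic error.\<close>

lemma interior_ball:
  fixes \<rho> :: "'a::euclidean_space \<Rightarrow> real"
  assumes U: "open U" "y \<in> U" and d\<rho>: "\<And>x. x \<in> U \<Longrightarrow> (\<rho> has_derivative (\<lambda>v. g x \<bullet> v)) (at x)"
    and dg: "(g has_derivative A) (at y)" and nz: "g y \<noteq> 0" and zero: "\<rho> y = 0"
  shows "\<exists>z r. r > 0 \<and> dist z y = r \<and> (\<forall>x\<in>cball z r. x \<noteq> y \<longrightarrow> x \<in> U \<and> \<rho> x > 0)"
proof -
  obtain K where K: "K > 0" "\<And>h. norm (A h) \<le> norm h * K"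
    using bounded_linear.pos_bounded[OF has_derivative_bounded_linear[OF dg]] by blast
  obtain d1 where d1: "d1 > 0" "\<And>x. norm (x - y) < d1 \<Longrightarrow> norm (g x - g y - A (x - y)) \<le> 1 * norm (x - y)"
    using dg unfolding has_derivative_at_alt by (metis zero_less_one)
  obtain d2 where d2: "d2 > 0" "ball y d2 \<subseteq> U" using U openE by blast
  define L where "L = 1 + K"
  have L: "L > 0" using K by (simp add: L_def)
  have lip: "norm (g x - g y) \<le> L * norm (x - y)" if "norm (x - y) < d1" for x
    using d1(2)[OF that] K(2)[of "x - y"] norm_triangle_sub[of "g x - g y" "A (x - y)"] by (simp add: L_def algebra_simps)
  define m where "m = g y /\<^sub>R norm (g y)"
  have m: "norm m = 1" "g y = norm (g y) *\<^sub>R m" using nz by (auto simp: m_def)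
  define d where "d = min d1 d2"
  have d: "d > 0" using d1 d2 by (simp add: d_def)
  define r where "r = min (norm (g y) / (4 * L)) (d / 4)"
  have r: "r > 0" "2 * r < d" "r * (4 * L) \<le> norm (g y)"
  proof -
    show "r > 0" using nz L d by (simp add: r_def)
    show "2 * r < d" using d by (simp add: r_def min_def)
    have "r \<le> norm (g y) / (4 * L)" by (simp add: r_def)
    then show "r * (4 * L) \<le> norm (g y)" using L by (simp add: pos_le_divide_eq)
  qed
  define z where "z = y + r *\<^sub>R m"
  have "x \<in> U \<and> \<rho> x > 0" if x: "x \<in> cball z r" "x \<noteq> y" for x
  proof -
    define h where "h = x - y"
    have h0: "h \<noteq> 0" using x by (simp add: h_def)
    have "norm (h - r *\<^sub>R m) \<le> r" using x(1) by (simp add: h_def z_def dist_norm norm_minus_commute algebra_simps)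
    then have "(h - r *\<^sub>R m) \<bullet> (h - r *\<^sub>R m) \<le> r\<^sup>2" using r(1) by (simp add: dot_square_norm power_mono)
    then have "h \<bullet> h - 2 * r * (m \<bullet> h) + r * r * (m \<bullet> m) \<le> r * r"
      by (simp add: algebra_simps inner_commute power2_eq_square)
    then have hm: "h \<bullet> h \<le> 2 * r * (m \<bullet> h)" using m(1) by (simp add: dot_square_norm)
    have "norm h \<le> norm (h - r *\<^sub>R m) + norm (r *\<^sub>R m)" by (metis diff_add_cancel norm_triangle_ineq)
    then have nh: "norm h < d" using \<open>norm (h - r *\<^sub>R m) \<le> r\<close> r m(1) by simp
    have seg: "y + t *\<^sub>R h \<in> U \<and> norm (g (y + t *\<^sub>R h) - g y) \<le> L * norm h" if "0 \<le> t" "t \<le> 1" for t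
    proof -
      have "t * norm h \<le> 1 * norm h" using that by (intro mult_right_mono) auto
      then have nt: "norm (t *\<^sub>R h) \<le> norm h" using that by simp
      then have "y + t *\<^sub>R h \<in> ball y d2" using nh by (simp add: dist_norm d_def)
      moreover have "norm (g (y + t *\<^sub>R h) - g y) \<le> L * norm (t *\<^sub>R h)"
        using lip[of "y + t *\<^sub>R h"] nt nh by (simp add: d_def)
      moreover have "L * norm (t *\<^sub>R h) \<le> L * norm h" using nt L by (intro mult_left_mono) auto
      ultimately show ?thesis using d2 by auto
    qed
    have "\<exists>t. 0 < t \<and> t < 1 \<and> \<rho> (y + 1 *\<^sub>R h) - \<rho> (y + 0 *\<^sub>R h) = (1 - 0) * (g (y + t *\<^sub>R h) \<bullet> h)"
      by (rule MVT2) (use seg has_derivative_along_line[OF d\<rho>] in auto)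
    then obtain t where t: "0 < t" "t < 1" "\<rho> x = g (y + t *\<^sub>R h) \<bullet> h" using zero by (auto simp: h_def)
    have "\<bar>(g (y + t *\<^sub>R h) - g y) \<bullet> h\<bar> \<le> norm (g (y + t *\<^sub>R h) - g y) * norm h" by (rule Cauchy_Schwarz_ineq2)
    also have "\<dots> \<le> L * norm h * norm h" using seg[of t] t by (intro mult_right_mono) auto
    also have "\<dots> = L * (h \<bullet> h)" by (simp add: dot_square_norm power2_eq_square)
    finally have "\<rho> x \<ge> g y \<bullet> h - L * (h \<bullet> h)" unfolding t(3) by (simp add: inner_diff_left)
    moreover have "g y \<bullet> h = norm (g y) * (m \<bullet> h)" by (subst m(2)) simp
    moreover have "norm (g y) * (m \<bullet> h) \<ge> r * (4 * L) * (m \<bullet> h)"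
    proof (rule mult_right_mono[OF r(3)])
      have "0 \<le> 2 * r * (m \<bullet> h)" using hm inner_ge_zero[of h] by linarith
      then show "0 \<le> m \<bullet> h" using r(1) by (simp add: zero_le_mult_iff)
    qed
    moreover have "r * (4 * L) * (m \<bullet> h) \<ge> 2 * L * (h \<bullet> h)"
      using mult_left_mono[OF hm, of "2 * L"] L by (simp add: algebra_simps)
    moreover have "L * (h \<bullet> h) > 0" using L h0 by simp
    ultimately have "\<rho> x > 0" by linarith
    moreover have "x \<in> U" using seg[of 1] by (simp add: h_def)
    ultimately show ?thesis by blast
  qed
  moreover have "dist z y = r" using r(1) m(1) by (simp add: z_def dist_norm)
  ultimately show ?thesis using r(1) by blast
qed

lemma smooth_boundary_exterior_ball:
  fixes \<Omega> :: "'a::euclidean_space set"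
  assumes smooth: "smooth_boundary \<Omega>" and op: "open \<Omega>" and y: "y \<in> frontier \<Omega>"
  shows "\<exists>z r. r > 0 \<and> dist z y = r \<and> cball z r - {y} \<subseteq> - closure \<Omega>"
proof -
  obtain U and \<rho> :: "'a \<Rightarrow> real" where U': "open U" "y \<in> U" "\<forall>k. higher_differentiable_on U \<rho> k"
    "\<forall>x\<in>U. grad_within U \<rho> x \<noteq> 0" "\<Omega> \<inter> U = {x \<in> U. \<rho> x < 0}"
    using bspec[OF smooth[unfolded smooth_boundary_def] y] by (elim exE conjE) (rule that)
  have U: "open U" "y \<in> U" "higher_differentiable_on U \<rho> 2" "grad_within U \<rho> y \<noteq> 0" "\<Omega> \<inter> U = {x \<in> U. \<rho> x < 0}"
    using U' by (auto simp del: higher_differentiable_on.simps)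
  have at: "at x within U = at x" if "x \<in> U" for x using that U(1) by (rule at_within_open)
  have d: "(\<rho> has_derivative (\<lambda>v. grad_within U \<rho> x \<bullet> v)) (at x)" if "x \<in> U" for x
    using has_derivative_grad_within[OF higher_differentiable_on_2D(1)[OF U(3) that]] at[OF that] by simp
  have dg: "(grad_within U \<rho> has_derivative hess_within U \<rho> y) (at y)"
    using grad_within_has_derivative[OF higher_differentiable_on_2D(2)[OF U(3,2)]] at[OF U(2)] by simp
  have cont: "continuous_on U \<rho>"
    using d by (meson has_derivative_continuous continuous_at_imp_continuous_on)
  have "\<rho> y = 0"
  proof (rule antisym)
    have "y \<notin> \<Omega>" using y op by (simp add: frontier_def interior_open)
    then show "0 \<le> \<rho> y" using U by force
    show "\<rho> y \<le> 0"
    proof (rule ccontr)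
      assume "\<not> \<rho> y \<le> 0"
      have o: "open (U \<inter> \<rho> -` {0<..})" by (rule continuous_open_preimage[OF cont U(1)]) auto
      moreover have "y \<in> U \<inter> \<rho> -` {0<..}" using U \<open>\<not> \<rho> y \<le> 0\<close> by auto
      moreover have "y \<in> closure \<Omega>" using y by (simp add: frontier_def)
      ultimately have "\<Omega> \<inter> (U \<inter> \<rho> -` {0<..}) \<noteq> {}" by (meson open_Int_closure_eq_empty disjoint_iff inf_commute)
      then show False using U(5) by force
    qed
  qed
  from interior_ball[OF U(1,2) d dg U(4) this] obtain z r where zr: "r > 0" "dist z y = r"
    "\<And>x. x \<in> cball z r \<Longrightarrow> x \<noteq> y \<Longrightarrow> x \<in> U \<and> \<rho> x > 0" by blast
  have "x \<notin> closure \<Omega>" if x: "x \<in> cball z r" "x \<noteq> y" for x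
  proof
    assume "x \<in> closure \<Omega>"
    have o: "open (U \<inter> \<rho> -` {0<..})" by (rule continuous_open_preimage[OF cont U(1)]) auto
    moreover have "x \<in> U \<inter> \<rho> -` {0<..}" using zr(3)[OF x] by auto
    ultimately have "\<Omega> \<inter> (U \<inter> \<rho> -` {0<..}) \<noteq> {}" using \<open>x \<in> closure \<Omega>\<close> by (meson open_Int_closure_eq_empty disjoint_iff inf_commute)
    then show False using U(5) by force
  qed
  then show ?thesis using zr by blast
qed

section \<open>Decay at infinity\<close>

lemma fundamental_solution_at_infinity:
  assumes "DIM('a::euclidean_space) \<ge> 3"
  shows "(fundamental_solution (0::'a) \<longlongrightarrow> 0) at_infinity"
proof -
  have "filterlim (\<lambda>x::'a. norm x ^ 2) at_top at_infinity"
    by (intro filterlim_pow_at_top filterlim_norm_at_top) auto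
  then have "((\<lambda>x::'a. (norm x ^ 2) powr (1 - real DIM('a) / 2)) \<longlongrightarrow> 0) at_infinity"
    using assms by (intro tendsto_neg_powr) auto
  then show ?thesis by (simp add: fundamental_solution_def[abs_def] dot_square_norm)
qed

lemma eventually_at_infinity_leD:
  fixes f :: "'a::real_normed_vector \<Rightarrow> real"
  assumes "(f \<longlongrightarrow> l) at_infinity" "e > l"
  shows "\<exists>R. \<forall>x. norm x \<ge> R \<longrightarrow> f x \<le> e"
  using order_tendstoD(2)[OF assms] by (auto simp: eventually_at_infinity intro: less_imp_le)

lemma harmonic_comparison:
  fixes f g :: "'a::euclidean_space \<Rightarrow> real"
  assumes W: "open W" and f: "harmonic_on W f" and g: "harmonic_on W g"
    and c: "continuous_on (closure W) f" "continuous_on (closure W) g"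
    and bd: "\<And>x. x \<in> frontier W \<Longrightarrow> f x \<le> g x"
    and lim: "(f \<longlongrightarrow> k) at_infinity" "(g \<longlongrightarrow> l) at_infinity" "k \<le> l" and x: "x \<in> W"
  shows "f x \<le> g x"
proof -
  have h: "harmonic_on W (\<lambda>x. 1 * f x + (-1) * g x)" by (rule harmonic_on_lincomb[OF f g])
  have "1 * f x + (-1) * g x \<le> 0"
  proof (rule weak_max_unbounded[OF W _ second_partials_harmonic[OF h] _ _ _ x])
    show "continuous_on (closure W) (\<lambda>x. 1 * f x + (-1) * g x)" by (intro continuous_intros c)
    have "((\<lambda>x. 1 * f x + (-1) * g x) \<longlongrightarrow> 1 * k + (-1) * l) at_infinity" by (intro tendsto_intros lim)
    then show "\<exists>R. \<forall>x\<in>closure W. norm x \<ge> R \<longrightarrow> 1 * f x + (-1) * g x \<le> e" if "e > 0" for e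
      using eventually_at_infinity_leD[of _ "1 * k + (-1) * l" e] lim(3) that by force
  qed (use harmonic_onD(3)[OF h] bd in auto)
  then show ?thesis by simp
qed

text \<open>Multiples of \<open>|x|\<^sup>2\<^sup>-\<^sup>n\<close> bound \<open>u\<close> from below, using a ball around 0 inside \<open>\<Omega>\<close>, and from above outside a ball
  that contains \<open>\<Omega>\<close>. Hence for large \<open>|x|\<close> the values of \<open>u\<close> on the ball of radius \<open>|x| / 2\<close> around \<open>x\<close> are
  comparable to \<open>u x\<close>, and the gradient estimate yields \<open>|Du| \<le> C u / |x|\<close>. The lower bound on \<open>u\<close> turns this
  into the bound on \<open>grad_power u\<close>, which is the decay at infinity that the comparison argument needs.\<close>

lemma exterior_potential_bounds:
  fixes u :: "'a::euclidean_space \<Rightarrow> real"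
  assumes dim: "DIM('a) \<ge> 3" and \<Omega>: "open \<Omega>" "bounded \<Omega>" "0 \<in> \<Omega>"
    and cont: "continuous_on (- \<Omega>) u" and u: "harmonic_on (- closure \<Omega>) u"
    and bd: "\<And>x. x \<in> frontier \<Omega> \<Longrightarrow> u x = 1" and inf: "(u \<longlongrightarrow> 0) at_infinity"
  shows "\<And>x. x \<notin> \<Omega> \<Longrightarrow> u x \<le> 1" "\<And>x. x \<notin> \<Omega> \<Longrightarrow> u x > 0"
    "\<exists>C R. C \<ge> 0 \<and> (\<forall>x. norm x \<ge> R \<longrightarrow> x \<notin> closure \<Omega> \<and> grad_power u x \<le> C * u x)"
proof -
  define n where "n = real DIM('a)"
  have n: "n \<ge> 3" using dim by (simp add: n_def)
  define a where "a = 1 - n / 2"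
  have a: "a < 0" using n by (simp add: a_def)
  let ?\<Gamma> = "fundamental_solution (0::'a)"
  have \<Gamma>: "?\<Gamma> x = ((norm x)\<^sup>2) powr a" for x
    by (simp add: fundamental_solution_def a_def n_def dot_square_norm)
  define E where "E = - closure \<Omega>"
  have E: "open E" by (simp add: E_def open_Compl)
  have u: "harmonic_on E u" using u by (simp add: E_def)
  have clE: "closure E \<subseteq> - \<Omega>"
    using \<Omega>(1) closure_subset by (intro closure_minimal) (auto simp: E_def closed_Compl)
  have frE: "frontier E \<subseteq> frontier \<Omega>" 
  proof -
    have "frontier (closure \<Omega>) \<subseteq> frontier \<Omega>"
      using interior_mono[OF closure_subset, of \<Omega>] by (auto simp: frontier_def)
    then show ?thesis by (simp add: E_def frontier_complement)
  qed
  have notin: "x \<in> E \<or> x \<in> frontier \<Omega>" if "x \<notin> \<Omega>" for x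
    using that \<Omega>(1) by (auto simp: E_def frontier_def interior_open)
  have cE: "continuous_on (closure E) u" by (rule continuous_on_subset[OF cont clE])
  show le1: "u x \<le> 1" if "x \<notin> \<Omega>" for x
  proof (cases "x \<in> E")
    case True
    show ?thesis
      by (rule harmonic_comparison[OF E u harmonic_on_const[OF E] cE _ _ inf tendsto_const _ True]) (use frE bd in auto)
  qed (use notin[OF that] bd in auto)
  obtain r0 where r0: "r0 > 0" "ball 0 r0 \<subseteq> \<Omega>" using \<Omega>(1,3) openE by blast
  define \<kappa>0 where "\<kappa>0 = (r0\<^sup>2) powr (- a)"
  have \<kappa>0: "\<kappa>0 > 0" using r0 by (simp add: \<kappa>0_def)
  have h\<Gamma>: "harmonic_on V (\<lambda>x. k * ?\<Gamma> x + 0 * ?\<Gamma> x)" if "open V" "0 \<notin> V" for V k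
    by (rule harmonic_on_subset[OF harmonic_on_lincomb[OF harmonic_on_fundamental_solution harmonic_on_fundamental_solution]])
      (use that in auto)
  have lim\<Gamma>: "((\<lambda>x. k * ?\<Gamma> x + 0 * ?\<Gamma> x) \<longlongrightarrow> 0) at_infinity" for k
    using tendsto_mult_left[OF fundamental_solution_at_infinity[OF dim], of k] by simp
  have c\<Gamma>: "continuous_on V (\<lambda>x. k * ?\<Gamma> x + 0 * ?\<Gamma> x)" if "0 \<notin> V" for V k
    by (rule continuous_on_subset[OF harmonic_on_continuous[OF h\<Gamma>[of "- {0}"]]]) (use that in auto)
  have lower_bd: "\<kappa>0 * ?\<Gamma> x \<le> 1" if "x \<notin> \<Omega>" for x
  proof -
    have "norm x \<ge> r0" using that r0 by force
    then have "(norm x)\<^sup>2 powr a \<le> (r0\<^sup>2) powr a" using r0 a by (intro powr_mono2') (auto intro: power_mono)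
    then have "\<kappa>0 * ?\<Gamma> x \<le> \<kappa>0 * (r0\<^sup>2) powr a" using \<kappa>0 by (simp add: \<Gamma>)
    also have "\<dots> = 1" using r0 by (simp add: \<kappa>0_def flip: powr_add)
    finally show ?thesis .
  qed
  have lower: "\<kappa>0 * ?\<Gamma> x \<le> u x" if x: "x \<notin> \<Omega>" for x
  proof (cases "x \<in> E")
    case True
    have "0 \<notin> closure E" using clE \<Omega>(3) by auto
    moreover then have "0 \<notin> E" using closure_subset by blast
    ultimately have "\<kappa>0 * ?\<Gamma> x + 0 * ?\<Gamma> x \<le> u x"
      by (intro harmonic_comparison[OF E h\<Gamma> u c\<Gamma> cE _ lim\<Gamma> inf order_refl True] E)
        (use frE bd lower_bd \<Omega>(1) in \<open>force simp: frontier_def interior_open\<close>)+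
    then show ?thesis by simp
  next
    case False
    then show ?thesis using notin[OF x] bd lower_bd[OF x] by auto
  qed
  show pos: "u x > 0" if "x \<notin> \<Omega>" for x
  proof -
    have "x \<noteq> 0" using that \<Omega>(3) by auto
    then have "\<kappa>0 * ?\<Gamma> x > 0" using \<kappa>0 fundamental_solution_pos[of x 0] by simp
    then show ?thesis using lower[OF that] by linarith
  qed
  obtain R0 where R0: "R0 > 0" "closure \<Omega> \<subseteq> ball 0 R0"
    using bounded_subset_ballD[OF bounded_closure[OF \<Omega>(2)], of 0] by auto
  define \<kappa>1 where "\<kappa>1 = (R0\<^sup>2) powr (- a)"
  have \<kappa>1: "\<kappa>1 > 0" using R0 by (simp add: \<kappa>1_def)
  define V where "V = - cball (0::'a) R0"
  have V: "open V" "V \<subseteq> E" "closure V \<subseteq> - ball 0 R0"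
    using R0 by (auto simp: V_def E_def closure_complement)
  have upper: "u x \<le> \<kappa>1 * ?\<Gamma> x" if x: "x \<in> V" for x
  proof -
    have 0: "0 \<notin> V" "0 \<notin> closure V" using V(3) R0(1) by (auto simp: V_def)
    have cV: "closure V \<subseteq> - \<Omega>" using V(3) R0(2) closure_subset by blast
    have "u x \<le> \<kappa>1 * ?\<Gamma> x + 0 * ?\<Gamma> x"
    proof (rule harmonic_comparison[OF V(1) harmonic_on_subset[OF u V(1,2)] h\<Gamma>[OF V(1) 0(1)] continuous_on_subset[OF cont cV] c\<Gamma>[OF 0(2)] _ inf lim\<Gamma> order_refl x])
      fix y assume y: "y \<in> frontier V"
      then have "norm y = R0" using R0(1) by (simp add: V_def frontier_complement frontier_cball)
      moreover have "\<kappa>1 * (R0\<^sup>2) powr a = 1" using R0 by (simp add: \<kappa>1_def flip: powr_add)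
      moreover have "u y \<le> 1" using y cV by (intro le1) (auto simp: frontier_def)
      ultimately show "u y \<le> \<kappa>1 * ?\<Gamma> y + 0 * ?\<Gamma> y" by (simp add: \<Gamma>)
    qed
    then show ?thesis by simp
  qed
  define K where "K = \<kappa>1 * (1 / 4) powr a / \<kappa>0"
  have K: "K \<ge> 0" using \<kappa>0 \<kappa>1 by (simp add: K_def)
  define g where "g = n / (n - 2)"
  define C where "C = n * (2 * n * K)\<^sup>2 * \<kappa>0 powr (1 - g)"
  have "grad_power u x \<le> C * u x" if x: "norm x \<ge> 4 * R0" for x
  proof -
    have x0: "norm x > 0" using x R0(1) by linarith
    define \<delta> where "\<delta> = norm x / 2"
    have \<delta>: "\<delta> > 0" using x0 by (simp add: \<delta>_def)
    have far: "norm y \<ge> norm x / 2" if "y \<in> cball x \<delta>" for y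
      using that norm_triangle_sub[of x y] by (simp add: dist_norm \<delta>_def)
    have cV: "y \<in> V" if "y \<in> cball x \<delta>" for y using far[OF that] x R0(1) by (simp add: V_def)
    then have cbE: "cball x \<delta> \<subseteq> E" using V(2) by blast
    have xV: "x \<in> V" using cV[of x] \<delta> by simp
    have x\<Omega>: "x \<notin> \<Omega>" using xV V(2) closure_subset by (auto simp: E_def)
    have upos: "u x > 0" by (rule pos[OF x\<Omega>])
    have M: "\<bar>u y\<bar> \<le> K * u x" if y: "y \<in> cball x \<delta>" for y
    proof -
      have y\<Omega>: "y \<notin> \<Omega>" using cV[OF y] V(2) closure_subset by (auto simp: E_def)
      have "u y \<le> \<kappa>1 * ((norm y)\<^sup>2) powr a" using upper[OF cV[OF y]] by (simp add: \<Gamma>)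
      also have "\<dots> \<le> \<kappa>1 * ((norm x / 2)\<^sup>2) powr a"
        using far[OF y] x0 \<kappa>1 a by (intro mult_left_mono powr_mono2' power_mono) auto
      also have "((norm x / 2)\<^sup>2) powr a = (1 / 4 * (norm x)\<^sup>2) powr a" by (simp add: power_divide)
      also have "\<dots> = (1 / 4) powr a * (norm x)\<^sup>2 powr a" by (rule powr_mult)
      also have "\<kappa>1 * ((1 / 4) powr a * (norm x)\<^sup>2 powr a) = K * (\<kappa>0 * ?\<Gamma> x)"
        using \<kappa>0 by (simp add: K_def \<Gamma>)
      also have "\<dots> \<le> K * u x" using lower[OF x\<Omega>] K by (intro mult_left_mono) auto
      finally show ?thesis using pos[OF y\<Omega>] by simp
    qed
    have grad: "(pd b u x)\<^sup>2 \<le> (2 * n * K)\<^sup>2 * ((u x)\<^sup>2 / (norm x)\<^sup>2)" if b: "b \<in> Basis" for b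
    proof -
      have "\<bar>pd b u x\<bar> \<le> n * (K * u x) / \<delta>"
        unfolding n_def by (rule gradient_estimate[OF u cbE \<delta> M b])
      also have "\<dots> = (2 * n * K) * (u x / norm x)" by (simp add: \<delta>_def)
      finally have "\<bar>pd b u x\<bar>\<^sup>2 \<le> ((2 * n * K) * (u x / norm x))\<^sup>2" by (rule power_mono) simp
      then show ?thesis by (simp add: power_mult_distrib power_divide)
    qed
    have "(\<Sum>b\<in>Basis. (pd b u x)\<^sup>2) \<le> (\<Sum>b\<in>(Basis::'a set). (2 * n * K)\<^sup>2 * ((u x)\<^sup>2 / (norm x)\<^sup>2))"
      by (rule sum_mono[OF grad])
    also have "\<dots> = n * (2 * n * K)\<^sup>2 * ((u x)\<^sup>2 / (norm x)\<^sup>2)" by (simp add: n_def)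
    finally have N: "(\<Sum>b\<in>Basis. (pd b u x)\<^sup>2) \<le> n * (2 * n * K)\<^sup>2 * ((u x)\<^sup>2 / (norm x)\<^sup>2)" .
    have "grad_power u x = (\<Sum>b\<in>Basis. (pd b u x)\<^sup>2) * u x powr (- g)" by (simp add: grad_power_def g_def n_def)
    also have "\<dots> \<le> n * (2 * n * K)\<^sup>2 * ((u x)\<^sup>2 / (norm x)\<^sup>2) * u x powr (- g)"
      using N by (intro mult_right_mono) auto
    also have "\<dots> = n * (2 * n * K)\<^sup>2 * (u x powr (1 - g) / (norm x)\<^sup>2) * u x"
    proof -
      have "u x powr (1 - g) = u x powr (- g) * u x" using upos powr_add[of "u x" "- g" 1] by simp
      then show ?thesis by (simp add: power2_eq_square)
    qed
    also have "\<dots> \<le> n * (2 * n * K)\<^sup>2 * \<kappa>0 powr (1 - g) * u x"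
    proof (intro mult_right_mono mult_left_mono)
      \<comment> \<open>The exponent \<open>1 - g = - 2 / (n - 2)\<close> is negative and reciprocal to \<open>a\<close>, so the lower bound gives
        \<open>u powr (1 - g) \<le> const * |x|\<^sup>2\<close>.\<close>
      have g1: "1 - g \<le> 0" using n by (simp add: g_def field_simps)
      have "u x powr (1 - g) \<le> (\<kappa>0 * ?\<Gamma> x) powr (1 - g)"
        using lower[OF x\<Omega>] g1 \<kappa>0 x0 by (intro powr_mono2') (auto simp: \<Gamma>)
      also have "\<dots> = \<kappa>0 powr (1 - g) * (norm x)\<^sup>2"
      proof -
        have "a * (1 - g) = 1" using n by (simp add: a_def g_def field_simps)
        then have "((norm x)\<^sup>2 powr a) powr (1 - g) = (norm x)\<^sup>2" using x0 by (simp add: powr_powr)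
        then show ?thesis using \<kappa>0 by (simp add: \<Gamma> powr_mult)
      qed
      finally show "u x powr (1 - g) / (norm x)\<^sup>2 \<le> \<kappa>0 powr (1 - g)" using x0 by (simp add: pos_divide_le_eq)
    qed (use upos n in auto)
    finally show ?thesis by (simp add: C_def)
  qed
  moreover have "x \<notin> closure \<Omega>" if "norm x \<ge> 4 * R0" for x using that R0 by force
  moreover have "C \<ge> 0" using n by (simp add: C_def)
  ultimately show "\<exists>C R. C \<ge> 0 \<and> (\<forall>x. norm x \<ge> R \<longrightarrow> x \<notin> closure \<Omega> \<and> grad_power u x \<le> C * u x)" by blast
qed

section \<open>From the potential to the ball\<close>

lemma zero_on_relative_closure:
  fixes f :: "'a::topological_space \<Rightarrow> 'b::t1_space"
  assumes "continuous_on T f" "E \<subseteq> T" "T \<subseteq> closure E" "\<And>x. x \<in> E \<Longrightarrow> f x = k" "x \<in> T"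
  shows "f x = k"
proof -
  have "closedin (top_of_set T) {x \<in> T. f x = k}"
    by (rule continuous_closedin_preimage_constant[OF assms(1)])
  then obtain C where C: "closed C" "{x \<in> T. f x = k} = T \<inter> C" unfolding closedin_closed by blast
  then have "E \<subseteq> C" using assms(2,4) by blast
  then have "closure E \<subseteq> C" using C(1) by (rule closure_minimal)
  then show ?thesis using assms(3,5) C(2) by blast
qed

text \<open>The formula would exceed 1 near \<open>p\<close>, so \<open>p\<close> lies in \<open>\<Omega>\<close> and the formula holds on all of \<open>- \<Omega>\<close>. Let \<open>r\<close> be the
  radius at which it takes the value 1. Inside it is greater than 1, so the ball is part of \<open>\<Omega>\<close>. Outside it is
  less than 1, so \<open>\<Omega>\<close> has no boundary points there; that region is connected and unbounded,
  so \<open>\<Omega>\<close> does not meet it.\<close>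

lemma domain_is_ball:
  fixes u :: "'a::euclidean_space \<Rightarrow> real"
  assumes dim: "DIM('a) \<ge> 3" and \<Omega>: "open \<Omega>" "bounded \<Omega>"
    and cl: "- \<Omega> \<subseteq> closure (- closure \<Omega>)"
    and cont: "continuous_on (- \<Omega>) u" and le: "\<And>x. x \<in> - \<Omega> \<Longrightarrow> u x \<le> 1"
    and bd: "\<And>x. x \<in> frontier \<Omega> \<Longrightarrow> u x = 1" and \<kappa>: "\<kappa> > 0"
    and eq: "\<And>x. x \<in> - closure \<Omega> \<Longrightarrow> x \<noteq> p \<Longrightarrow> u x = \<kappa> * fundamental_solution p x"
  shows "\<exists>r>0. \<Omega> = ball p r \<and> (\<forall>x\<in>- \<Omega>. \<forall>y\<in>- \<Omega>. dist p x = dist p y \<longrightarrow> u x = u y)"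
proof -
  define a where "a = 1 - real DIM('a) / 2"
  have a: "a < 0" using dim by (simp add: a_def)
  have \<Gamma>: "fundamental_solution p x = ((dist p x)\<^sup>2) powr a" for x
    by (simp add: fundamental_solution_def a_def dist_norm norm_minus_commute[of p] dot_square_norm)
  define r where "r = sqrt ((1 / \<kappa>) powr (1 / a))"
  have r: "r > 0" using \<kappa> by (simp add: r_def)
  have r2: "(r\<^sup>2) powr a = 1 / \<kappa>" using \<kappa> a by (simp add: r_def powr_powr)
  have large: "\<kappa> * fundamental_solution p x > 1" if "x \<noteq> p" "dist p x < r" for x
  proof -
    have "(dist p x)\<^sup>2 < r\<^sup>2" using that by (intro power_strict_mono) auto
    then have "1 / \<kappa> < ((dist p x)\<^sup>2) powr a" unfolding r2[symmetric] using that a by (intro powr_less_mono2_neg) auto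
    then show ?thesis using \<kappa> by (simp add: \<Gamma> field_simps)
  qed
  have small: "\<kappa> * fundamental_solution p x < 1" if "dist p x > r" for x
  proof -
    have "r\<^sup>2 < (dist p x)\<^sup>2" using that r by (intro power_strict_mono) auto
    then have "((dist p x)\<^sup>2) powr a < 1 / \<kappa>" unfolding r2[symmetric] using r a by (intro powr_less_mono2_neg) auto
    then show ?thesis using \<kappa> by (simp add: \<Gamma> field_simps)
  qed
  define E where "E = - closure \<Omega>"
  have E: "open E" "E \<subseteq> - \<Omega>" using closure_subset by (auto simp: E_def open_Compl)
  have p: "p \<in> \<Omega>"
  proof (rule ccontr)
    assume "p \<notin> \<Omega>"
    then have "p \<in> closure E" using cl by (auto simp: E_def)
    then have "p islimpt E" using E(1) interior_limit_point[of p E] by (auto simp: closure_def interior_open)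
    then obtain x where x: "x \<in> E" "x \<noteq> p" "dist x p < r" using r unfolding islimpt_approachable by blast
    then have "u x > 1" using large[of x] eq[of x] by (simp add: E_def dist_commute)
    then show False using le[of x] x(1) E(2) by force
  qed
  have eqS: "u x = \<kappa> * fundamental_solution p x" if x: "x \<in> - \<Omega>" for x
  proof -
    have "continuous_on (- \<Omega>) (fundamental_solution p)"
      by (rule continuous_on_subset[OF harmonic_on_continuous[OF harmonic_on_fundamental_solution]]) (use p in auto)
    then have "continuous_on (- \<Omega>) (\<lambda>x. u x - \<kappa> * fundamental_solution p x)" by (intro continuous_intros cont)
    then have "u x - \<kappa> * fundamental_solution p x = 0"
      by (rule zero_on_relative_closure[OF _ E(2) cl[folded E_def] _ x]) (use eq p closure_subset in \<open>auto simp: E_def\<close>)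
    then show ?thesis by simp
  qed
  have "ball p r \<subseteq> \<Omega>"
  proof
    fix x assume x: "x \<in> ball p r"
    show "x \<in> \<Omega>"
    proof (rule ccontr)
      assume n: "x \<notin> \<Omega>"
      then have "x \<noteq> p" using p by auto
      then have "u x > 1" using large[of x] eqS[of x] x n by simp
      then show False using le[of x] n by simp
    qed
  qed
  moreover have "\<Omega> \<subseteq> ball p r"
  proof -
    have "\<Omega> \<subseteq> cball p r"
    proof (rule ccontr)
      assume "\<not> \<Omega> \<subseteq> cball p r"
      then have 1: "- cball p r \<inter> \<Omega> \<noteq> {}" by auto
      have 2: "- cball p r - \<Omega> \<noteq> {}"
      proof
        assume "- cball p r - \<Omega> = {}"
        then have "UNIV \<subseteq> cball p r \<union> \<Omega>" by auto
        then have "bounded (UNIV :: 'a set)" using \<Omega>(2) bounded_subset[of "cball p r \<union> \<Omega>" UNIV] by simp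
        then show False by simp
      qed
      have "connected (- cball p r)"
        by (rule connected_complement_bounded_convex) (use dim in auto)
      from connected_Int_frontier[OF this 1 2] obtain y where y: "y \<in> frontier \<Omega>" "dist p y > r" by (auto simp: not_le)
      have "y \<in> - \<Omega>" using y(1) \<Omega>(1) by (auto simp: frontier_def interior_open)
      then show False using bd[OF y(1)] small[OF y(2)] eqS[of y] by simp
    qed
    then have "\<Omega> \<subseteq> interior (cball p r)" using \<Omega>(1) by (rule interior_maximal)
    then show ?thesis by simp
  qed
  ultimately have "\<Omega> = ball p r" by blast
  moreover have "u x = u y" if "x \<in> - \<Omega>" "y \<in> - \<Omega>" "dist p x = dist p y" for x y
    using eqS[OF that(1)] eqS[OF that(2)] that(3) by (simp add: \<Gamma>)
  ultimately show ?thesis using r by blast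
qed

text \<open>Used to identify the gradient at a boundary point from one-sided information.\<close>

lemma nonpositive_on_half_space:
  fixes g m :: "'a::real_inner"
  assumes m: "m \<noteq> 0" and le: "\<And>v. m \<bullet> v > 0 \<Longrightarrow> g \<bullet> v \<le> 0"
  shows "\<exists>k\<ge>0. g = - (k *\<^sub>R m)"
proof -
  define k where "k = - ((g \<bullet> m) / (m \<bullet> m))"
  define q where "q = g + k *\<^sub>R m"
  have mm: "m \<bullet> m > 0" using m by simp
  have qm: "m \<bullet> q = 0" using m by (simp add: q_def k_def inner_add_right inner_diff_right inner_commute)
  have gm: "g \<bullet> m \<le> 0" using le[of m] mm by simp
  have "q = 0"
  proof (rule ccontr)
    assume "q \<noteq> 0"
    then have qq: "q \<bullet> q > 0" by simp
    define D where "D = \<bar>g \<bullet> m\<bar> + 1"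
    have D: "D > 0" by (simp add: D_def add_nonneg_pos)
    define \<delta> where "\<delta> = (q \<bullet> q) / (2 * D)"
    have \<delta>: "\<delta> > 0" using qq D by (simp add: \<delta>_def)
    have "(g + k *\<^sub>R m) \<bullet> q = g \<bullet> q + k * (m \<bullet> q)" by (simp add: inner_add_left)
    then have "g \<bullet> q = q \<bullet> q" using qm unfolding q_def[symmetric] by simp
    moreover have "g \<bullet> (q + \<delta> *\<^sub>R m) \<le> 0" by (rule le) (use qm \<delta> mm in \<open>simp add: inner_add_right\<close>)
    ultimately have "q \<bullet> q \<le> \<delta> * \<bar>g \<bullet> m\<bar>" using gm by (simp add: inner_add_right)
    also have "\<dots> \<le> \<delta> * D" using \<delta> by (simp add: D_def)
    also have "\<dots> = (q \<bullet> q) / 2" using D by (simp add: \<delta>_def)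
    finally show False using qq by simp
  qed
  then have "g = - (k *\<^sub>R m)" by (simp add: q_def eq_neg_iff_add_eq_0)
  moreover have "k \<ge> 0" using gm mm by (simp add: k_def divide_nonpos_pos)
  ultimately show ?thesis by blast
qed

section \<open>The overdetermined problem\<close>

text \<open>The set \<open>S\<close> carries the relative derivatives. The set \<open>T\<close> is where \<open>u\<close> is known to have continuous second
  derivatives relative to \<open>S\<close>: up to the boundary if the level set is the boundary, and in the open exterior \<open>E\<close>
  otherwise. It contains the level set \<open>L\<close> in both cases, so the cases \<open>c = 1\<close> and \<open>c < 1\<close> can be
  treated together. The set \<open>G\<close> is the region in which the comparison argument takes place.\<close>

locale overdetermined_potential =
  fixes \<Omega> :: "'a::euclidean_space set" and u :: "'a \<Rightarrow> real" and c d :: real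
  assumes dim: "DIM('a) \<ge> 3"
    and domain: "open \<Omega>" "bounded \<Omega>" "0 \<in> \<Omega>" "smooth_boundary \<Omega>"
    and exterior: "c < 1 \<longrightarrow> connected (- closure \<Omega>)"
    and continuous: "continuous_on (- \<Omega>) u"
    and harmonic: "harmonic_on (- closure \<Omega>) u"
    and C2_boundary: "c = 1 \<longrightarrow> higher_differentiable_on (- \<Omega>) u 2"
    and boundary: "\<And>x. x \<in> frontier \<Omega> \<Longrightarrow> u x = 1"
    and infinity: "(u \<longlongrightarrow> 0) at_infinity"
    and constants: "0 < c" "c \<le> 1" "0 < d"
    and gradient: "\<And>x. x \<in> level_set \<Omega> u c \<Longrightarrow> norm (grad_within (- \<Omega>) u x) = d"
begin

definition E where "E = - closure \<Omega>"
definition S where "S = - \<Omega>"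
definition T where "T = (if c < 1 then E else S)"
definition G where "G = {x \<in> E. u x < c}"
definition L where "L = level_set \<Omega> u c"
definition g where "g = grad_within S u"
definition A where "A = hess_within S u"

abbreviation fd where "fd b \<equiv> \<lambda>y. frechet_derivative u (at y within S) b"

lemma open_E: "open E" by (simp add: E_def open_Compl)
lemma E_sub_S: "E \<subseteq> S" using closure_subset by (auto simp: E_def S_def)
lemma closed_S: "closed S" using domain(1) by (simp add: S_def closed_Compl)
lemma E_sub_T: "E \<subseteq> T" using E_sub_S by (simp add: T_def)
lemma T_sub_S: "T \<subseteq> S" using E_sub_S by (simp add: T_def)
lemma S_cases: "x \<in> S \<Longrightarrow> x \<in> E \<or> x \<in> frontier \<Omega>"
  using domain(1) by (auto simp: S_def E_def frontier_def interior_open)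
lemma frontier_sub_S: "x \<in> frontier \<Omega> \<Longrightarrow> x \<in> S"
  using domain(1) by (auto simp: S_def frontier_def interior_open)
lemma harm: "harmonic_on E u" using harmonic by (simp add: E_def)
lemma cont_S: "continuous_on S u" using continuous by (simp add: S_def)
lemma level_iff: "x \<in> L \<longleftrightarrow> x \<in> S \<and> u x = c" by (auto simp: L_def level_set_def S_def)
lemma closure_E: "closure E \<subseteq> S" by (rule closure_minimal[OF E_sub_S closed_S])

lemmas bounds = exterior_potential_bounds[OF dim domain(1-3) continuous harmonic boundary infinity]

lemma u_le: "x \<in> S \<Longrightarrow> u x \<le> 1" using bounds(1) by (simp add: S_def)
lemma u_pos: "x \<in> S \<Longrightarrow> u x > 0" using bounds(2) by (simp add: S_def)

text \<open>This is the only place where smoothness of the boundary enters. It serves for uniqueness of the relative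
  derivatives, for density of \<open>E\<close> in \<open>S\<close>, and as the ball in the Hopf lemma if \<open>c = 1\<close>.\<close>

lemma touching_ball:
  assumes "x \<in> S"
  shows "\<exists>z r. r > 0 \<and> dist z x = r \<and> cball z r - {x} \<subseteq> E"
proof (cases "x \<in> E")
  case True
  then obtain \<delta> where \<delta>: "\<delta> > 0" "cball x \<delta> \<subseteq> E" using open_E open_contains_cball by blast
  obtain e :: 'a where e: "e \<in> Basis" using nonempty_Basis by blast
  define z where "z = x + (\<delta> / 2) *\<^sub>R e"
  have dz: "dist z x = \<delta> / 2" using e \<delta> by (simp add: z_def dist_norm)
  then have "cball z (\<delta> / 2) \<subseteq> cball x \<delta>" by (simp add: cball_subset_cball_iff)
  then show ?thesis using \<delta> dz by (intro exI[of _ z] exI[of _ "\<delta> / 2"]) auto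
next
  case False
  then show ?thesis
    using smooth_boundary_exterior_ball[OF domain(4,1)] S_cases[OF assms] by (auto simp: E_def)
qed

lemma S_sub_closure: "S \<subseteq> closure E"
proof
  fix x assume "x \<in> S"
  then obtain z r where zr: "r > 0" "dist z x = r" "cball z r - {x} \<subseteq> E" using touching_ball by blast
  then have "ball z r \<subseteq> E" by force
  then have "closure (ball z r) \<subseteq> closure E" by (rule closure_mono)
  then show "x \<in> closure E" using zr by auto
qed

lemma derivative_unique:
  fixes f :: "'a \<Rightarrow> 'b::real_normed_vector"
  assumes "x \<in> S" "(f has_derivative f1) (at x within S)" "(f has_derivative f2) (at x within S)"
  shows "f1 = f2"
proof -
  obtain z r where zr: "r > 0" "dist z x = r" "cball z r - {x} \<subseteq> E" using touching_ball[OF assms(1)] by blast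
  then have "ball z r \<subseteq> S" using E_sub_S by force
  then show ?thesis using has_derivative_within_unique[OF zr(1) _ zr(2) assms] by blast
qed

lemma at_E: "x \<in> E \<Longrightarrow> at x within S = at x"
  using at_within_open_subset[OF _ open_E E_sub_S] .

lemma first_E: "x \<in> E \<Longrightarrow> frechet_derivative u (at x within S) v = pd v u x"
  by (simp add: at_E pd_def)

lemma second_E: "x \<in> E \<Longrightarrow> frechet_derivative (fd b) (at x within S) v = pd v (pd b u) x"
proof -
  assume x: "x \<in> E"
  have "pd v (fd b) x = pd v (pd b u) x"
    by (rule pd_cong[OF open_E x first_E])
  then show ?thesis unfolding at_E[OF x] by (simp only: pd_def[of v "fd b"])
qed

lemma twice_differentiable_T:
  assumes x: "x \<in> T"
  shows "u differentiable (at x within S)"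
    "(fd b) differentiable (at x within S)"
proof -
  have "u differentiable (at x within S) \<and> (fd b) differentiable (at x within S)"
  proof (cases "c < 1")
    case True
    then have xE: "x \<in> E" using x by (simp add: T_def)
    have "(pd b u has_derivative (\<lambda>v. pd v (pd b u) x)) (at x)"
      by (rule harmonic_onD(1)[OF harmonic_on_pd[OF harm] xE])
    then have "((fd b) has_derivative (\<lambda>v. pd v (pd b u) x)) (at x)"
      by (rule has_derivative_transform_within_open[OF _ open_E xE]) (simp add: first_E)
    then show ?thesis
      using harmonic_onD(1)[OF harm xE] unfolding at_E[OF xE] differentiable_def by blast
  next
    case False
    then have "T = S" by (simp add: T_def)
    moreover have "c = 1" using False constants by simp
    moreover then have "higher_differentiable_on S u 2" using C2_boundary by (simp add: S_def)
    ultimately show ?thesis using higher_differentiable_on_2D(1,2) x by blast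
  qed
  then show "u differentiable (at x within S)"
    "(fd b) differentiable (at x within S)" by blast+
qed

lemma continuous_second:
  "continuous_on T (\<lambda>x. frechet_derivative (fd b) (at x within S) v)"
proof (cases "c < 1")
  case True
  have "continuous_on E (pd v (pd b u))"
    by (rule harmonic_on_continuous[OF harmonic_on_pd[OF harmonic_on_pd[OF harm]]])
  then show ?thesis using True by (simp add: T_def second_E cong: continuous_on_cong_simp)
next
  case False
  then have "T = S" by (simp add: T_def)
  have "c = 1" using False constants by simp
  then have "higher_differentiable_on S u 2" using C2_boundary by (simp add: S_def)
  then show ?thesis unfolding \<open>T = S\<close> by (rule continuous_on_second_derivative)
qed

lemma has_derivative_u: "x \<in> T \<Longrightarrow> (u has_derivative (\<lambda>v. g x \<bullet> v)) (at x within S)"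
  unfolding g_def by (rule has_derivative_grad_within[OF twice_differentiable_T(1)])

lemma has_derivative_g: "x \<in> T \<Longrightarrow> (g has_derivative A x) (at x within S)"
  unfolding g_def A_def by (rule grad_within_has_derivative[OF twice_differentiable_T(2)])

lemma continuous_A: "continuous_on T (\<lambda>x. A x v)"
  unfolding A_def hess_within_def by (intro continuous_intros continuous_second)

lemma continuous_g: "continuous_on T g"
  using has_derivative_g T_sub_S by (meson continuous_on_eq_continuous_within has_derivative_continuous has_derivative_subset)

text \<open>The equation extends to boundary points by continuity of the second derivatives.\<close>

lemma trace_A:
  assumes "x \<in> T" shows "(\<Sum>b\<in>Basis. A x b \<bullet> b) = 0"
proof (rule zero_on_relative_closure[OF _ E_sub_T _ _ assms])
  show "continuous_on T (\<lambda>x. \<Sum>b\<in>Basis. A x b \<bullet> b)" by (intro continuous_intros continuous_A)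
  show "T \<subseteq> closure E" using T_sub_S S_sub_closure by blast
  show "(\<Sum>b\<in>Basis. A x b \<bullet> b) = 0" if "x \<in> E" for x
    using harmonic_onD(3)[OF harm that] second_E[OF that]
    by (simp add: A_def hess_within_def)
qed

lemma g_E: "x \<in> E \<Longrightarrow> (\<Sum>b\<in>Basis. (pd b u x)\<^sup>2) = g x \<bullet> g x"
  by (subst euclidean_inner) (simp add: g_def grad_within_def first_E power2_eq_square)

lemma L_sub_T: "L \<subseteq> T"
proof
  fix x assume "x \<in> L"
  then have x: "x \<in> S" "u x = c" by (auto simp: level_iff)
  then show "x \<in> T" using S_cases[OF x(1)] boundary[of x] by (auto simp: T_def)
qed

lemma g_L: "x \<in> L \<Longrightarrow> norm (g x) = d"
  using gradient by (simp add: L_def g_def S_def)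

lemma compact_L: "compact L"
proof -
  have "L = {x \<in> S. u x = c}" using level_iff by blast
  then have "closed L" using continuous_closed_preimage_constant[OF cont_S closed_S] by simp
  moreover obtain R where R: "\<And>x. norm x \<ge> R \<Longrightarrow> u x \<le> c / 2"
    using eventually_at_infinity_leD[OF infinity, of "c / 2"] constants by auto
  then have "norm x \<le> R" if "x \<in> L" for x
    using that constants R[of x] by (force simp: level_iff)
  then have "bounded L" by (auto simp: bounded_iff)
  ultimately show ?thesis by (simp add: compact_eq_bounded_closed)
qed

text \<open>For \<open>c < 1\<close> this is the intermediate value theorem on the connected set \<open>E\<close>, where \<open>u\<close> takes values
  close to 1 and close to 0.\<close>

lemma L_nonempty: "L \<noteq> {}"
proof -
  have "frontier \<Omega> \<noteq> {}" using domain(2,3) by (auto simp: frontier_eq_empty)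
  then obtain y where y: "y \<in> frontier \<Omega>" by blast
  show ?thesis
  proof (cases "c < 1")
    case False
    then have "u y = c" using boundary[OF y] constants by simp
    then have "y \<in> L" using frontier_sub_S[OF y] level_iff by blast
    then show ?thesis by blast
  next
    case True
    have yS: "y \<in> S" by (rule frontier_sub_S[OF y])
    have "\<exists>x\<in>E. u x > c"
    proof (rule ccontr)
      assume "\<not> (\<exists>x\<in>E. u x > c)"
      then have "E \<subseteq> {x \<in> S. u x \<le> c}" using E_sub_S by force
      moreover have "closed {x \<in> S. u x \<le> c}"
        using continuous_closed_preimage[OF cont_S closed_S, of "{..c}"] by (simp add: vimage_def Int_def)
      ultimately have "closure E \<subseteq> {x \<in> S. u x \<le> c}" by (rule closure_minimal)
      then show False using yS S_sub_closure boundary[OF y] True by auto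
    qed
    then obtain x1 where x1: "x1 \<in> E" "u x1 > c" by blast
    obtain R where R: "\<And>x. norm x \<ge> R \<Longrightarrow> u x \<le> c / 2"
      using eventually_at_infinity_leD[OF infinity, of "c / 2"] constants by auto
    obtain R' where R': "\<And>x. norm x \<ge> R' \<Longrightarrow> x \<notin> closure \<Omega>" using bounds(3) by blast
    obtain x2 :: 'a where "norm x2 = \<bar>R\<bar> + \<bar>R'\<bar>" by (metis abs_ge_zero add_nonneg_nonneg vector_choose_size)
    then have x2: "x2 \<in> E" "u x2 \<le> c / 2" using R[of x2] R'[of x2] by (auto simp: E_def)
    have "connected (u ` E)"
      using exterior True harmonic_on_continuous[OF harm] by (intro connected_continuous_image) (auto simp: E_def)
    then have "c \<in> u ` E"
      by (rule connectedD_interval[of _ "u x2" "u x1"]) (use x1 x2 constants in auto)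
    then show ?thesis using E_sub_S level_iff by blast
  qed
qed

lemma unit_normal_L: "x \<in> L \<Longrightarrow> unit_normal S u x = - (g x /\<^sub>R d)"
  using g_L by (simp add: unit_normal_def g_def)

lemma mean_curvature_L:
  assumes x: "x \<in> L"
  shows "mean_curvature S u x = A x (- (g x /\<^sub>R d)) \<bullet> (- (g x /\<^sub>R d)) / d"
proof -
  have xT: "x \<in> T" using x L_sub_T by blast
  have "x \<in> S" using xT T_sub_S by blast
  then have "mean_curvature S u x =
    (A x (unit_normal S u x) \<bullet> unit_normal S u x - (\<Sum>b\<in>Basis. A x b \<bullet> b)) / norm (grad_within S u x)"
    using g_L[OF x] constants(3) has_derivative_g[OF xT] by (intro mean_curvature_eq_hess_within) (auto simp: g_def dest: derivative_unique)
  then show ?thesis using trace_A[OF xT] unit_normal_L[OF x] g_L[OF x] by (simp add: g_def)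
qed

lemma continuous_mean_curvature: "continuous_on L (mean_curvature S u)"
proof -
  define \<nu> where "\<nu> = (\<lambda>x. - (g x /\<^sub>R d))"
  have c\<nu>: "continuous_on L \<nu>" unfolding \<nu>_def using continuous_on_subset[OF continuous_g L_sub_T] by (intro continuous_intros)
  have "continuous_on L (\<lambda>x. (\<Sum>b\<in>Basis. (\<nu> x \<bullet> b) *\<^sub>R A x b) \<bullet> \<nu> x / d)"
    using constants by (intro continuous_intros c\<nu> continuous_on_subset[OF continuous_A L_sub_T]) auto
  moreover have "mean_curvature S u x = (\<Sum>b\<in>Basis. (\<nu> x \<bullet> b) *\<^sub>R A x b) \<bullet> \<nu> x / d" if "x \<in> L" for x
  proof -
    have lin: "linear (A x)" using has_derivative_g L_sub_T that has_derivative_linear by blast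
    have "A x (\<nu> x) = A x (\<Sum>b\<in>Basis. (\<nu> x \<bullet> b) *\<^sub>R b)" by (simp add: euclidean_representation)
    also have "\<dots> = (\<Sum>b\<in>Basis. (\<nu> x \<bullet> b) *\<^sub>R A x b)" by (subst linear_sum[OF lin]) (simp add: linear_cmul[OF lin])
    finally show ?thesis using mean_curvature_L[OF that] by (simp add: \<nu>_def)
  qed
  ultimately show ?thesis by (simp cong: continuous_on_cong_simp)
qed

text \<open>A point of \<open>E\<close> with \<open>u = 1\<close> would be an interior maximum that belongs to the level set, against \<open>|Du| = d > 0\<close>.\<close>

lemma u_less_on_E: "c = 1 \<Longrightarrow> x \<in> E \<Longrightarrow> u x < 1"
proof (rule ccontr)
  assume c: "c = 1" and x: "x \<in> E" and "\<not> u x < 1"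
  then have ux: "u x = 1" using u_le E_sub_S by force
  then have "u x = c" using c by simp
  then have xL: "x \<in> L" using x E_sub_S level_iff by blast
  have "(u has_derivative (\<lambda>v. g x \<bullet> v)) (at x)" using has_derivative_u[of x] x E_sub_T at_E by auto
  then have "(\<lambda>v. g x \<bullet> v) = (\<lambda>v. 0)"
    by (rule differential_zero_maxmin[OF x open_E]) (use u_le E_sub_S ux in auto)
  then have "g x \<bullet> g x = 0" by (rule fun_cong)
  then show False using g_L[OF xL] constants by simp
qed

text \<open>For \<open>c = 1\<close> a bounded component would have boundary values 1, hence \<open>u \<ge> 1\<close> on it by the maximum
  principle; this excludes holes.\<close>

lemma connected_E: "connected E"
proof (cases "c < 1")
  case True then show ?thesis using exterior by (simp add: E_def)
next
  case False
  then have c: "c = 1" using constants by simp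
  show ?thesis
  proof (rule ccontr)
    assume "\<not> connected E"
    moreover have "bounded (- E)" using bounded_closure[OF domain(2)] by (simp add: E_def)
    ultimately obtain C where C: "C \<in> components E" "bounded C"
      using cobounded_has_bounded_component[of E] dim by auto
    have oC: "open C" and CE: "C \<subseteq> E" using C open_components[OF open_E] in_components_subset by blast+
    have fC: "frontier C \<subseteq> frontier E" by (rule frontier_of_components_subset[OF C(1)])
    have cC: "closure C \<subseteq> S" using closure_mono[OF CE] closure_E by blast
    obtain x where x: "x \<in> C" using in_components_nonempty[OF C(1)] by blast
    have h: "harmonic_on C (\<lambda>x. (-1) * u x + 0 * u x)"
      by (intro harmonic_on_lincomb harmonic_on_subset[OF harm oC CE])
    have "(-1) * u x + 0 * u x \<le> -1"
    proof (rule weak_max_bounded[OF oC C(2) _ second_partials_harmonic[OF h] _ _ x])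
      show "continuous_on (closure C) (\<lambda>x. (-1) * u x + 0 * u x)"
        by (intro continuous_intros continuous_on_subset[OF cont_S cC])
      show "(-1) * u y + 0 * u y \<le> -1" if "y \<in> frontier C" for y
      proof -
        have "y \<in> frontier E" using that fC by blast
        then have "y \<in> S" "y \<notin> E" using closure_E open_E by (auto simp: frontier_def interior_open)
        then show ?thesis using boundary S_cases by force
      qed
    qed (use harmonic_onD(3)[OF h] in auto)
    then show False using u_less_on_E[OF c, of x] x CE by auto
  qed
qed

lemma open_G: "open G"
proof -
  have "open (E \<inter> u -` {..<c})"
    by (rule continuous_open_preimage[OF harmonic_on_continuous[OF harm] open_E]) auto
  moreover have "G = E \<inter> u -` {..<c}" by (auto simp: G_def)
  ultimately show ?thesis by simp
qed

lemma G_sub_E: "G \<subseteq> E" by (auto simp: G_def)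

lemma closure_G: "closure G \<subseteq> {x \<in> T. u x \<le> c}"
proof -
  have "closed {x \<in> S. u x \<le> c}"
    using continuous_closed_preimage[OF cont_S closed_S, of "{..c}"] by (simp add: vimage_def Int_def)
  then have "closure G \<subseteq> {x \<in> S. u x \<le> c}" by (rule closure_minimal[rotated]) (use E_sub_S in \<open>auto simp: G_def\<close>)
  moreover have "x \<in> T" if "x \<in> S" "u x \<le> c" for x
    using S_cases[OF that(1)] boundary[of x] that by (auto simp: T_def)
  ultimately show ?thesis by blast
qed

lemma frontier_G: "frontier G \<subseteq> L"
proof
  fix x assume "x \<in> frontier G"
  then have x: "x \<in> T" "u x \<le> c" "x \<notin> G" using closure_G open_G by (auto simp: frontier_def interior_open)
  then have "x \<in> S" using T_sub_S by blast
  then show "x \<in> L" using x S_cases[of x] boundary[of x] constants by (auto simp: level_iff G_def)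
qed

text \<open>The constant \<open>P\<close> is the value of \<open>grad_power u / u\<close> on the level set. The function \<open>w\<close> is written with \<open>g\<close> instead of
  \<open>grad_power\<close> because on boundary points of \<open>\<Omega>\<close> only derivatives relative to \<open>S\<close> make sense.\<close>

definition \<gamma> where "\<gamma> = real DIM('a) / (real DIM('a) - 2)"
definition P where "P = d\<^sup>2 * c powr (- \<gamma>) / c"
definition w where "w x = (g x \<bullet> g x) * u x powr (- \<gamma>) - P * u x"

lemma P_pos: "P > 0" using constants by (simp add: P_def)

lemma w_E: "x \<in> E \<Longrightarrow> w x = grad_power u x + (- P) * u x"
  by (simp add: w_def grad_power_def g_E \<gamma>_def)

lemma w_L: "x \<in> L \<Longrightarrow> w x = 0"
  using g_L[of x] constants by (simp add: w_def P_def level_iff dot_square_norm)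

lemma continuous_w: "continuous_on T w"
proof -
  have "continuous_on T u" by (rule continuous_on_subset[OF cont_S T_sub_S])
  moreover have "u x > 0" if "x \<in> T" for x using u_pos T_sub_S that by blast
  ultimately show ?thesis
    unfolding w_def[abs_def] by (intro continuous_intros continuous_g) (auto simp: less_imp_neq[symmetric])
qed

lemma w_subharmonic:
  obtains w1 w2 where "second_partials E w w1 w2" "\<And>x. x \<in> E \<Longrightarrow> (\<Sum>b\<in>Basis. w2 x b) \<ge> 0"
proof -
  have pos: "\<And>x. x \<in> E \<Longrightarrow> u x > 0" using u_pos E_sub_S by blast
  obtain Q1 Q2 where Q: "second_partials E (grad_power u) Q1 Q2" and lap: "\<And>x. x \<in> E \<Longrightarrow> (\<Sum>b\<in>Basis. Q2 x b) =
        2 * u x powr (- (real DIM('a) / (real DIM('a) - 2))) * (\<Sum>b\<in>Basis. \<Sum>e\<in>Basis. (pd b (pd e u) x - model_hessian u x e b)\<^sup>2)"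
    using grad_power_subharmonic[OF dim harm pos] by blast
  have "second_partials E w (\<lambda>x b. Q1 x b + (- P) * pd b u x) (\<lambda>x b. Q2 x b + (- P) * pd b (pd b u) x)"
    by (rule second_partials_cong[OF open_E second_partials_lincomb[OF Q second_partials_harmonic[OF harm]] w_E])
  moreover have "(\<Sum>b\<in>Basis. Q2 x b + (- P) * pd b (pd b u) x) \<ge> 0" if "x \<in> E" for x
  proof -
    have "(\<Sum>b\<in>Basis. Q2 x b + (- P) * pd b (pd b u) x) = (\<Sum>b\<in>Basis. Q2 x b) + (- P) * (\<Sum>b\<in>Basis. pd b (pd b u) x)"
      by (simp only: sum.distrib sum_distrib_left)
    then show ?thesis using lap[OF that] harmonic_onD(3)[OF harm that] by (simp add: sum_nonneg)
  qed
  ultimately show ?thesis by (rule that)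
qed

lemma w_nonpos: "x \<in> G \<Longrightarrow> w x \<le> 0"
proof -
  assume x: "x \<in> G"
  obtain w1 w2 where w12: "second_partials E w w1 w2" "\<And>x. x \<in> E \<Longrightarrow> (\<Sum>b\<in>Basis. w2 x b) \<ge> 0"
    using w_subharmonic by blast
  show "w x \<le> 0"
  proof (rule weak_max_unbounded[OF open_G _ _ _ _ _ x])
    show "continuous_on (closure G) w" using continuous_on_subset[OF continuous_w] closure_G by blast
    show "second_partials G w w1 w2" using w12(1) G_sub_E by (auto simp: second_partials_def)
    show "\<And>x. x \<in> G \<Longrightarrow> (\<Sum>b\<in>Basis. w2 x b) \<ge> 0" using w12(2) G_sub_E by blast
    show "\<And>x. x \<in> frontier G \<Longrightarrow> w x \<le> 0" using w_L frontier_G by force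
    fix e :: real assume e: "e > 0"
    obtain C R where CR: "C \<ge> 0" "\<And>x. norm x \<ge> R \<Longrightarrow> x \<notin> closure \<Omega> \<and> grad_power u x \<le> C * u x"
      using bounds(3) by blast
    have "((\<lambda>x. C * u x) \<longlongrightarrow> C * 0) at_infinity" by (intro tendsto_intros infinity)
    then obtain R' where R': "\<And>x. norm x \<ge> R' \<Longrightarrow> C * u x \<le> e"
      using eventually_at_infinity_leD[of "\<lambda>x. C * u x" "C * 0" e] e by auto
    have "w x \<le> e" if "norm x \<ge> max R R'" for x
    proof -
      have xE: "x \<in> E" using CR(2)[of x] that by (simp add: E_def)
      have "P * u x > 0" using P_pos u_pos xE E_sub_S by (intro mult_pos_pos) auto
      then show ?thesis using w_E[OF xE] CR(2)[of x] R'[of x] that by simp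
    qed
    then show "\<exists>R. \<forall>x\<in>closure G. norm x \<ge> R \<longrightarrow> w x \<le> e" by blast
  qed
qed

lemma touching_ball_G:
  assumes y: "y \<in> L"
  shows "\<exists>z r. r > 0 \<and> dist z y = r \<and> cball z r - {y} \<subseteq> G"
proof (cases "c < 1")
  case True
  have yE: "y \<in> E" using y L_sub_T True by (auto simp: T_def)
  have "\<exists>z r. r > 0 \<and> dist z y = r \<and> (\<forall>x\<in>cball z r. x \<noteq> y \<longrightarrow> x \<in> E \<and> c - u x > 0)"
  proof (rule interior_ball[OF open_E yE, where g = "\<lambda>x. - g x" and A = "\<lambda>v. - A y v"])
    show "((\<lambda>x. c - u x) has_derivative (\<lambda>v. - g x \<bullet> v)) (at x)" if "x \<in> E" for x
      using has_derivative_u[of x] that E_sub_T at_E[OF that] by (auto intro!: derivative_eq_intros)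
    show "((\<lambda>x. - g x) has_derivative (\<lambda>v. - A y v)) (at y)"
      using has_derivative_g[of y] yE E_sub_T at_E[OF yE] by (auto intro!: derivative_eq_intros)
    show "- g y \<noteq> 0" using g_L[OF y] constants by auto
    show "c - u y = 0" using y by (simp add: level_iff)
  qed
  then show ?thesis by (force simp: G_def)
next
  case False
  then have c: "c = 1" using constants by simp
  have "G = E" unfolding G_def using u_less_on_E[OF c] c by auto
  then show ?thesis using touching_ball[of y] y by (simp add: level_iff)
qed

text \<open>From \<open>y\<close> the function \<open>u\<close> decreases along every ray into the ball, so \<open>g y \<bullet> v \<le> 0\<close> on a half space. Thus the
  ball touches the level set in the direction of the gradient.\<close>

lemma gradient_at_touching_point:
  assumes y: "y \<in> L" and r: "r > 0" and zr: "dist z y = r" "cball z r - {y} \<subseteq> G"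
  shows "g y = - ((d / r) *\<^sub>R (z - y))"
proof -
  have yT: "y \<in> T" using y L_sub_T by blast
  have "\<exists>k\<ge>0. g y = - (k *\<^sub>R (z - y))"
  proof (rule nonpositive_on_half_space)
    show "z - y \<noteq> 0" using r zr by auto
    fix v assume v: "(z - y) \<bullet> v > 0"
    obtain \<epsilon> where \<epsilon>: "\<epsilon> > 0" "\<And>t. 0 < t \<Longrightarrow> t \<le> \<epsilon> \<Longrightarrow> y + t *\<^sub>R v \<in> ball z r"
      using ray_in_ball[OF r zr(1) v] by blast
    have inG: "y + t *\<^sub>R v \<in> G" if "0 < t" "t \<le> \<epsilon>" for t
    proof -
      have "y + t *\<^sub>R v \<in> ball z r" by (rule \<epsilon>(2)[OF that])
      moreover from this have "y + t *\<^sub>R v \<noteq> y" using zr(1) by auto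
      ultimately show ?thesis using zr(2) by auto
    qed
    have "y + t *\<^sub>R v \<in> S" if "t \<in> {0..\<epsilon>}" for t
      using inG[of t] that G_sub_E E_sub_S yT T_sub_S by (cases "t = 0") auto
    from has_derivative_along_ray[OF has_derivative_u[OF yT] this]
    have D: "((\<lambda>t. u (y + t *\<^sub>R v)) has_real_derivative g y \<bullet> v) (at 0 within {0..\<epsilon>})"
      by (simp add: has_real_derivative_iff_has_vector_derivative)
    show "g y \<bullet> v \<le> 0"
    proof (rule ccontr)
      assume "\<not> g y \<bullet> v \<le> 0"
      then obtain \<delta> where \<delta>: "\<delta> > 0" "\<And>h. h > 0 \<Longrightarrow> 0 + h \<in> {0..\<epsilon>} \<Longrightarrow> h < \<delta> \<Longrightarrow> u (y + 0 *\<^sub>R v) < u (y + (0 + h) *\<^sub>R v)"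
        using has_real_derivative_pos_inc_right[OF D] by auto
      define h where "h = min \<delta> \<epsilon> / 2"
      have h: "h > 0" "h < \<delta>" "h \<le> \<epsilon>" using \<delta> \<epsilon> by (auto simp: h_def min_def)
      have "u y < u (y + h *\<^sub>R v)" using \<delta>(2)[of h] h by simp
      then show False using inG[OF h(1,3)] y by (simp add: G_def level_iff)
    qed
  qed
  then obtain k where k: "k \<ge> 0" "g y = - (k *\<^sub>R (z - y))" by blast
  have "norm (g y) = k * r" using k zr by (simp add: dist_norm)
  then have "k = d / r" using g_L[OF y] r by (simp add: field_simps)
  then show ?thesis using k by simp
qed

lemma w_derivative:
  assumes y: "y \<in> L"
  shows "(w has_derivative (\<lambda>v. 2 * (A y v \<bullet> g y) * c powr (- \<gamma>)
     - d\<^sup>2 * ((g y \<bullet> v) * (\<gamma> * c powr (- \<gamma> - 1))) - P * (g y \<bullet> v))) (at y within S)"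
proof -
  have yT: "y \<in> T" using y L_sub_T by blast
  have uy: "u y = c" using y by (simp add: level_iff)
  have gg: "g y \<bullet> g y = d\<^sup>2" using g_L[OF y] by (simp add: dot_square_norm)
  have "(w has_derivative (\<lambda>v. (g y \<bullet> g y) * ((g y \<bullet> v) * ((- \<gamma>) * u y powr (- \<gamma> - 1))) + (g y \<bullet> A y v + A y v \<bullet> g y) * u y powr (- \<gamma>)
     - P * (g y \<bullet> v))) (at y within S)"
    unfolding w_def[abs_def]
    by (intro has_derivative_diff has_derivative_mult has_derivative_inner has_derivative_powr_const has_derivative_mult_right has_derivative_u has_derivative_g yT)
      (use uy constants in simp)
  then show ?thesis unfolding uy gg
    by (rule has_derivative_eq_rhs) (auto simp: inner_commute algebra_simps)
qed

text \<open>The expression is the derivative of \<open>w\<close> from \<open>w_derivative\<close> in the direction \<open>m = r \<nu>\<close>. With \<open>A \<nu> \<bullet> \<nu> = d H\<close>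
  and \<open>\<gamma> + 1 = 2 (n - 1) / (n - 2)\<close> it is a positive multiple of \<open>(n - 1) d / ((n - 2) c) - H\<close>.\<close>

lemma w_normal_derivative_nonneg:
  assumes y: "y \<in> L" and r: "r > 0" and m: "g y = - ((d / r) *\<^sub>R m)"
    and H: "mean_curvature S u y \<le> (real DIM('a) - 1) * d / ((real DIM('a) - 2) * c)"
  shows "2 * (A y m \<bullet> g y) * c powr (- \<gamma>) - d\<^sup>2 * ((g y \<bullet> m) * (\<gamma> * c powr (- \<gamma> - 1))) - P * (g y \<bullet> m) \<ge> 0"
proof -
  define \<nu> where "\<nu> = - (g y /\<^sub>R d)"
  have lin: "linear (A y)" using has_derivative_g L_sub_T y has_derivative_linear by blast
  have m\<nu>: "m = r *\<^sub>R \<nu>" using m r constants by (simp add: \<nu>_def)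
  have g\<nu>: "g y = - (d *\<^sub>R \<nu>)" using constants by (simp add: \<nu>_def)
  have nn: "\<nu> \<bullet> \<nu> = 1" using g_L[OF y] constants by (simp add: \<nu>_def dot_square_norm power2_eq_square)
  have Amg: "A y m \<bullet> g y = - (d * r) * (A y \<nu> \<bullet> \<nu>)" unfolding m\<nu> by (simp add: linear_cmul[OF lin] g\<nu>)
  have gm: "g y \<bullet> m = - (d * r)" unfolding m\<nu> by (simp add: g\<nu> nn)
  define H where "H = mean_curvature S u y"
  have AH: "A y \<nu> \<bullet> \<nu> = d * H" using mean_curvature_L[OF y] constants by (simp add: \<nu>_def H_def)
  have pw: "c powr (- \<gamma> - 1) = c powr (- \<gamma>) / c" using constants by (simp add: powr_diff)
  have n: "real DIM('a) - 2 > 0" using dim by simp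
  have "\<gamma> + 1 = 2 * ((real DIM('a) - 1) / (real DIM('a) - 2))" using n by (simp add: \<gamma>_def field_simps)
  then have "(\<gamma> + 1) * d = 2 * ((real DIM('a) - 1) * d / (real DIM('a) - 2))" by simp
  moreover have "c * H \<le> (real DIM('a) - 1) * d / (real DIM('a) - 2)"
    using assms(4) constants n by (simp add: H_def field_simps)
  ultimately have key: "(\<gamma> + 1) * d - 2 * (c * H) \<ge> 0" by linarith
  have "2 * (A y m \<bullet> g y) * c powr (- \<gamma>) - d\<^sup>2 * ((g y \<bullet> m) * (\<gamma> * c powr (- \<gamma> - 1))) - P * (g y \<bullet> m)
     = (c powr (- \<gamma>) / c * d\<^sup>2 * r) * ((\<gamma> + 1) * d - 2 * (c * H))"
    unfolding Amg gm AH pw P_def using constants by (simp add: field_simps power2_eq_square)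
  also have "\<dots> \<ge> 0" using key constants r by (intro mult_nonneg_nonneg) auto
  finally show ?thesis .
qed

text \<open>Otherwise the Hopf lemma makes \<open>w\<close> decrease linearly along the ray from \<open>y\<close> into \<open>G\<close>, while its derivative in
  this direction is nonnegative.\<close>

lemma w_has_zero:
  assumes y: "y \<in> L" and H: "mean_curvature S u y \<le> (real DIM('a) - 1) * d / ((real DIM('a) - 2) * c)"
  shows "\<exists>x\<in>G. w x = 0"
proof (rule ccontr)
  assume "\<not> (\<exists>x\<in>G. w x = 0)"
  then have neg: "w x < 0" if "x \<in> G" for x using w_nonpos[OF that] that by force
  obtain z r where zr: "r > 0" "dist z y = r" "cball z r - {y} \<subseteq> G" using touching_ball_G[OF y] by blast
  have yT: "y \<in> T" using y L_sub_T by blast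
  have bG: "ball z r \<subseteq> G" using zr by force
  have cT: "cball z r \<subseteq> T" using zr(3) yT G_sub_E E_sub_T by blast
  obtain w1 w2 where w12: "second_partials E w w1 w2" "\<And>x. x \<in> E \<Longrightarrow> (\<Sum>b\<in>Basis. w2 x b) \<ge> 0"
    using w_subharmonic by blast
  have "\<exists>\<epsilon>>0. \<forall>t. 0 < t \<and> t < 1 / 2 \<longrightarrow> w (y + t *\<^sub>R (z - y)) \<le> - \<epsilon> * t"
  proof (rule hopf_lemma[OF dim zr(1) continuous_on_subset[OF continuous_w cT] _ _ _ _ zr(2)])
    show "second_partials (ball z r) w w1 w2" using w12(1) bG G_sub_E by (auto simp: second_partials_def)
    show "\<And>x. x \<in> ball z r \<Longrightarrow> (\<Sum>b\<in>Basis. w2 x b) \<ge> 0" using w12(2) bG G_sub_E by blast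
    show "\<And>x. x \<in> cball z r \<Longrightarrow> w x \<le> 0" using zr(3) w_nonpos w_L[OF y] by force
    show "\<And>x. x \<in> cball z (r / 2) \<Longrightarrow> w x < 0" using neg bG zr(1) by force
  qed
  then obtain \<epsilon> where \<epsilon>: "\<epsilon> > 0" "\<And>t. 0 < t \<Longrightarrow> t < 1 / 2 \<Longrightarrow> w (y + t *\<^sub>R (z - y)) \<le> - \<epsilon> * t" by blast
  define D where "D = 2 * (A y (z - y) \<bullet> g y) * c powr (- \<gamma>)
     - d\<^sup>2 * ((g y \<bullet> (z - y)) * (\<gamma> * c powr (- \<gamma> - 1))) - P * (g y \<bullet> (z - y))"
  have D: "D \<ge> 0" unfolding D_def
    by (rule w_normal_derivative_nonneg[OF y zr(1) gradient_at_touching_point[OF y zr] H])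
  have ray: "y + t *\<^sub>R (z - y) \<in> S" if "t \<in> {0..1}" for t
  proof -
    have "z - (y + t *\<^sub>R (z - y)) = (1 - t) *\<^sub>R (z - y)" by (simp add: algebra_simps)
    then have "dist z (y + t *\<^sub>R (z - y)) = (1 - t) * r" using that zr(2) by (simp add: dist_norm)
    also have "\<dots> \<le> 1 * r" using that zr(1) by (intro mult_right_mono) auto
    finally have "y + t *\<^sub>R (z - y) \<in> cball z r" by simp
    then show ?thesis using cT T_sub_S by blast
  qed
  have "((\<lambda>t. w (y + t *\<^sub>R (z - y))) has_real_derivative D) (at 0 within {0..1})"
    using has_derivative_along_ray[OF w_derivative[OF y] ray]
    by (simp add: has_real_derivative_iff_has_vector_derivative D_def)
  then have "((\<lambda>t. w (y + t *\<^sub>R (z - y)) + \<epsilon> * t) has_real_derivative D + \<epsilon>) (at 0 within {0..1})"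
    by (auto intro!: derivative_eq_intros)
  from has_real_derivative_pos_inc_right[OF this] D \<epsilon>(1) obtain \<delta> where \<delta>: "\<delta> > 0"
    "\<And>h. h > 0 \<Longrightarrow> 0 + h \<in> {0..1} \<Longrightarrow> h < \<delta> \<Longrightarrow> w (y + 0 *\<^sub>R (z - y)) + \<epsilon> * 0 < w (y + (0 + h) *\<^sub>R (z - y)) + \<epsilon> * (0 + h)" by auto
  define h where "h = min \<delta> (1 / 2) / 2"
  have h: "h > 0" "h < \<delta>" "h < 1 / 2" using \<delta>(1) by (auto simp: h_def min_def)
  show False using \<delta>(2)[of h] \<epsilon>(2)[of h] h w_L[OF y] by simp
qed

theorem radial_symmetry:
  assumes y: "y \<in> L" and H: "mean_curvature S u y \<le> (real DIM('a) - 1) * d / ((real DIM('a) - 2) * c)"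
  shows "\<exists>p. \<exists>r>0. \<Omega> = ball p r \<and> (\<forall>x\<in>- \<Omega>. \<forall>y\<in>- \<Omega>. dist p x = dist p y \<longrightarrow> u x = u y)"
proof -
  obtain q where q: "q \<in> G" "w q = 0" using w_has_zero[OF assms] by blast
  obtain \<delta>' where \<delta>': "\<delta>' > 0" "cball q \<delta>' \<subseteq> G" using open_G q open_contains_cball by blast
  define \<delta> where "\<delta> = \<delta>' / 2"
  have \<delta>: "\<delta> > 0" "cball q (2 * \<delta>) \<subseteq> G" using \<delta>' by (auto simp: \<delta>_def)
  define V where "V = ball q \<delta>"
  have "V \<subseteq> cball q (2 * \<delta>)" using \<delta>(1) by (auto simp: V_def)
  then have "V \<subseteq> E" using \<delta>(2) G_sub_E by blast
  then have V: "open V" "connected V" "V \<noteq> {}" "V \<subseteq> E" using \<delta>(1) by (simp_all add: V_def)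
  obtain w1 w2 where w12: "second_partials E w w1 w2" "\<And>x. x \<in> E \<Longrightarrow> (\<Sum>b\<in>Basis. w2 x b) \<ge> 0"
    using w_subharmonic by blast
  have pos: "u x > 0" if "x \<in> E" for x using that u_pos E_sub_S by blast
  have diff: "w differentiable (at x)" if x: "x \<in> E" for x
  proof -
    have "(\<lambda>x. grad_power u x + (- P) * u x) differentiable (at x)"
      using grad_power_differentiable[OF harm x pos[OF x]] harm x
      by (intro differentiable_add differentiable_mult) (auto simp: harmonic_on_def)
    then obtain D where "((\<lambda>x. grad_power u x + (- P) * u x) has_derivative D) (at x)" by (auto simp: differentiable_def)
    then have "(w has_derivative D) (at x)"
      by (rule has_derivative_transform_within_open[OF _ open_E x]) (simp add: w_E)
    then show ?thesis by (auto simp: differentiable_def)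
  qed
  have "w x = 0" if "x \<in> V" for x
  proof (rule strong_maximum_principle[where w = w and ?w1.0 = w1 and ?w2.0 = w2 and q = q, OF dim open_G _ _ _ w_nonpos q(2) \<delta> that[unfolded V_def]])
    show "second_partials G w w1 w2" using w12(1) G_sub_E by (auto simp: second_partials_def)
  qed (use diff w12(2) G_sub_E in auto)
  then have "grad_power u x = P * u x" if "x \<in> V" for x using w_E[of x] that V(4) by force
  then have "\<exists>p \<kappa>. \<kappa> > 0 \<and> (\<forall>x\<in>V. x \<noteq> p \<and> u x = \<kappa> * fundamental_solution p x)"
    using pos V by (intro rigidity[OF dim V(1-3) harmonic_on_subset[OF harm V(1,4)] _ P_pos]) auto
  then obtain p \<kappa> where p: "\<kappa> > 0" "\<And>x. x \<in> V \<Longrightarrow> x \<noteq> p \<and> u x = \<kappa> * fundamental_solution p x" by blast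
  have o: "open (E - {p})" using open_E by auto
  have "connected (E - {p})" by (rule connected_open_delete[OF open_E connected_E]) (use dim in simp)
  have h: "harmonic_on (E - {p}) (\<lambda>x. 1 * u x + (- \<kappa>) * fundamental_solution p x)"
    by (intro harmonic_on_lincomb harmonic_on_subset[OF harm o] harmonic_on_subset[OF harmonic_on_fundamental_solution o]) auto
  have "u x = \<kappa> * fundamental_solution p x" if "x \<in> - closure \<Omega>" "x \<noteq> p" for x
  proof -
    have "1 * u x + (- \<kappa>) * fundamental_solution p x = 0"
      by (rule harmonic_unique_continuation[OF h \<open>connected (E - {p})\<close> V(1,3)]) (use p V(4) that in \<open>auto simp: E_def\<close>)
    then show ?thesis by simp
  qed
  then have "\<exists>r>0. \<Omega> = ball p r \<and> (\<forall>x\<in>- \<Omega>. \<forall>y\<in>- \<Omega>. dist p x = dist p y \<longrightarrow> u x = u y)"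
    using S_sub_closure u_le
    by (intro domain_is_ball[OF dim domain(1,2) _ continuous _ boundary p(1)]) (auto simp: S_def E_def)
  then show ?thesis by blast
qed

end

text \<open>The mean curvature attains its infimum on the compact level set, and there the curvature condition becomes
  the pointwise bound required by \<open>radial_symmetry\<close>.\<close>

theorem theorem1p5:
  fixes \<Omega> :: "(real ^ 'n) set" and u :: "real ^ 'n \<Rightarrow> real" and c d :: real
  assumes dim: "CARD('n) \<ge> 3"
    and domain: "open \<Omega>" "connected \<Omega>" "bounded \<Omega>" "0 \<in> \<Omega>" "smooth_boundary \<Omega>"
    and exterior: "c < 1 \<longrightarrow> connected (- closure \<Omega>)"
    and continuous: "continuous_on (- \<Omega>) u"
    and C2: "higher_differentiable_on (- closure \<Omega>) u 2"
    and C2_boundary: "c = 1 \<longrightarrow> higher_differentiable_on (- \<Omega>) u 2"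
    and harmonic: "\<And>x. x \<in> - closure \<Omega> \<Longrightarrow> - laplacian u x = 0"
    and boundary: "\<And>x. x \<in> frontier \<Omega> \<Longrightarrow> u x = 1"
    and infinity: "(u \<longlongrightarrow> 0) at_infinity"
    and constants: "0 < c" "c \<le> 1" "0 < d"
    and gradient: "\<And>x. x \<in> level_set \<Omega> u c \<Longrightarrow> norm (grad_within (- \<Omega>) u x) = d"
    and curvature: "\<And>x. x \<in> level_set \<Omega> u c \<Longrightarrow>
        (INF y\<in>level_set \<Omega> u c. mean_curvature (- \<Omega>) u y / (real CARD('n) - 1))
          \<le> norm (grad_within (- \<Omega>) u x) / ((real CARD('n) - 2) * u x)"
  shows "\<exists>p r. r > 0 \<and> \<Omega> = ball p r \<and>
           (\<forall>x\<in>- \<Omega>. \<forall>y\<in>- \<Omega>. dist p x = dist p y \<longrightarrow> u x = u y)"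
proof -
  interpret overdetermined_potential \<Omega> u c d
  proof
    show "DIM(real ^ 'n) \<ge> 3" using dim by simp
    show "harmonic_on (- closure \<Omega>) u"
      using harmonic by (intro harmonic_onI_laplacian C2) (auto simp: open_Compl)
  qed (fact domain exterior continuous C2_boundary boundary infinity constants gradient)+
  define n where "n = real CARD('n)"
  have n: "n \<ge> 3" using dim by (simp add: n_def)
  obtain y where y: "y \<in> L" and min: "\<And>x. x \<in> L \<Longrightarrow> mean_curvature S u y \<le> mean_curvature S u x"
    using continuous_attains_inf[OF compact_L L_nonempty continuous_mean_curvature] by blast
  have "mean_curvature S u y / (n - 1) \<le> (INF x\<in>L. mean_curvature S u x / (n - 1))"
    using n min by (intro cINF_greatest L_nonempty divide_right_mono) auto
  also have "\<dots> \<le> norm (grad_within (- \<Omega>) u y) / ((n - 2) * u y)"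
    using curvature[of y] y by (simp add: L_def S_def n_def)
  also have "\<dots> = d / ((n - 2) * c)"
    using gradient[of y] y by (simp add: L_def level_set_def)
  finally have "mean_curvature S u y \<le> d / ((n - 2) * c) * (n - 1)"
    using n by (simp add: pos_divide_le_eq)
  then have "mean_curvature S u y \<le> (real DIM(real ^ 'n) - 1) * d / ((real DIM(real ^ 'n) - 2) * c)"
    by (simp add: n_def mult.commute)
  from radial_symmetry[OF y this] show ?thesis by blast
qed

end
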